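(* Let $A$ be an attributed tree transducer without look-around ($att$) or with look-around ($att^U$) that is functional, i.e. $\tau_A$ is a partial function. Then a deterministic attributed tree transducer with look-around ($datt^U$) $D$ can be effectively constructed such that $\tau_D=\tau_A$.
   Context: Trees. A ranked alphabet $\Sigma$ is a finite set of symbols each with a unique rank $k\ge 0$; $\Sigma_k$ is the set of symbols of rank $k$; $T_\Sigma$ is the set of (finite ordered) trees over $\Sigma$, and $[k]=\{1,\dots,k\}$. Nodes are strings over $\mathbb{N}$: the root is $\epsilon$, the $i$-th child of $v$ is $v.i$; $V(t)$ is the set of nodes of $t$ and $t[v]$ the label of $v$. For a set $\Lambda$ disjoint from $\Sigma$, $T_\Sigma[\Lambda]$ is the set of trees over $\Sigma$ where elements of $\Lambda$ may also occur as leaf labels. Attributed tree transducers. An $att$ is $A=(S,I,\Sigma,\Delta,a_0,R)$ where $S,I$ are disjoint finite sets of synthesized and inherited attributes, $\Sigma,\Delta$ are ranked alphabets (input, output), $a_0\in S$ is the initial attribute, and $R=(R_\sigma\mid\sigma\in\Sigma\cup\{\#\})$ is a collection of finite rule sets, where $\#\notin\Sigma$ is a root marker of rank 1. For $\sigma\in\Sigma_k$, $R_\sigma$ contains arbitrarily many rules $a(\pi)\to\xi$ for each $a\in S$ and arbitrarily many rules $b(\pi i)\to\xi$ for each $b\in I$, $i\in[k]$, with $\xi\in T_\Delta[\{a'(\pi i)\mid a'\in S,i\in[k]\}\cup\{b'(\pi)\mid b'\in I\}]$ ($\pi$ is a node variable). $R_\#$ is defined analogously (with $k=1$), but contains no rules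 with synthesized attributes on the left-hand side and no inherited attributes on right-hand sides. $A$ is deterministic (a $datt$) if each left-hand side has at most one rule in each $R_\sigma$ and in $R_\#$. Semantics. For $s\in T_\Sigma$ let $s^\#=\#(s)$ and $\mathrm{SI}(s^\#)=\{\alpha(v)\mid \alpha\in S\cup I, v\in V(s^\#)\}$. With the conventions $\pi 0=\pi$, $v.0=v$, for $t,t'\in T_\Delta[\mathrm{SI}(s^\#)]$ write $t\Rightarrow_{A,s^\#}t'$ if $t'$ arises from $t$ by replacing one leaf labeled $\gamma(v.i)$ (where $i=0$ if $\gamma\in S$, and $i>0$ if $\gamma\in I$) by $\xi[\pi\leftarrow v]$ for some rule $\gamma(\pi i)\to\xi$ in $R_{s^\#[v]}$, where $[\pi\leftarrow v]$ replaces every occurrence of $\pi$ by $v$. The translation of $A$ is $\tau_A=\{(s,t)\in T_\Sigma\times T_\Delta\mid a_0(1)\Rightarrow^*_{A,s^\#}t\}$. Circular $atts$ (where some $\alpha(v)$ derives in one or more steps a tree containing $\alpha(v)$) are allowed. Look-around. A bottom-up relabeling is $B=(P,\Sigma,\Sigma',F,R)$ with finite state set $P$, ranked alphabets $\Sigma,\Sigma'$, final states $F\subseteq P$, and for every $\sigma\in\Sigma_k$, $p_1,\dots,p_k\in P$ at most one rule $\sigma(p_1(x_1),\dots,p_k(x_k))\to p(\sigma'(x_1,\dots,x_k))$ with $p\in P$, $\sigma'\in\Sigma'_k$; it relabels trees bottom-up in the usual way and $\tau_B=\{(s,s')\mid s\Rightarrow_B^* p(s'),\ p\in F\}$. A top-down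 relabeling is a $datt$ without inherited attributes in which every rule for $\sigma\in\Sigma_k$ has the form $q(\pi)\to\sigma'(q_1(\pi1),\dots,q_k(\pi k))$ with $\sigma'$ of rank $k$. A look-around is a pair $U=(B,T)$ of a bottom-up relabeling $B$ and a top-down relabeling $T$, with $\tau_U=\tau_B\circ\tau_T$ (first $B$, then $T$). An $att$ with look-around ($att^U$) is a pair $(U,A')$ of a look-around $U$ and an $att$ $A'$, realizing $\tau_U\circ\tau_{A'}$ (first $U$, then $A'$); it is a $datt^U$ if $A'$ is a $datt$. Relation composition is $\rho\circ\rho'=\{(x,z)\mid\exists y:(x,y)\in\rho,(y,z)\in\rho'\}$. A relation $\rho$ is a (partial) function if $(x,y),(x,y')\in\rho$ implies $y=y'$. *)

theory Defs
  imports Main "HOL-Library.Nat_Bijection"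
begin

datatype 'a tree = Node 'a "'a tree list"

definition ranked_alphabet :: "('a \<times> nat) set \<Rightarrow> bool" where
  "ranked_alphabet \<Sigma> \<longleftrightarrow> finite \<Sigma> \<and> single_valued \<Sigma>"

inductive_set trees :: "('a \<times> nat) set \<Rightarrow> 'a tree set" for \<Sigma> where
  "(f, length ts) \<in> \<Sigma> \<Longrightarrow> \<forall>t\<in>set ts. t \<in> trees \<Sigma> \<Longrightarrow> Node f ts \<in> trees \<Sigma>"

text \<open>Trees over \<open>\<Sigma>\<close> with additional leaf labels from \<open>\<Lambda>\<close>; the sum type makes
  \<open>\<Sigma>\<close> and \<open>\<Lambda>\<close> disjoint.\<close>

definition trees_with :: "('a \<times> nat) set \<Rightarrow> 'l set \<Rightarrow> ('a + 'l) tree set" where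
  "trees_with \<Sigma> \<Lambda> = trees ((\<lambda>(f, k). (Inl f, k)) ` \<Sigma> \<union> (\<lambda>x. (Inr x, 0)) ` \<Lambda>)"

text \<open>Nodes are lists of child numbers, and children are numbered from 1.\<close>

type_synonym node = "nat list"

fun label_at :: "'a tree \<Rightarrow> node \<Rightarrow> 'a option" where
  "label_at (Node f ts) [] = Some f"
| "label_at (Node f ts) (i # v) =
    (if 1 \<le> i \<and> i \<le> length ts then label_at (ts ! (i - 1)) v else None)"

definition nodes :: "'a tree \<Rightarrow> node set" where
  "nodes t = {v. label_at t v \<noteq> None}"

definition child :: "node \<Rightarrow> nat \<Rightarrow> node" where
  "child v i = (if i = 0 then v else v @ [i])"

text \<open>\<open>s\<^sup>#\<close>: the root marker \<open>#\<close> is \<^term>\<open>None\<close>, an input symbol \<open>f\<close> is \<^term>\<open>Some f\<close>.\<close>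

definition marked :: "'a tree \<Rightarrow> 'a option tree" where
  "marked s = Node None [map_tree Some s]"

text \<open>The pair \<open>(\<gamma>, i)\<close> stands for \<open>\<gamma>(\<pi> i)\<close>, where \<open>\<pi> 0 = \<pi>\<close>. The family of rule sets is
  given as one set: \<open>(x, (\<gamma>, i), \<xi>)\<close> is the rule \<open>\<gamma>(\<pi> i) \<rightarrow> \<xi>\<close> of \<open>R\<^sub>x\<close>.\<close>

type_synonym ('q, 'a, 'b) att_rule = "'a option \<times> ('q \<times> nat) \<times> ('b + 'q \<times> nat) tree"

record ('q, 'a, 'b) att =
  syn :: "'q set"
  inh :: "'q set"
  in_alph :: "('a \<times> nat) set"
  out_alph :: "('b \<times> nat) set"
  init :: 'q
  rules :: "('q, 'a, 'b) att_rule set"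

definition is_att_rule :: "('q, 'a, 'b) att \<Rightarrow> ('q, 'a, 'b) att_rule \<Rightarrow> bool" where
  "is_att_rule A = (\<lambda>(x, (\<gamma>, i), \<xi>).
    case x of
      Some f \<Rightarrow> \<exists>k. (f, k) \<in> in_alph A \<and>
        (\<gamma> \<in> syn A \<and> i = 0 \<or> \<gamma> \<in> inh A \<and> i \<in> {1..k}) \<and>
        \<xi> \<in> trees_with (out_alph A) (syn A \<times> {1..k} \<union> inh A \<times> {0})
    | None \<Rightarrow> \<gamma> \<in> inh A \<and> i = 1 \<and> \<xi> \<in> trees_with (out_alph A) (syn A \<times> {1}))"

definition is_att :: "('q, 'a, 'b) att \<Rightarrow> bool" where
  "is_att A \<longleftrightarrow> finite (syn A) \<and> finite (inh A) \<and> syn A \<inter> inh A = {} \<and>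
    ranked_alphabet (in_alph A) \<and> ranked_alphabet (out_alph A) \<and> init A \<in> syn A \<and>
    finite (rules A) \<and> (\<forall>r\<in>rules A. is_att_rule A r)"

definition deterministic :: "('q, 'a, 'b) att \<Rightarrow> bool" where
  "deterministic A \<longleftrightarrow>
    (\<forall>x l \<xi> \<xi>'. (x, l, \<xi>) \<in> rules A \<and> (x, l, \<xi>') \<in> rules A \<longrightarrow> \<xi> = \<xi>')"

definition is_datt :: "('q, 'a, 'b) att \<Rightarrow> bool" where
  "is_datt A \<longleftrightarrow> is_att A \<and> deterministic A"

definition attribute_instances :: "('q, 'a, 'b) att \<Rightarrow> 'a tree \<Rightarrow> ('q \<times> node) set" where
  "attribute_instances A s = (syn A \<union> inh A) \<times> nodes (marked s)"

definition instantiate :: "node \<Rightarrow> ('b + 'q \<times> nat) tree \<Rightarrow> ('b + 'q \<times> node) tree" where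
  "instantiate v = map_tree (map_sum id (\<lambda>(\<gamma>, i). (\<gamma>, child v i)))"

inductive rewrite ::
  "('q, 'a, 'b) att \<Rightarrow> 'a tree \<Rightarrow> ('b + 'q \<times> node) tree \<Rightarrow> ('b + 'q \<times> node) tree \<Rightarrow> bool"
  for A s where
  leaf: "label_at (marked s) v = Some x \<Longrightarrow> (x, (\<gamma>, i), \<xi>) \<in> rules A \<Longrightarrow>
    \<gamma> \<in> syn A \<and> i = 0 \<or> \<gamma> \<in> inh A \<and> i > 0 \<Longrightarrow>
    rewrite A s (Node (Inr (\<gamma>, child v i)) []) (instantiate v \<xi>)"
| inner: "rewrite A s t t' \<Longrightarrow> rewrite A s (Node f (us @ t # ws)) (Node f (us @ t' # ws))"

definition step ::
  "('q, 'a, 'b) att \<Rightarrow> 'a tree \<Rightarrow> ('b + 'q \<times> node) tree \<Rightarrow> ('b + 'q \<times> node) tree \<Rightarrow> bool" where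
  "step A s t t' \<longleftrightarrow>
    t \<in> trees_with (out_alph A) (attribute_instances A s) \<and>
    t' \<in> trees_with (out_alph A) (attribute_instances A s) \<and> rewrite A s t t'"

definition att_translation :: "('q, 'a, 'b) att \<Rightarrow> ('a tree \<times> 'b tree) set" where
  "att_translation A = {(s, t). s \<in> trees (in_alph A) \<and> t \<in> trees (out_alph A) \<and>
    (step A s)\<^sup>*\<^sup>* (Node (Inr (init A, [1])) []) (map_tree Inl t)}"

text \<open>\<open>(f, ps, p, g)\<close> is the rule \<open>f(p\<^sub>1(x\<^sub>1), \<dots>, p\<^sub>k(x\<^sub>k)) \<rightarrow> p(g(x\<^sub>1, \<dots>, x\<^sub>k))\<close>.\<close>

record ('p, 'a, 'b) bu =
  states :: "'p set"
  bu_in :: "('a \<times> nat) set"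
  bu_out :: "('b \<times> nat) set"
  final :: "'p set"
  bu_rules :: "('a \<times> 'p list \<times> 'p \<times> 'b) set"

definition is_bu_relabeling :: "('p, 'a, 'b) bu \<Rightarrow> bool" where
  "is_bu_relabeling B \<longleftrightarrow> finite (states B) \<and>
    ranked_alphabet (bu_in B) \<and> ranked_alphabet (bu_out B) \<and> final B \<subseteq> states B \<and>
    finite (bu_rules B) \<and>
    (\<forall>(f, ps, p, g)\<in>bu_rules B. set ps \<subseteq> states B \<and> p \<in> states B \<and>
      (f, length ps) \<in> bu_in B \<and> (g, length ps) \<in> bu_out B) \<and>
    (\<forall>f ps p g p' g'. (f, ps, p, g) \<in> bu_rules B \<and> (f, ps, p', g') \<in> bu_rules B \<longrightarrow>
      p = p' \<and> g = g')"

text \<open>\<open>bu_run B s p s'\<close> means \<open>s \<Rightarrow>\<^sub>B\<^sup>* p(s')\<close>.\<close>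

inductive bu_run :: "('p, 'a, 'b) bu \<Rightarrow> 'a tree \<Rightarrow> 'p \<Rightarrow> 'b tree \<Rightarrow> bool" for B where
  "(f, ps, p, g) \<in> bu_rules B \<Longrightarrow> length ps = length ts \<Longrightarrow> length ts' = length ts \<Longrightarrow>
    \<forall>i<length ts. bu_run B (ts ! i) (ps ! i) (ts' ! i) \<Longrightarrow>
    bu_run B (Node f ts) p (Node g ts')"

definition bu_translation :: "('p, 'a, 'b) bu \<Rightarrow> ('a tree \<times> 'b tree) set" where
  "bu_translation B = {(s, s'). \<exists>p\<in>final B. bu_run B s p s'}"

definition is_td_relabeling :: "('q, 'a, 'b) att \<Rightarrow> bool" where
  "is_td_relabeling T \<longleftrightarrow> is_datt T \<and> inh T = {} \<and>
    (\<forall>(x, l, \<xi>)\<in>rules T. \<exists>f g qs. x = Some f \<and> (f, length qs) \<in> in_alph T \<and>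
      (g, length qs) \<in> out_alph T \<and>
      \<xi> = Node (Inl g) (map (\<lambda>i. Node (Inr (qs ! i, Suc i)) []) [0..<length qs]))"

type_synonym ('p, 'r, 'a, 'c, 'd) look_around = "('p, 'a, 'c) bu \<times> ('r, 'c, 'd) att"

definition is_look_around :: "('p, 'r, 'a, 'c, 'd) look_around \<Rightarrow> bool" where
  "is_look_around = (\<lambda>(B, T). is_bu_relabeling B \<and> is_td_relabeling T \<and> bu_out B = in_alph T)"

definition look_around_translation ::
  "('p, 'r, 'a, 'c, 'd) look_around \<Rightarrow> ('a tree \<times> 'd tree) set" where
  "look_around_translation = (\<lambda>(B, T). bu_translation B O att_translation T)"

type_synonym ('p, 'r, 'q, 'a, 'c, 'd, 'b) attU =
  "('p, 'r, 'a, 'c, 'd) look_around \<times> ('q, 'd, 'b) att"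

definition is_attU :: "('p, 'r, 'q, 'a, 'c, 'd, 'b) attU \<Rightarrow> bool" where
  "is_attU = (\<lambda>(U, A). is_look_around U \<and> is_att A \<and> out_alph (snd U) = in_alph A)"

definition is_dattU :: "('p, 'r, 'q, 'a, 'c, 'd, 'b) attU \<Rightarrow> bool" where
  "is_dattU = (\<lambda>(U, A). is_attU (U, A) \<and> is_datt A)"

definition attU_translation :: "('p, 'r, 'q, 'a, 'c, 'd, 'b) attU \<Rightarrow> ('a tree \<times> 'b tree) set" where
  "attU_translation = (\<lambda>(U, A). look_around_translation U O att_translation A)"

text \<open>Kleene's partial recursive functions: \<open>computes f xs y\<close> says that \<open>f\<close> halts on the
  arguments \<open>xs\<close> with value \<open>y\<close>.\<close>

datatype recf = Zero | Succ | Proj nat | Comp recf "recf list" | PrimRec recf recf | Mu recf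

inductive computes :: "recf \<Rightarrow> nat list \<Rightarrow> nat \<Rightarrow> bool" where
  zero: "computes Zero xs 0"
| succ: "computes Succ [x] (Suc x)"
| proj: "i < length xs \<Longrightarrow> computes (Proj i) xs (xs ! i)"
| comp: "list_all2 (\<lambda>g y. computes g xs y) gs ys \<Longrightarrow> computes f ys z \<Longrightarrow>
    computes (Comp f gs) xs z"
| rec_0: "computes f xs y \<Longrightarrow> computes (PrimRec f g) (0 # xs) y"
| rec_Suc: "computes (PrimRec f g) (n # xs) y \<Longrightarrow> computes g (n # y # xs) z \<Longrightarrow>
    computes (PrimRec f g) (Suc n # xs) z"
| mu: "computes f (n # xs) 0 \<Longrightarrow> \<forall>m<n. \<exists>y. computes f (m # xs) (Suc y) \<Longrightarrow>
    computes (Mu f) xs n"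

inductive_cases computes_elims:
  "computes Zero xs z" "computes Succ xs z" "computes (Proj i) xs z"
  "computes (Comp f gs) xs z" "computes (PrimRec f g) (0 # xs) z"
  "computes (PrimRec f g) (Suc n # xs) z" "computes (Mu f) xs z"

lemma computes_unique: "computes f xs y \<Longrightarrow> computes f xs z \<Longrightarrow> y = z"
proof (induction arbitrary: z rule: computes.induct)
  case (comp xs gs ys f y)
  from comp.prems obtain ys' where
    ys': "list_all2 (\<lambda>g y. computes g xs y) gs ys'" "computes f ys' z"
    by (rule computes_elims(4))
  have "ys = ys'"
    using comp.IH(1) ys'(1) by (auto simp: list_all2_conv_all_nth intro!: nth_equalityI)
  then show ?case using comp.IH(2) ys'(2) by blast
next
  case (mu f n xs)
  from mu.prems have z: "computes f (z # xs) 0" "\<forall>m<z. \<exists>y. computes f (m # xs) (Suc y)"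
    by (blast elim: computes_elims(7))+
  show ?case
  proof (rule linorder_cases[of n z])
    assume "n < z"
    then obtain y where "computes f (n # xs) (Suc y)" using z(2) by blast
    then show ?thesis using mu.IH(1) by blast
  next
    assume "z < n"
    then obtain y where "\<forall>w. computes f (z # xs) w \<longrightarrow> Suc y = w" using mu.IH(2) by blast
    then show ?thesis using z(1) by blast
  qed
next
  case (rec_Suc f g n xs y w)
  from rec_Suc.prems obtain y' where
    "computes (PrimRec f g) (n # xs) y'" "computes g (n # y' # xs) z"
    by (rule computes_elims(6))
  then show ?case using rec_Suc.IH by blast
qed (blast elim: computes_elims)+

text \<open>Transducers are given to algorithms by numbers, with all names (of symbols, states and
  attributes) being natural numbers and each finite set listed in an arbitrary order. So a
  transducer has several codes, while a code determines the transducer.\<close>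

definition set_code :: "('x \<Rightarrow> nat) \<Rightarrow> 'x set \<Rightarrow> nat \<Rightarrow> bool" where
  "set_code c X n \<longleftrightarrow> (\<exists>xs. set xs = X \<and> n = list_encode (map c xs))"

primrec tree_code :: "nat tree \<Rightarrow> nat" where
  "tree_code (Node f ts) = prod_encode (f, list_encode (map tree_code ts))"

fun symbol_code :: "nat option \<Rightarrow> nat" where
  "symbol_code None = 0"
| "symbol_code (Some f) = Suc f"

definition att_rule_code :: "(nat, nat, nat) att_rule \<Rightarrow> nat" where
  "att_rule_code = (\<lambda>(x, l, \<xi>). list_encode [symbol_code x, prod_encode l,
    tree_code (map_tree (\<lambda>y. sum_encode (map_sum id prod_encode y)) \<xi>)])"

definition att_code :: "(nat, nat, nat) att \<Rightarrow> nat \<Rightarrow> bool" where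
  "att_code A n \<longleftrightarrow> (\<exists>s i a b r. set_code id (syn A) s \<and> set_code id (inh A) i \<and>
    set_code prod_encode (in_alph A) a \<and> set_code prod_encode (out_alph A) b \<and>
    set_code att_rule_code (rules A) r \<and> n = list_encode [s, i, a, b, init A, r])"

definition bu_rule_code :: "nat \<times> nat list \<times> nat \<times> nat \<Rightarrow> nat" where
  "bu_rule_code = (\<lambda>(f, ps, p, g). list_encode [f, list_encode ps, p, g])"

definition bu_code :: "(nat, nat, nat) bu \<Rightarrow> nat \<Rightarrow> bool" where
  "bu_code B n \<longleftrightarrow> (\<exists>s a b e r. set_code id (states B) s \<and>
    set_code prod_encode (bu_in B) a \<and> set_code prod_encode (bu_out B) b \<and>
    set_code id (final B) e \<and> set_code bu_rule_code (bu_rules B) r \<and>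
    n = list_encode [s, a, b, e, r])"

definition attU_code :: "(nat, nat, nat, nat, nat, nat, nat) attU \<Rightarrow> nat \<Rightarrow> bool" where
  "attU_code = (\<lambda>((B, T), A) n. \<exists>b t a. bu_code B b \<and> att_code T t \<and> att_code A a \<and>
    n = list_encode [b, t, a])"

lemma set_code_exists: "finite X \<Longrightarrow> \<exists>n. set_code c X n"
  unfolding set_code_def using finite_list by blast

lemma set_code_unique:
  assumes "inj c" "set_code c X n" "set_code c Y n"
  shows "X = Y"
  using assms unfolding set_code_def by (auto simp: list_encode_eq inj_map_eq_map)

lemma inj_tree_code: "inj tree_code"
proof (rule injI)
  show "s = t" if "tree_code s = tree_code t" for s t :: "nat tree"
    using that
  proof (induction s arbitrary: t)
    case (Node f ts)
    obtain g us where t: "t = Node g us" by (cases t)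
    have eq: "f = g" "map tree_code ts = map tree_code us"
      using Node.prems by (auto simp: t prod_encode_eq list_encode_eq)
    have len: "length ts = length us"
      using map_eq_imp_length_eq[OF eq(2)] .
    have "ts = us"
    proof (rule nth_equalityI[OF len])
      fix i assume i: "i < length ts"
      have "tree_code (ts ! i) = tree_code (us ! i)"
        using arg_cong[OF eq(2), of "\<lambda>l. l ! i"] i len by simp
      then show "ts ! i = us ! i" using Node.IH i by auto
    qed
    then show ?case using eq t by simp
  qed
qed

lemma symbol_code_eq: "symbol_code x = symbol_code y \<Longrightarrow> x = y"
  by (cases x; cases y) auto

lemma inj_att_rule_code: "inj att_rule_code"
proof -
  have "inj (\<lambda>y :: nat + nat \<times> nat. sum_encode (map_sum id prod_encode y))"
    by (rule injI) (auto simp: sum_encode_eq prod_encode_eq map_sum_def split: sum.splits)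
  then have "inj (map_tree (\<lambda>y :: nat + nat \<times> nat. sum_encode (map_sum id prod_encode y)))"
    by (rule tree.inj_map)
  then show ?thesis
    by (intro injI)
      (auto simp: att_rule_code_def list_encode_eq prod_encode_eq dest!: symbol_code_eq injD[OF inj_tree_code] dest: injD)
qed

lemma inj_bu_rule_code: "inj bu_rule_code"
  by (rule injI) (auto simp: bu_rule_code_def list_encode_eq)

lemma att_code_exists:
  assumes "is_att A"
  shows "\<exists>n. att_code A n"
proof -
  have "finite (syn A)" "finite (inh A)" "finite (in_alph A)" "finite (out_alph A)"
    "finite (rules A)"
    using assms by (simp_all add: is_att_def ranked_alphabet_def)
  then show ?thesis
    unfolding att_code_def using set_code_exists by (metis (full_types))
qed

lemma att_code_unique:
  assumes "att_code A n" "att_code A' n"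
  shows "A = A'"
  using assms unfolding att_code_def
  by (auto simp: list_encode_eq intro!: att.equality
      dest: set_code_unique[OF inj_on_id] set_code_unique[OF inj_prod_encode]
        set_code_unique[OF inj_att_rule_code])

lemma bu_code_exists:
  assumes "is_bu_relabeling B"
  shows "\<exists>n. bu_code B n"
proof -
  have "finite (states B)" "finite (bu_in B)" "finite (bu_out B)" "finite (final B)"
    "finite (bu_rules B)"
    using assms finite_subset[of "final B" "states B"]
    by (simp_all add: is_bu_relabeling_def ranked_alphabet_def)
  then show ?thesis
    unfolding bu_code_def using set_code_exists by (metis (full_types))
qed

lemma bu_code_unique:
  assumes "bu_code B n" "bu_code B' n"
  shows "B = B'"
proof -
  obtain s a b e r where 1: "set_code id (states B) s" "set_code prod_encode (bu_in B) a"
    "set_code prod_encode (bu_out B) b" "set_code id (final B) e"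
    "set_code bu_rule_code (bu_rules B) r" "n = list_encode [s, a, b, e, r]"
    using assms(1) unfolding bu_code_def by blast
  obtain s' a' b' e' r' where 2: "set_code id (states B') s'" "set_code prod_encode (bu_in B') a'"
    "set_code prod_encode (bu_out B') b'" "set_code id (final B') e'"
    "set_code bu_rule_code (bu_rules B') r'" "n = list_encode [s', a', b', e', r']"
    using assms(2) unfolding bu_code_def by blast
  have "[s, a, b, e, r] = [s', a', b', e', r']"
    using 1(6) 2(6) list_encode_eq by metis
  with 1 2 show ?thesis
    by (intro bu.equality)
      (simp_all add: set_code_unique[OF inj_on_id 1(1)] set_code_unique[OF inj_on_id 1(4)]
        set_code_unique[OF inj_prod_encode 1(2)] set_code_unique[OF inj_prod_encode 1(3)]
        set_code_unique[OF inj_bu_rule_code 1(5)])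
qed

lemma attU_code_exists:
  assumes "is_attU M"
  shows "\<exists>n. attU_code M n"
proof -
  obtain B T A where M: "M = ((B, T), A)" by (metis surj_pair)
  have "is_bu_relabeling B" "is_att T" "is_att A"
    using assms
    by (auto simp: M is_attU_def is_look_around_def is_td_relabeling_def is_datt_def)
  then obtain b t a where "bu_code B b" "att_code T t" "att_code A a"
    using att_code_exists[of T] att_code_exists[of A] bu_code_exists[of B] by auto
  then have "attU_code M (list_encode [b, t, a])"
    unfolding M attU_code_def prod.case by blast
  then show ?thesis by blast
qed

lemma attU_code_unique:
  assumes "attU_code M n" "attU_code M' n"
  shows "M = M'"
proof -
  obtain B T A B' T' A' where M: "M = ((B, T), A)" "M' = ((B', T'), A')"
    by (metis surj_pair)
  from assms(1) obtain b t a where 1: "bu_code B b" "att_code T t" "att_code A a"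
    "n = list_encode [b, t, a]"
    by (auto simp: M attU_code_def)
  from assms(2) have "bu_code B' b" "att_code T' t" "att_code A' a"
    by (auto simp: M attU_code_def 1(4) list_encode_eq simp del: list_encode.simps)
  with 1 show ?thesis
    by (simp add: M bu_code_unique[of B b B'] att_code_unique[of T t T']
        att_code_unique[of A a A'])
qed

end

(*
A derivation of an output from an input tree evaluates finitely many attribute instances, and it may
be assumed to use one rule for each of them and to be well-founded: listing the instances in order of
evaluation, each rule refers only to instances listed before. The part of this list that belongs to a
node and its children is one of finitely many local schedules, and a family of local schedules that
agree on the common nodes is enough to guarantee termination, by induction on the tree. Hence the
families of schedules are recognized by a finite automaton running over the input. The subset
construction turns it into a look-around: the bottom-up relabeling computes which schedules are
feasible, and the top-down relabeling selects one. The new transducer uses the rules chosen by the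
selected schedules, so it is deterministic, produces only outputs of the given transducer and has the
same domain. The given look-around is simulated by running it inside the automaton.

A rule for an inherited attribute lives at the parent (which may be the root marker, unseen by the
look-around). It is therefore chosen at the node itself and passed to the parent in the name of the
attribute.

Effectivity is obtained by writing the construction as a functional program on lists and showing that
the functions on encoded data that are computed by recursive programs are closed under all the
constructs used.
*)
theory Submission
  imports Defs
begin

section \<open>Computable functions between encoded types\<close>

text \<open>Functionality enters only at the end. A derivation may evaluate several copies of one
  instance by different rules; forcing one rule per instance may change the output, so the
  construction only preserves the domain. As every output of the new transducer is an output of the
  given one, single-valuedness then makes the translations equal. The obstacle is that a local
  schedule orders only one neighbourhood, whereas a cycle might run through several subtrees.
  Neighbouring schedules agree on the common node as lists, not just as sets. So the order at the
  root of a subtree tells its context all it has to know: a synthesized attribute there can be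
  evaluated as soon as the inherited attributes behind it in the list are available. Stating this
  for all suffixes of the list is what lets the induction on the tree go through. Every type that is
  ever decoded is coded bijectively, so decoding is the identity on codes and costs no program. The
  codings are built from those in which transducers are presented.\<close>

class coded =
  fixes enc :: "'a \<Rightarrow> nat"
  assumes enc_inject [simp]: "enc x = enc y \<longleftrightarrow> x = y"

class coded_onto = coded +
  assumes enc_onto: "\<exists>x. enc x = n"

definition dec :: "nat \<Rightarrow> 'a::coded_onto" where
  "dec = inv enc"

lemma enc_dec [simp]: "enc (dec n :: 'a::coded_onto) = n"
  unfolding dec_def by (rule f_inv_into_f) (metis enc_onto rangeI)

lemma dec_enc [simp]: "dec (enc x) = x"
  using enc_dec enc_inject by blast

instantiation nat :: coded_onto
begin
definition enc_nat :: "nat \<Rightarrow> nat" where [simp]: "enc_nat n = n"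
instance by standard auto
end

instantiation bool :: coded
begin
definition enc_bool :: "bool \<Rightarrow> nat" where "enc_bool b = (if b then 1 else 0)"
instance by standard (auto simp: enc_bool_def)
end

instantiation prod :: (coded, coded) coded
begin
definition enc_prod :: "'a \<times> 'b \<Rightarrow> nat" where
  "enc_prod p = prod_encode (enc (fst p), enc (snd p))"
instance by standard (auto simp: enc_prod_def prod_encode_eq prod_eq_iff)
end

instance prod :: (coded_onto, coded_onto) coded_onto
proof
  show "\<exists>x :: 'a \<times> 'b. enc x = n" for n
    by (rule exI[of _ "(dec (fst (prod_decode n)), dec (snd (prod_decode n)))"])
      (simp add: enc_prod_def)
qed

instantiation sum :: (coded, coded) coded
begin
definition enc_sum :: "'a + 'b \<Rightarrow> nat" where
  "enc_sum x = sum_encode (map_sum enc enc x)"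
instance
  by standard (auto simp: enc_sum_def sum_encode_eq map_sum_def split: sum.splits)
end

instance sum :: (coded_onto, coded_onto) coded_onto
proof
  show "\<exists>x :: 'a + 'b. enc x = n" for n
    by (rule exI[of _ "map_sum dec dec (sum_decode n)"])
      (simp add: enc_sum_def sum.map_comp o_def sum.map_ident)
qed

instantiation option :: (coded) coded
begin
definition enc_option :: "'a option \<Rightarrow> nat" where
  "enc_option x = (case x of None \<Rightarrow> 0 | Some y \<Rightarrow> Suc (enc y))"
instance by standard (auto simp: enc_option_def split: option.splits)
end

instance option :: (coded_onto) coded_onto
proof
  show "\<exists>x :: 'a option. enc x = n" for n
    by (rule exI[of _ "case n of 0 \<Rightarrow> None | Suc m \<Rightarrow> Some (dec m)"])
      (simp add: enc_option_def split: nat.splits)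
qed

instantiation list :: (coded) coded
begin
definition enc_list :: "'a list \<Rightarrow> nat" where
  "enc_list xs = list_encode (map enc xs)"
instance
proof
  show "enc xs = enc ys \<longleftrightarrow> xs = ys" for xs ys :: "'a list"
    unfolding enc_list_def list_encode_eq by (rule inj_map_eq_map) (simp add: inj_def)
qed
end

instance list :: (coded_onto) coded_onto
proof
  show "\<exists>x :: 'a list. enc x = n" for n
    by (rule exI[of _ "map dec (list_decode n)"]) (simp add: enc_list_def o_def)
qed

instantiation tree :: (coded) coded
begin
definition enc_tree :: "'a tree \<Rightarrow> nat" where
  "enc_tree t = tree_code (map_tree enc t)"
instance
proof
  show "enc s = enc t \<longleftrightarrow> s = t" for s t :: "'a tree"
    using injD[OF tree.inj_map[OF injI, of enc]] injD[OF inj_tree_code]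
    by (auto simp: enc_tree_def)
qed
end

lemma enc_Node: "enc (Node f ts) = prod_encode (enc f, enc ts)"
  by (simp add: enc_tree_def enc_list_def o_def enc_tree_def[abs_def])

lemma enc_Nil [simp]: "enc [] = 0"
  by (simp add: enc_list_def)

lemma enc_Cons: "enc (x # xs) = Suc (prod_encode (enc x, enc xs))"
  by (simp add: enc_list_def)

lemma enc_Pair: "enc (x, y) = prod_encode (enc x, enc y)"
  by (simp add: enc_prod_def)

lemma length_le_enc: "length xs \<le> enc xs"
proof (induction xs)
  case (Cons x xs)
  then show ?case using le_prod_encode_2[of "enc xs" "enc x"] by (simp add: enc_Cons)
qed simp

lemma enc_mem_less: "x \<in> set xs \<Longrightarrow> enc x < enc xs"
proof (induction xs)
  case (Cons y xs)
  have "enc y \<le> prod_encode (enc y, enc xs)" "enc xs \<le> prod_encode (enc y, enc xs)"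
    by (rule le_prod_encode_1 le_prod_encode_2)+
  then show ?case using Cons by (auto simp: enc_Cons)
qed simp

lemma enc_subtree_less: "t \<in> set ts \<Longrightarrow> enc t < enc (Node f ts)"
  using enc_mem_less[of t ts] le_prod_encode_2[of "enc ts" "enc f"] by (simp add: enc_Node)

instance tree :: (coded_onto) coded_onto
proof
  show "\<exists>x :: 'a tree. enc x = n" for n
  proof (induction n rule: less_induct)
    case (less n)
    define f :: 'a where "f = dec (fst (prod_decode n))"
    define cs :: "nat list" where "cs = dec (snd (prod_decode n))"
    have n: "n = prod_encode (enc f, enc cs)" by (simp add: f_def cs_def)
    have "\<exists>x :: 'a tree. enc x = c" if "c \<in> set cs" for c
    proof (rule less)
      show "c < n"
        using enc_mem_less[OF that] le_prod_encode_2[of "enc cs" "enc f"] by (simp add: n)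
    qed
    then obtain g :: "nat \<Rightarrow> 'a tree" where g: "\<And>c. c \<in> set cs \<Longrightarrow> enc (g c) = c"
      by metis
    have "enc (map g cs) = enc cs"
      using g by (simp add: enc_list_def o_def cong: map_cong)
    then have "enc (Node f (map g cs)) = n" by (simp add: enc_Node n)
    then show ?case by blast
  qed
qed

section \<open>Recursive programs for arithmetic and the Cantor pairing\<close>

lemma computes_comp1: "computes g xs y \<Longrightarrow> computes f [y] z \<Longrightarrow> computes (Comp f [g]) xs z"
  by (rule computes.comp[of _ _ "[y]"]) auto

lemma computes_comp2: "computes g xs y \<Longrightarrow> computes h xs y' \<Longrightarrow> computes f [y, y'] z \<Longrightarrow>
    computes (Comp f [g, h]) xs z"
  by (rule computes.comp[of _ _ "[y, y']"]) auto

lemma computes_proj: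
  "computes (Proj 0) (a # xs) a"
  "computes (Proj 1) (a # b # xs) b"
  "computes (Proj 2) (a # b # c # xs) c"
  using computes.proj[of 0 "a # xs"] computes.proj[of 1 "a # b # xs"]
    computes.proj[of 2 "a # b # c # xs"] by simp_all

definition "recf_add = PrimRec (Proj 0) (Comp Succ [Proj 1])"
definition "recf_pred = PrimRec Zero (Proj 0)"
definition "recf_sub = PrimRec (Proj 0) (Comp recf_pred [Proj 1])"
definition "recf_triangle = PrimRec Zero (Comp recf_add [Proj 1, Comp Succ [Proj 0]])"
definition "recf_pair = Comp recf_add [Comp recf_triangle [recf_add], Proj 0]"
text \<open>\<open>prod_encode (m, n)\<close> is \<open>triangle (m + n) + m\<close>, so the
  diagonal \<open>m + n\<close> of a code \<open>x\<close> is the least \<open>k\<close> with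
  \<open>x < triangle (Suc k)\<close>. As \<open>recf_sub\<close> takes the subtrahend first, the
  minimized function is \<open>Suc x - triangle (Suc k)\<close>, which vanishes exactly under this
  condition.\<close>

definition "recf_diagonal =
  Mu (Comp recf_sub [Comp recf_triangle [Comp Succ [Proj 0]], Comp Succ [Proj 1]])"
definition "recf_fst = Comp recf_sub [Comp recf_triangle [recf_diagonal], Proj 0]"
definition "recf_snd = Comp recf_sub [recf_fst, recf_diagonal]"

lemma computes_add: "computes recf_add [m, n] (m + n)"
  unfolding recf_add_def
proof (induction m)
  case (Suc m)
  show ?case
    by (rule computes.rec_Suc[OF Suc], rule computes_comp1[OF computes_proj(2)])
      (use computes.succ[of "m + n"] in simp)
qed (simp add: computes.rec_0 computes_proj)

lemma computes_pred: "computes recf_pred [n] (n - 1)"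
  unfolding recf_pred_def
proof (induction n)
  case (Suc n)
  show ?case by (rule computes.rec_Suc[OF Suc]) (simp add: computes_proj)
qed (simp add: computes.rec_0 computes.zero)

lemma computes_sub: "computes recf_sub [m, n] (n - m)"
  unfolding recf_sub_def
proof (induction m)
  case (Suc m)
  show ?case
    by (rule computes.rec_Suc[OF Suc], rule computes_comp1[OF computes_proj(2)])
      (use computes_pred[of "n - m"] in simp)
qed (simp add: computes.rec_0 computes_proj)

lemma computes_triangle: "computes recf_triangle [n] (triangle n)"
  unfolding recf_triangle_def
proof (induction n)
  case (Suc n)
  show ?case
    by (rule computes.rec_Suc[OF Suc], rule computes_comp2[OF computes_proj(2)
          computes_comp1[OF computes_proj(1) computes.succ]])
      (use computes_add[of "triangle n" "Suc n"] in simp)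
qed (simp add: computes.rec_0 computes.zero)

lemma computes_pair: "computes recf_pair [m, n] (prod_encode (m, n))"
  unfolding recf_pair_def prod_encode_def prod.case
  by (rule computes_comp2[OF computes_comp1[OF computes_add computes_triangle]
        computes_proj(1) computes_add])

lemma triangle_mono: "m \<le> n \<Longrightarrow> triangle m \<le> triangle n"
  by (induction rule: dec_induct) simp_all

lemma computes_diagonal: "computes recf_diagonal [prod_encode (m, n)] (m + n)"
proof -
  define h where "h = Comp recf_sub [Comp recf_triangle [Comp Succ [Proj 0]], Comp Succ [Proj 1]]"
  have h: "computes h [k, x] (Suc x - triangle (Suc k))" for k x
    unfolding h_def
    by (rule computes_comp2[OF computes_comp1[OF computes_comp1[OF computes_proj(1) computes.succ]
            computes_triangle] computes_comp1[OF computes_proj(2) computes.succ] computes_sub])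
  have "computes (Mu h) [prod_encode (m, n)] (m + n)"
  proof (rule computes.mu)
    show "computes h ((m + n) # [prod_encode (m, n)]) 0"
      using h[of "m + n" "prod_encode (m, n)"] by (simp add: prod_encode_def)
    show "\<forall>k<m + n. \<exists>y. computes h (k # [prod_encode (m, n)]) (Suc y)"
    proof (intro allI impI)
      fix k assume "k < m + n"
      then have "triangle (Suc k) \<le> prod_encode (m, n)"
        using triangle_mono[of "Suc k" "m + n"] by (simp add: prod_encode_def)
      then have "Suc (prod_encode (m, n)) - triangle (Suc k) =
          Suc (prod_encode (m, n) - triangle (Suc k))"
        by (simp add: Suc_diff_le)
      then show "\<exists>y. computes h (k # [prod_encode (m, n)]) (Suc y)"
        using h[of k "prod_encode (m, n)"] by auto
    qed
  qed
  then show ?thesis by (simp add: h_def recf_diagonal_def)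
qed

lemma computes_fst: "computes recf_fst [prod_encode (m, n)] m"
  unfolding recf_fst_def
  by (rule computes_comp2[OF computes_comp1[OF computes_diagonal computes_triangle]
        computes_proj(1)])
    (use computes_sub[of "triangle (m + n)" "prod_encode (m, n)"] in \<open>simp add: prod_encode_def\<close>)

lemma computes_snd: "computes recf_snd [prod_encode (m, n)] n"
  unfolding recf_snd_def
  by (rule computes_comp2[OF computes_fst computes_diagonal])
    (use computes_sub[of m "m + n"] in simp)

section \<open>Closure of the computable functions under the constructs of functional
  programs\<close>

definition computable :: "('a::coded \<Rightarrow> 'b::coded) \<Rightarrow> bool" where
  "computable f \<longleftrightarrow> (\<exists>e. \<forall>x. computes e [enc x] (enc (f x)))"

lemma computableI: "(\<And>x. computes e [enc x] (enc (f x))) \<Longrightarrow> computable f"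
  unfolding computable_def by blast

named_theorems computable_intros

text \<open>Replacing a function by one with the same codes changes its type, but not its recursive
  program.\<close>

lemma computable_cong_enc:
  assumes "computable f" "\<And>x. enc (f x) = enc (g x)"
  shows "computable g"
  using assms unfolding computable_def by simp

lemma computable_id [computable_intros]: "computable (\<lambda>x. x)"
  by (rule computableI[of "Proj 0"]) (rule computes_proj)

lemma computes_const: "\<exists>e. \<forall>xs. computes e xs n"
proof (induction n)
  case 0
  show ?case using computes.zero by blast
next
  case (Suc n)
  then obtain e where "\<forall>xs. computes e xs n" by blast
  then have "\<forall>xs. computes (Comp Succ [e]) xs (Suc n)"
    using computes_comp1 computes.succ by blast
  then show ?case by blast
qed

lemma computable_const [computable_intros]: "computable (\<lambda>x. c)"
  unfolding computable_def using computes_const by blast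

lemma computable_comp: "computable f \<Longrightarrow> computable g \<Longrightarrow> computable (\<lambda>x. f (g x))"
  unfolding computable_def using computes_comp1 by blast

lemma computable_Pair [computable_intros]:
  assumes "computable f" "computable g"
  shows "computable (\<lambda>x. (f x, g x))"
proof -
  obtain e d where "\<forall>x. computes e [enc x] (enc (f x))" "\<forall>x. computes d [enc x] (enc (g x))"
    using assms unfolding computable_def by blast
  then have "\<forall>x. computes (Comp recf_pair [e, d]) [enc x] (enc (f x, g x))"
    unfolding enc_Pair using computes_comp2 computes_pair by blast
  then show ?thesis unfolding computable_def by blast
qed

lemma computable_fst [computable_intros]: "computable f \<Longrightarrow> computable (\<lambda>x. fst (f x))"
  by (rule computable_comp[of fst]) (auto intro!: computableI[of recf_fst] computes_fst simp: enc_prod_def)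

lemma computable_snd [computable_intros]: "computable f \<Longrightarrow> computable (\<lambda>x. snd (f x))"
  by (rule computable_comp[of snd]) (auto intro!: computableI[of recf_snd] computes_snd simp: enc_prod_def)

text \<open>Functions of several arguments are treated as functions of nested pairs. The rules for
  constructs that bind variables state their premises in this shape, with the outer context as the
  first component and the bound variables behind it.\<close>

lemma computable_comp2:
  assumes "computable (\<lambda>p. F (fst p) (snd p))" "computable f" "computable g"
  shows "computable (\<lambda>x. F (f x) (g x))"
  using computable_comp[OF assms(1) computable_Pair[OF assms(2,3)]] by simp

lemma computable_comp3:
  assumes "computable (\<lambda>p. F (fst p) (fst (snd p)) (snd (snd p)))"
    "computable f" "computable g" "computable h"
  shows "computable (\<lambda>x. F (f x) (g x) (h x))"
  using computable_comp[OF assms(1) computable_Pair[OF assms(2) computable_Pair[OF assms(3,4)]]]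
  by simp

lemma computable_split [computable_intros]:
  assumes "computable (\<lambda>z. F (fst z) (fst (snd z)) (snd (snd z)))" "computable p"
  shows "computable (\<lambda>x. case p x of (a, b) \<Rightarrow> F x a b)"
  using computable_comp[OF assms(1) computable_Pair[OF computable_id assms(2)]]
  by (simp add: case_prod_beta)

lemma computable_enc [computable_intros]: "computable f \<Longrightarrow> computable (\<lambda>x. enc (f x))"
  by (erule computable_cong_enc) simp

lemma computable_dec [computable_intros]: "computable f \<Longrightarrow> computable (\<lambda>x. dec (f x))"
  by (erule computable_cong_enc) simp

lemma computable_Suc [computable_intros]: "computable f \<Longrightarrow> computable (\<lambda>x. Suc (f x))"
  by (rule computable_comp[of Suc]) (auto intro!: computableI[of Succ] computes.succ)

lemma computable_Some [computable_intros]: "computable f \<Longrightarrow> computable (\<lambda>x. Some (f x))"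
  by (rule computable_cong_enc[OF computable_Suc[OF computable_enc]])
    (simp_all add: enc_option_def)

lemma computable_Cons [computable_intros]:
  "computable f \<Longrightarrow> computable g \<Longrightarrow> computable (\<lambda>x. f x # g x)"
  by (rule computable_cong_enc[OF computable_Suc[OF computable_enc[OF computable_Pair]]])
    (simp_all add: enc_Cons enc_Pair)

lemma computable_Node [computable_intros]:
  "computable f \<Longrightarrow> computable g \<Longrightarrow> computable (\<lambda>x. Node (f x) (g x))"
  by (rule computable_cong_enc[OF computable_Pair]) (simp_all add: enc_Pair enc_Node)

lemma computable_rec_nat [computable_intros]:
  assumes b: "computable b" and s: "computable (\<lambda>z. s (fst z) (fst (snd z)) (snd (snd z)))"
    and n: "computable n"
  shows "computable (\<lambda>x. rec_nat (b x) (\<lambda>m y. s x m y) (n x))"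
proof -
  obtain eb es en where e: "\<And>x. computes eb [enc x] (enc (b x))"
    "\<And>z. computes es [enc z] (enc (s (fst z) (fst (snd z)) (snd (snd z))))"
    "\<And>x. computes en [enc x] (enc (n x))"
    using assms unfolding computable_def by blast
  \<comment> \<open>Primitive recursion passes counter, accumulator and parameter in this order,
    whereas the program for \<open>s\<close> expects the parameter first.\<close>
  define h where "h = Comp es [Comp recf_pair [Proj 2, Comp recf_pair [Proj 0, Proj 1]]]"
  have h: "computes h [m, enc y, enc x] (enc (s x m y))" for x m y
    unfolding h_def
    by (rule computes_comp1[OF computes_comp2[OF computes_proj(3)
            computes_comp2[OF computes_proj(1) computes_proj(2) computes_pair] computes_pair]])
      (use e(2)[of "(x, m, y)"] in \<open>simp add: enc_Pair\<close>)
  have r: "computes (PrimRec eb h) [m, enc x] (enc (rec_nat (b x) (s x) m))" for m x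
  proof (induction m)
    case (Suc m)
    show ?case by (rule computes.rec_Suc[OF Suc]) (simp add: h)
  qed (simp add: computes.rec_0 e)
  have "computes (Comp (PrimRec eb h) [en, Proj 0]) [enc x] (enc (rec_nat (b x) (s x) (n x)))" for x
    by (rule computes_comp2[OF e(3) computes_proj(1)]) (simp add: r)
  then show ?thesis by (rule computableI)
qed

lemma computable_case_nat [computable_intros]:
  assumes "computable b" "computable (\<lambda>z. s (fst z) (snd z))" "computable n"
  shows "computable (\<lambda>x. case n x of 0 \<Rightarrow> b x | Suc m \<Rightarrow> s x m)"
proof -
  have "computable (\<lambda>x. rec_nat (b x) (\<lambda>m y. s x m) (n x))"
    by (intro computable_intros computable_comp2[OF assms(2)] assms(1,3))
  moreover have "rec_nat (b x) (\<lambda>m y. s x m) (n x) = (case n x of 0 \<Rightarrow> b x | Suc m \<Rightarrow> s x m)" for x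
    by (cases "n x") simp_all
  ultimately show ?thesis by simp
qed

lemma computable_if [computable_intros]:
  assumes "computable b" "computable f" "computable g"
  shows "computable (\<lambda>x. if b x then f x else g x)"
proof -
  have "computable (\<lambda>x. case enc (b x) of 0 \<Rightarrow> g x | Suc m \<Rightarrow> f x)"
    using computable_comp[OF assms(2) computable_fst[OF computable_id]]
    by (intro computable_intros assms)
  moreover have "(case enc (b x) of 0 \<Rightarrow> g x | Suc m \<Rightarrow> f x) = (if b x then f x else g x)" for x
    by (simp add: enc_bool_def)
  ultimately show ?thesis by simp
qed

lemma computable_add [computable_intros]:
  assumes "computable f" "computable g"
  shows "computable (\<lambda>x. f x + g x :: nat)"
proof -
  have "computable (\<lambda>p. fst p + snd p :: nat)"
    by (rule computableI[of "Comp recf_add [recf_fst, recf_snd]"])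
      (auto simp: enc_prod_def intro: computes_comp2[OF computes_fst computes_snd computes_add])
  from computable_comp2[OF this assms] show ?thesis .
qed

lemma computable_sub [computable_intros]:
  assumes "computable f" "computable g"
  shows "computable (\<lambda>x. f x - g x :: nat)"
proof -
  have "computable (\<lambda>p. fst p - snd p :: nat)"
    by (rule computableI[of "Comp recf_sub [recf_snd, recf_fst]"])
      (auto simp: enc_prod_def intro: computes_comp2[OF computes_snd computes_fst computes_sub])
  from computable_comp2[OF this assms] show ?thesis .
qed

lemma computable_mult [computable_intros]:
  assumes "computable f" "computable g"
  shows "computable (\<lambda>x. f x * g x :: nat)"
proof -
  have "computable (\<lambda>p :: nat \<times> nat. rec_nat 0 (\<lambda>m y. y + snd p) (fst p))"
    by (intro computable_intros)
  moreover have "rec_nat 0 (\<lambda>m y. y + snd p) (fst p) = fst p * snd p" for p :: "nat \<times> nat"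
    by (induction "fst p" arbitrary: p rule: nat.induct) (simp, metis add.commute fst_conv mult_Suc nat.rec(2) snd_conv)
  ultimately show ?thesis using computable_comp2[OF _ assms, of times] by simp
qed

lemma computable_not [computable_intros]: "computable b \<Longrightarrow> computable (\<lambda>x. \<not> b x)"
  using computable_if[of b "\<lambda>_. False" "\<lambda>_. True"] by (simp add: computable_const if_bool_eq_conj)

lemma computable_conj [computable_intros]:
  "computable b \<Longrightarrow> computable c \<Longrightarrow> computable (\<lambda>x. b x \<and> c x)"
  using computable_not[of "\<lambda>x. b x \<longrightarrow> \<not> c x"] computable_if[of b "\<lambda>x. \<not> c x" "\<lambda>_. True"]
  by (simp add: computable_const computable_not if_bool_eq_conj)

lemma computable_imp [computable_intros]:
  "computable b \<Longrightarrow> computable c \<Longrightarrow> computable (\<lambda>x. b x \<longrightarrow> c x)"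
  using computable_if[of b c "\<lambda>_. True"] by (simp add: computable_const if_bool_eq_conj)

lemma computable_eq [computable_intros]:
  assumes "computable f" "computable g"
  shows "computable (\<lambda>x. f x = g x)"
proof -
  have zero: "computable (\<lambda>n :: nat. n = 0)"
  proof -
    have "computable (\<lambda>n :: nat. case n of 0 \<Rightarrow> True | Suc m \<Rightarrow> False)"
      by (intro computable_intros)
    moreover have "(case n of 0 \<Rightarrow> True | Suc m \<Rightarrow> False) = (n = 0)" for n :: nat
      by (cases n) simp_all
    ultimately show ?thesis by simp
  qed
  have "computable (\<lambda>x. (enc (f x) - enc (g x)) + (enc (g x) - enc (f x)) = 0)"
    by (rule computable_comp[OF zero]) (intro computable_intros assms)
  moreover have "((enc (f x) - enc (g x)) + (enc (g x) - enc (f x)) = 0) = (f x = g x)" for x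
    using enc_inject[of "f x" "g x"] by linarith
  ultimately show ?thesis by simp
qed

lemma computable_case_option [computable_intros]:
  fixes l :: "'a::coded \<Rightarrow> 'c::coded_onto option"
  assumes "computable a" "computable (\<lambda>z. c (fst z) (snd z))" "computable l"
  shows "computable (\<lambda>x. case l x of None \<Rightarrow> a x | Some y \<Rightarrow> c x y)"
proof -
  have "computable (\<lambda>x. case enc (l x) of 0 \<Rightarrow> a x | Suc m \<Rightarrow> c x (dec m))"
    by (rule computable_case_nat[OF assms(1)
          computable_comp2[OF assms(2) computable_fst[OF computable_id]
            computable_dec[OF computable_snd[OF computable_id]]]
          computable_enc[OF assms(3)]])
  moreover have "(case enc (l x) of 0 \<Rightarrow> a x | Suc m \<Rightarrow> c x (dec m)) =
      (case l x of None \<Rightarrow> a x | Some y \<Rightarrow> c x y)" for x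
    by (simp add: enc_option_def split: option.split)
  ultimately show ?thesis by simp
qed

lemma computable_case_list [computable_intros]:
  fixes l :: "'a::coded \<Rightarrow> 'c::coded_onto list"
  assumes "computable a" "computable (\<lambda>z. c (fst z) (fst (snd z)) (snd (snd z)))" "computable l"
  shows "computable (\<lambda>x. case l x of [] \<Rightarrow> a x | y # ys \<Rightarrow> c x y ys)"
proof -
  have "computable (\<lambda>z. let p = dec (snd z) in c (fst z) (fst p) (snd p))"
    unfolding Let_def by (rule computable_comp3[OF assms(2)]) (intro computable_intros)+
  then have "computable (\<lambda>x. case enc (l x) of 0 \<Rightarrow> a x | Suc m \<Rightarrow>
      (let p = dec m in c x (fst p) (snd p)))"
    by (rule computable_case_nat[OF assms(1) _ computable_enc[OF assms(3)]])
  moreover have "(case enc (l x) of 0 \<Rightarrow> a x | Suc m \<Rightarrow> (let p = dec m in c x (fst p) (snd p))) =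
      (case l x of [] \<Rightarrow> a x | y # ys \<Rightarrow> c x y ys)" for x
    by (cases "l x") (simp_all add: enc_Cons flip: enc_Pair)
  ultimately show ?thesis by simp
qed

text \<open>The code of a list bounds its length (\<open>length_le_enc\<close>). The step is
  iterated \<open>enc (l x)\<close> times; the surplus iterations meet an empty list and change
  nothing.\<close>

lemma computable_fold:
  fixes l :: "'a::coded \<Rightarrow> 'c::coded_onto list"
  assumes s: "computable (\<lambda>z. s (fst z) (fst (snd z)) (snd (snd z)))"
    and l: "computable l" and b: "computable b"
  shows "computable (\<lambda>x. fold (s x) (l x) (b x))"
proof -
  define body where "body x r = (case fst r of [] \<Rightarrow> r | y # ys \<Rightarrow> (ys, s x y (snd r)))" for x r
  have "computable (\<lambda>z. body (fst z) (snd z))"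
    unfolding body_def by (intro computable_intros computable_comp3[OF s])
  then have "computable (\<lambda>x. snd (rec_nat (l x, b x) (\<lambda>_ r. body x r) (enc (l x))))"
    by (intro computable_intros l b) (rule computable_comp2, assumption, (intro computable_intros)+)
  moreover have "rec_nat (xs, b) (\<lambda>_ r. body x r) n = (drop n xs, fold (s x) (take n xs) b)"
    for x n xs b
  proof (induction n)
    case (Suc n)
    show ?case
    proof (cases "n < length xs")
      case True
      then have "drop n xs = xs ! n # drop (Suc n) xs" by (simp add: Cons_nth_drop_Suc)
      then show ?thesis using Suc True by (simp add: body_def take_Suc_conv_app_nth)
    qed (use Suc in \<open>simp add: body_def\<close>)
  qed simp
  ultimately show ?thesis by (simp add: length_le_enc)
qed

lemma computable_rev [computable_intros]:
  fixes l :: "'a::coded \<Rightarrow> 'c::coded_onto list"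
  assumes "computable l"
  shows "computable (\<lambda>x. rev (l x))"
  unfolding rev_conv_fold by (intro computable_fold computable_intros assms)

lemma computable_foldr [computable_intros]:
  fixes l :: "'a::coded \<Rightarrow> 'c::coded_onto list"
  assumes "computable (\<lambda>z. s (fst z) (fst (snd z)) (snd (snd z)))"
    "computable l" "computable b"
  shows "computable (\<lambda>x. foldr (s x) (l x) (b x))"
  unfolding foldr_conv_fold by (intro computable_fold computable_intros assms)

lemma computable_map [computable_intros]:
  fixes l :: "'a::coded \<Rightarrow> 'c::coded_onto list"
  assumes "computable (\<lambda>z. f (fst z) (snd z))" "computable l"
  shows "computable (\<lambda>x. map (f x) (l x))"
proof -
  have "computable (\<lambda>x. foldr (\<lambda>y ys. f x y # ys) (l x) [])"
    by (intro computable_intros assms(2) computable_comp2[OF assms(1)])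
  moreover have "foldr (\<lambda>y ys. f x y # ys) xs [] = map (f x) xs" for x xs
    by (induction xs) simp_all
  ultimately show ?thesis by simp
qed

lemma computable_filter [computable_intros]:
  fixes l :: "'a::coded \<Rightarrow> 'c::coded_onto list"
  assumes "computable (\<lambda>z. P (fst z) (snd z))" "computable l"
  shows "computable (\<lambda>x. filter (P x) (l x))"
proof -
  have "computable (\<lambda>x. foldr (\<lambda>y ys. if P x y then y # ys else ys) (l x) [])"
    by (intro computable_intros assms(2) computable_comp2[OF assms(1)])
  moreover have "foldr (\<lambda>y ys. if P x y then y # ys else ys) xs [] = filter (P x) xs" for x xs
    by (induction xs) simp_all
  ultimately show ?thesis by simp
qed

lemma computable_Ball [computable_intros]:
  fixes l :: "'a::coded \<Rightarrow> 'c::coded_onto list"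
  assumes "computable (\<lambda>z. P (fst z) (snd z))" "computable l"
  shows "computable (\<lambda>x. \<forall>y\<in>set (l x). P x y)"
proof -
  have "computable (\<lambda>x. foldr (\<lambda>y b. P x y \<and> b) (l x) True)"
    by (intro computable_intros assms(2) computable_comp2[OF assms(1)])
  moreover have "foldr (\<lambda>y b. P x y \<and> b) xs True = (\<forall>y\<in>set xs. P x y)" for x xs
    by (induction xs) simp_all
  ultimately show ?thesis by simp
qed

lemma computable_Bex [computable_intros]:
  fixes l :: "'a::coded \<Rightarrow> 'c::coded_onto list"
  assumes "computable (\<lambda>z. P (fst z) (snd z))" "computable l"
  shows "computable (\<lambda>x. \<exists>y\<in>set (l x). P x y)"
  using computable_not[OF computable_Ball[OF computable_not[OF assms(1)] assms(2)]] by simp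

lemma computable_mem [computable_intros]:
  fixes l :: "'a::coded \<Rightarrow> 'c::coded_onto list"
  assumes "computable f" "computable l"
  shows "computable (\<lambda>x. f x \<in> set (l x))"
proof -
  have "computable (\<lambda>x. \<exists>y\<in>set (l x). f x = y)"
    by (intro computable_intros computable_comp[OF assms(1)] assms)
  then show ?thesis by simp
qed

lemma computable_append [computable_intros]:
  fixes f :: "'a::coded \<Rightarrow> 'c::coded_onto list"
  assumes "computable f" "computable g"
  shows "computable (\<lambda>x. f x @ g x)"
proof -
  have "computable (\<lambda>x. foldr (\<lambda>y ys. y # ys) (f x) (g x))"
    by (intro computable_intros assms)
  moreover have "foldr (\<lambda>y ys. y # ys) xs zs = xs @ zs" for xs zs :: "'c list"
    by (induction xs) simp_all
  ultimately show ?thesis by simp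
qed

lemma computable_concat [computable_intros]:
  fixes f :: "'a::coded \<Rightarrow> 'c::coded_onto list list"
  assumes "computable f"
  shows "computable (\<lambda>x. concat (f x))"
  unfolding concat_conv_foldr by (intro computable_intros assms)

lemma computable_length [computable_intros]:
  fixes f :: "'a::coded \<Rightarrow> 'c::coded_onto list"
  assumes "computable f"
  shows "computable (\<lambda>x. length (f x))"
proof -
  have "computable (\<lambda>x. foldr (\<lambda>y n. Suc n) (f x) 0)"
    by (intro computable_intros assms)
  moreover have "foldr (\<lambda>y n. Suc n) xs 0 = length xs" for xs :: "'c list"
    by (induction xs) simp_all
  ultimately show ?thesis by simp
qed

lemma computable_upt [computable_intros]:
  assumes "computable f"
  shows "computable (\<lambda>x. [0..<f x])"
proof -
  have "computable (\<lambda>x. rec_nat [] (\<lambda>n ns. ns @ [n]) (f x))"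
    by (intro computable_intros assms)
  moreover have "rec_nat [] (\<lambda>n ns. ns @ [n]) n = [0..<n]" for n
    by (induction n) simp_all
  ultimately show ?thesis by simp
qed

lemma computable_replicate [computable_intros]:
  fixes f :: "'a::coded \<Rightarrow> 'c::coded_onto"
  assumes "computable n" "computable f"
  shows "computable (\<lambda>x. replicate (n x) (f x))"
proof -
  have "computable (\<lambda>x. map (\<lambda>_. f x) [0..<n x])"
    by (intro computable_intros computable_comp[OF assms(2)] assms(1))
  then show ?thesis by (simp add: map_replicate_const)
qed

lemma computable_zip [computable_intros]:
  fixes f :: "'a::coded \<Rightarrow> 'c::coded_onto list" and g :: "'a \<Rightarrow> 'd::coded_onto list"
  assumes "computable f" "computable g"
  shows "computable (\<lambda>x. zip (f x) (g x))"
proof -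
  \<comment> \<open>The accumulator holds the rest of the second list and the pairs found so far, in
    reverse order. Once the second list is exhausted it stays fixed, just as \<open>zip\<close>
    truncates.\<close>
  define body :: "'c \<Rightarrow> 'd list \<times> ('c \<times> 'd) list \<Rightarrow> 'd list \<times> ('c \<times> 'd) list" where
    "body y r = (case fst r of [] \<Rightarrow> r | z # zs \<Rightarrow> (zs, (y, z) # snd r))" for y r
  have "computable (\<lambda>z. body (fst z) (snd z))"
    unfolding body_def by (intro computable_intros)
  then have "computable (\<lambda>x. rev (snd (fold body (f x) (g x, []))))"
    by (intro computable_intros computable_fold assms)
       (rule computable_comp2, assumption, (intro computable_intros)+)
  moreover have "snd (fold body xs (ys, r)) = rev (zip xs ys) @ r" for xs ys r
  proof (induction xs arbitrary: ys r)
    case (Cons x xs)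
    have "fold body xs ([], r) = ([], r)" for xs r
      by (induction xs) (simp_all add: body_def)
    then show ?case using Cons by (cases ys) (simp_all add: body_def)
  qed simp
  ultimately show ?thesis by simp
qed

text \<open>A number is even iff it codes an element of the left summand.\<close>

lemma computable_case_sum [computable_intros]:
  fixes l :: "'a::coded \<Rightarrow> 'c::coded_onto + 'd::coded_onto"
  assumes "computable (\<lambda>z. f (fst z) (snd z))" "computable (\<lambda>z. g (fst z) (snd z))" "computable l"
  shows "computable (\<lambda>x. case l x of Inl y \<Rightarrow> f x y | Inr y \<Rightarrow> g x y)"
proof -
  define half where "half = rec_nat (0, 0) (\<lambda>_ r. if snd r = 0 then (fst r, 1) else (Suc (fst r), 0 :: nat))"
  have half: "half (2 * n) = (n, 0) \<and> half (Suc (2 * n)) = (n, 1)" for n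
    by (induction n) (simp_all add: half_def)
  have [computable_intros]: "computable (\<lambda>x. half (n x))" if "computable n" for n :: "'a \<Rightarrow> nat"
    unfolding half_def by (intro computable_intros that)
  have "computable (\<lambda>x. let r = half (enc (l x)) in
      if snd r = 0 then f x (dec (fst r)) else g x (dec (fst r)))"
    unfolding Let_def by (intro computable_intros computable_comp2[OF assms(1)]
        computable_comp2[OF assms(2)] assms(3))
  moreover have "(let r = half (enc (l x)) in
      if snd r = 0 then f x (dec (fst r)) else g x (dec (fst r))) =
      (case l x of Inl y \<Rightarrow> f x y | Inr y \<Rightarrow> g x y)" for x
    using half by (cases "l x") (simp_all add: enc_sum_def sum_encode_def)
  ultimately show ?thesis by simp
qed

lemma computable_Inl [computable_intros]:
  assumes "computable f" shows "computable (\<lambda>x. Inl (f x) :: 'a::coded + 'b::coded)"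
  by (rule computable_cong_enc[where f = "\<lambda>x. 2 * enc (f x)"])
    (intro computable_intros assms, simp add: enc_sum_def sum_encode_def)

lemma computable_Inr [computable_intros]:
  assumes "computable f" shows "computable (\<lambda>x. Inr (f x) :: 'a::coded + 'b::coded)"
  by (rule computable_cong_enc[where f = "\<lambda>x. Suc (2 * enc (f x))"])
    (intro computable_intros assms, simp add: enc_sum_def sum_encode_def)

section \<open>Recursion on trees\<close>

primrec fold_tree :: "('a \<Rightarrow> 'b list \<Rightarrow> 'b) \<Rightarrow> 'a tree \<Rightarrow> 'b" where
  "fold_tree g (Node f ts) = g f (map (fold_tree g) ts)"

text \<open>Course-of-values recursion: the values on all trees with code below \<open>n\<close> are tabulated.\<close>

lemma computable_fold_tree [computable_intros]:
  fixes t :: "'a::coded \<Rightarrow> 'c::coded_onto tree" and g :: "'a \<Rightarrow> 'c \<Rightarrow> 'b list \<Rightarrow> 'b::coded_onto"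
  assumes g: "computable (\<lambda>z. g (fst z) (fst (snd z)) (snd (snd z)))" and t: "computable t"
  shows "computable (\<lambda>x. fold_tree (g x) (t x))"
proof -
  define look :: "(nat \<times> 'b) list \<Rightarrow> nat \<Rightarrow> 'b" where
    "look tab n = foldr (\<lambda>e r. if fst e = n then snd e else r) tab (dec 0)" for tab n
  \<comment> \<open>A tree has the same code as the pair of its root label and the list of its
    immediate subtrees. Decoding at this pair type therefore yields the codes of the subtrees, whose
    values are in the table.\<close>
  define val where "val x n tab = g x (fst (dec n :: 'c \<times> nat list))
    (map (look tab) (snd (dec n :: 'c \<times> nat list)))" for x n tab
  define tab where "tab x = rec_nat [] (\<lambda>n r. (n, val x n r) # r)" for x
  have [computable_intros]: "computable (\<lambda>x. look (f x) (h x))" if "computable f" "computable h"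
    for f :: "'y::coded \<Rightarrow> (nat \<times> 'b) list" and h
    unfolding look_def by (intro computable_intros that computable_comp[OF that(2)])
  have [computable_intros]: "computable (\<lambda>x. val (f x) (h x) (k x))"
    if "computable f" "computable h" "computable k"
    for f :: "'y::coded \<Rightarrow> 'a" and h k
    unfolding val_def
    by (intro computable_comp3[OF g] computable_intros that computable_comp[OF that(3)])
  have "computable (\<lambda>x. look (tab x (Suc (enc (t x)))) (enc (t x)))"
    unfolding tab_def by (intro computable_intros t)
  moreover have "look (tab x n) m = fold_tree (g x) (dec m)" if "m < n" for x n m
    using that
  proof (induction n arbitrary: m)
    case (Suc n)
    have Cons: "look (tab x (Suc n)) m = (if n = m then val x n (tab x n) else look (tab x n) m)"
      by (simp add: look_def tab_def)
    show ?case
    proof (cases "m = n")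
      case True
      obtain f ts where fts: "(dec n :: 'c tree) = Node f ts" by (cases "dec n :: 'c tree")
      then have n: "n = enc (Node f ts)" by (metis enc_dec)
      then have "dec n = (f, map enc ts)"
        by (metis (mono_tags, lifting) dec_enc enc_Node enc_Pair enc_list_def enc_nat_def list.map_ident list.map_id map_idI map_map o_def)
      moreover have "look (tab x n) (enc u) = fold_tree (g x) u" if "u \<in> set ts" for u
        using Suc.IH[of "enc u"] enc_subtree_less[OF that, of f] by (simp add: n)
      ultimately have "val x n (tab x n) = fold_tree (g x) (Node f ts)"
        by (simp add: val_def o_def cong: map_cong)
      then show ?thesis using True Cons fts by simp
    qed (use Suc Cons in auto)
  qed simp
  ultimately show ?thesis by simp
qed

lemma computable_map_tree [computable_intros]:
  fixes t :: "'a::coded \<Rightarrow> 'c::coded_onto tree" and h :: "'a \<Rightarrow> 'c \<Rightarrow> 'b::coded_onto"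
  assumes h: "computable (\<lambda>z. h (fst z) (snd z))" and t: "computable t"
  shows "computable (\<lambda>x. map_tree (h x) (t x))"
proof -
  have "computable (\<lambda>x. fold_tree (\<lambda>f. Node (h x f)) (t x))"
    by (intro computable_intros computable_comp2[OF h] t)
  moreover have "fold_tree (\<lambda>f. Node (h x f)) u = map_tree (h x) u" for x u
    by (induction u) simp
  ultimately show ?thesis by simp
qed

primrec labels :: "'a tree \<Rightarrow> 'a list" where
  "labels (Node f ts) = f # concat (map labels ts)"

lemma computable_labels [computable_intros]:
  fixes t :: "'a::coded \<Rightarrow> 'c::coded_onto tree"
  assumes "computable t"
  shows "computable (\<lambda>x. labels (t x))"
proof -
  have "computable (\<lambda>x. fold_tree (\<lambda>f us. f # concat us) (t x))"
    by (intro computable_intros assms)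
  moreover have "fold_tree (\<lambda>f us. f # concat us) u = labels u" for u :: "'c tree"
    by (induction u) (simp cong: map_cong)
  ultimately show ?thesis by simp
qed

section \<open>Big-step semantics\<close>

fun subtree :: "'a tree \<Rightarrow> node \<Rightarrow> 'a tree option" where
  "subtree t [] = Some t"
| "subtree (Node f ts) (i # v) =
    (if 1 \<le> i \<and> i \<le> length ts then subtree (ts ! (i - 1)) v else None)"

lemma label_at_iff: "label_at t v = Some f \<longleftrightarrow> (\<exists>ts. subtree t v = Some (Node f ts))"
proof (induction t v rule: label_at.induct)
  case (1 f ts)
  then show ?case by auto
next
  case (2 f ts i v)
  then show ?case by simp
qed

lemma subtree_snoc:
  "subtree t v = Some (Node f ts) \<Longrightarrow> 1 \<le> i \<Longrightarrow> i \<le> length ts \<Longrightarrow> subtree t (v @ [i]) = Some (ts ! (i - 1))"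
  by (induction t v rule: subtree.induct) (auto split: if_splits)

lemma subtree_map: "subtree (map_tree g t) v = map_option (map_tree g) (subtree t v)"
  by (induction t v rule: subtree.induct) auto

lemma subtree_marked: "subtree (marked s) (1 # v) = map_option (map_tree Some) (subtree s v)"
  by (simp add: marked_def subtree_map)

lemma label_at_marked_map:
  "label_at (marked (map_tree g s)) v = map_option (map_option g) (label_at (marked s) v)"
proof -
  have "label_at (map_tree g t) v = map_option g (label_at t v)" for g :: "'c \<Rightarrow> 'd" and t v
    by (induction t v rule: label_at.induct) auto
  moreover have "marked (map_tree g s) = map_tree (map_option g) (marked s)"
    by (simp add: marked_def tree.map_comp o_def)
  ultimately show ?thesis by simp
qed

lemma Node_in_trees_iff:
  "Node f ts \<in> trees \<Sigma> \<longleftrightarrow> (f, length ts) \<in> \<Sigma> \<and> (\<forall>t\<in>set ts. t \<in> trees \<Sigma>)"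
  by (subst trees.simps) auto

lemma subtree_in_trees: "subtree t v = Some u \<Longrightarrow> t \<in> trees \<Sigma> \<Longrightarrow> u \<in> trees \<Sigma>"
  by (induction t v rule: subtree.induct) (auto simp: Node_in_trees_iff split: if_splits)

lemma trees_with_Inl [simp]: "Node (Inl f) ts \<in> trees_with \<Sigma> \<Lambda> \<longleftrightarrow>
    (f, length ts) \<in> \<Sigma> \<and> (\<forall>t\<in>set ts. t \<in> trees_with \<Sigma> \<Lambda>)"
  unfolding trees_with_def by (subst Node_in_trees_iff) auto

lemma trees_with_Inr [simp]: "Node (Inr x) ts \<in> trees_with \<Sigma> \<Lambda> \<longleftrightarrow> x \<in> \<Lambda> \<and> ts = []"
  unfolding trees_with_def by (subst Node_in_trees_iff) auto

lemma map_tree_Inl_in_trees_with: "map_tree Inl t \<in> trees_with \<Sigma> \<Lambda> \<longleftrightarrow> t \<in> trees \<Sigma>"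
  by (induction t) (auto simp: Node_in_trees_iff)

lemma map_tree_trees_with:
  assumes "t \<in> trees_with \<Sigma> \<Lambda>" "g ` \<Lambda> \<subseteq> \<Lambda>'"
  shows "map_tree (map_sum id g) t \<in> trees_with \<Sigma> \<Lambda>'"
  using assms(1)
proof (induction t)
  case (Node f ts)
  then show ?case using assms(2) by (cases f) auto
qed

lemma trees_with_mono: "t \<in> trees_with \<Sigma> \<Lambda> \<Longrightarrow> \<Lambda> \<subseteq> \<Lambda>' \<Longrightarrow> t \<in> trees_with \<Sigma> \<Lambda>'"
  using map_tree_trees_with[of t \<Sigma> \<Lambda> id \<Lambda>'] by (simp add: sum.map_id0 tree.map_id)

lemma trees_with_leaf:
  "t \<in> trees_with \<Sigma> \<Lambda> \<Longrightarrow> Inr x \<in> set_tree t \<Longrightarrow> x \<in> \<Lambda>"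
proof (induction t)
  case (Node f ts)
  then show ?case by (cases f) auto
qed

lemma set_labels: "set (labels t) = set_tree t"
  by (induction t) auto

lemma instantiate_Inl [simp]: "instantiate v (Node (Inl f) ts) = Node (Inl f) (map (instantiate v) ts)"
  by (simp add: instantiate_def)

lemma instantiate_Inr [simp]:
  "instantiate v (Node (Inr (\<gamma>, i)) ts) = Node (Inr (\<gamma>, child v i)) (map (instantiate v) ts)"
  by (simp add: instantiate_def)

text \<open>Big-step form of the rewriting. It dispenses with the intermediate trees, their
  membership in \<open>trees_with\<close> and the order of the steps, and it allows induction on
  derivations. Circular attributes do no harm, since derivations are finite.\<close>

inductive gen :: "('q, 'a, 'b) att \<Rightarrow> 'a tree \<Rightarrow> ('b + 'q \<times> node) tree \<Rightarrow> 'b tree \<Rightarrow> bool"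
  for A s where
  gen_Inl: "list_all2 (gen A s) ts us \<Longrightarrow> gen A s (Node (Inl f) ts) (Node f us)"
| gen_Inr: "label_at (marked s) v = Some x \<Longrightarrow> (x, (\<gamma>, i), \<xi>) \<in> rules A \<Longrightarrow>
    gen A s (instantiate v \<xi>) u \<Longrightarrow> gen A s (Node (Inr (\<gamma>, child v i)) []) u"

inductive_cases gen_InlE: "gen A s (Node (Inl f) ts) u"
inductive_cases gen_InrE: "gen A s (Node (Inr x) ts) u"

definition defd :: "('q, 'a, 'b) att \<Rightarrow> 'a tree \<Rightarrow> 'q \<Rightarrow> node \<Rightarrow> bool" where
  "defd A s \<gamma> v \<longleftrightarrow> (\<exists>u. gen A s (Node (Inr (\<gamma>, v)) []) u)"

text \<open>An evaluation is pulled back along one step, so that a sequence of steps can be followed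
  backwards from its output, which evaluates to itself.\<close>

lemma rewrite_gen: "rewrite A s t t' \<Longrightarrow> gen A s t' u \<Longrightarrow> gen A s t u"
proof (induction arbitrary: u rule: rewrite.induct)
  case (leaf v x \<gamma> i \<xi>)
  then show ?case by (blast intro: gen_Inr)
next
  case (inner t t' f us ws)
  show ?case
  proof (cases f)
    case (Inl g)
    with inner.prems obtain zs where zs: "u = Node g zs" "list_all2 (gen A s) (us @ t' # ws) zs"
      by (auto elim: gen_InlE)
    then obtain zs1 z zs2 where "zs = zs1 @ z # zs2" "list_all2 (gen A s) us zs1" "gen A s t' z"
      "list_all2 (gen A s) ws zs2"
      by (auto simp: list_all2_append1 list_all2_Cons1)
    then have "list_all2 (gen A s) (us @ t # ws) zs"
      using inner.IH by (simp add: list_all2_appendI)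
    then show ?thesis using zs(1) Inl by (auto intro: gen_Inl)
  next
    case (Inr y)
    with inner.prems show ?thesis by (auto elim: gen_InrE)
  qed
qed

lemma gen_map_tree_Inl: "gen A s (map_tree Inl t) t"
proof (induction t)
  case (Node f ts)
  then show ?case by (auto simp: list_all2_conv_all_nth intro!: gen_Inl)
qed

lemma steps_gen: "(step A s)\<^sup>*\<^sup>* X (map_tree Inl u) \<Longrightarrow> gen A s X u"
  by (induction rule: converse_rtranclp_induct) (auto simp: step_def gen_map_tree_Inl intro: rewrite_gen)

text \<open>Uniqueness of ranks identifies \<open>k\<close> with the number of children of
  \<open>v\<close>; hence all instances mentioned by a rule exist in the tree.\<close>

lemma nodes_marked_child:
  assumes "label_at (marked s) v = Some (Some f)" "s \<in> trees \<Sigma>" "ranked_alphabet \<Sigma>" "(f, k) \<in> \<Sigma>"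
    "i \<le> k"
  shows "child v i \<in> nodes (marked s)"
proof -
  obtain us where us: "subtree (marked s) v = Some (Node (Some f) us)"
    using assms(1) by (auto simp: label_at_iff)
  obtain w where v: "v = 1 # w"
  proof (cases v)
    case Nil
    then show ?thesis using us by (simp add: marked_def)
  next
    case (Cons j w)
    then have "j = 1" using us by (simp add: marked_def split: if_splits)
    then show ?thesis using that Cons by simp
  qed
  from us obtain t where t: "subtree s w = Some t" "map_tree Some t = Node (Some f) us"
    unfolding v subtree_marked by auto
  obtain g ts where "t = Node g ts" by (cases t)
  with t have ts: "subtree s w = Some (Node f ts)" "us = map (map_tree Some) ts" by auto
  then have "(f, length ts) \<in> \<Sigma>"
    using subtree_in_trees[OF ts(1) assms(2)] by (simp add: Node_in_trees_iff)
  then have "k = length ts"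
    using assms(3,4) by (auto simp: ranked_alphabet_def dest: single_valuedD)
  then show ?thesis
    using subtree_snoc[OF us, of i] assms(5) label_at_iff[of "marked s"] us
    by (cases "i = 0") (auto simp: child_def nodes_def ts(2), metis tree.exhaust)
qed

lemma is_att_ruleD:
  assumes "is_att A" "(x, (\<gamma>, i), \<xi>) \<in> rules A"
  shows "\<gamma> \<in> syn A \<and> i = 0 \<or> \<gamma> \<in> inh A \<and> i > 0"
    "\<xi> \<in> trees_with (out_alph A) ((syn A \<union> inh A) \<times> UNIV)"
    "Inr (\<gamma>', i') \<in> set_tree \<xi> \<Longrightarrow> \<gamma>' \<in> syn A \<and> i' > 0 \<or> \<gamma>' \<in> inh A \<and> i' = 0 \<and> x \<noteq> None"
    "x = Some f \<Longrightarrow> (f, k) \<in> in_alph A \<Longrightarrow> Inr (\<gamma>', i') \<in> set_tree \<xi> \<Longrightarrow> i' \<le> k"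
    "x = None \<Longrightarrow> Inr (\<gamma>', i') \<in> set_tree \<xi> \<Longrightarrow> i' = 1 \<and> \<gamma>' \<in> syn A"
    "x = None \<Longrightarrow> i = 1 \<and> \<gamma> \<in> inh A"
proof -
  have r: "is_att_rule A (x, (\<gamma>, i), \<xi>)" and sv: "single_valued (in_alph A)"
    using assms by (auto simp: is_att_def ranked_alphabet_def)
  show "\<gamma> \<in> syn A \<and> i = 0 \<or> \<gamma> \<in> inh A \<and> i > 0"
    using r by (auto simp: is_att_rule_def split: option.splits)
  show "\<xi> \<in> trees_with (out_alph A) ((syn A \<union> inh A) \<times> UNIV)"
    using r by (auto simp: is_att_rule_def split: option.splits elim!: trees_with_mono)
  show "\<gamma>' \<in> syn A \<and> i' > 0 \<or> \<gamma>' \<in> inh A \<and> i' = 0 \<and> x \<noteq> None" if "Inr (\<gamma>', i') \<in> set_tree \<xi>"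
    using r that by (auto simp: is_att_rule_def split: option.splits dest!: trees_with_leaf)
  show "i' \<le> k" if x: "x = Some f" "(f, k) \<in> in_alph A" and leaf: "Inr (\<gamma>', i') \<in> set_tree \<xi>"
  proof -
    from r x(1) obtain k' where k': "(f, k') \<in> in_alph A"
      "\<xi> \<in> trees_with (out_alph A) (syn A \<times> {1..k'} \<union> inh A \<times> {0})"
      by (auto simp: is_att_rule_def)
    have "k' = k" using single_valuedD[OF sv k'(1) x(2)] .
    then show ?thesis using trees_with_leaf[OF k'(2) leaf] by auto
  qed
  show "i' = 1 \<and> \<gamma>' \<in> syn A" if "x = None" "Inr (\<gamma>', i') \<in> set_tree \<xi>"
    using r that by (auto simp: is_att_rule_def dest!: trees_with_leaf)
  show "i = 1 \<and> \<gamma> \<in> inh A" if "x = None"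
    using r that by (auto simp: is_att_rule_def)
qed

lemma instantiate_in_trees_with:
  assumes A: "is_att A" and s: "s \<in> trees (in_alph A)" and x: "label_at (marked s) v = Some x"
    and r: "(x, (\<gamma>, i), \<xi>) \<in> rules A"
  shows "instantiate v \<xi> \<in> trees_with (out_alph A) (attribute_instances A s)"
proof -
  have r': "is_att_rule A (x, (\<gamma>, i), \<xi>)" and ra: "ranked_alphabet (in_alph A)"
    using A r by (auto simp: is_att_def)
  show ?thesis
  proof (cases x)
    case None
    have v: "v = []"
    proof (cases v)
      case (Cons j w)
      then have "j = 1" using x by (auto simp: marked_def split: if_splits)
      then show ?thesis using x None Cons subtree_marked[of s w]
        by (auto simp: label_at_iff) (metis option.distinct(1) tree.exhaust tree.inject tree.map)
    qed simp
    have "[1] \<in> nodes (marked s)"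
      by (cases s) (simp add: marked_def nodes_def)
    then show ?thesis
      using r' None unfolding instantiate_def v
      by (auto simp: is_att_rule_def attribute_instances_def child_def elim!: map_tree_trees_with)
  next
    case (Some f)
    with r' obtain k where k: "(f, k) \<in> in_alph A"
      "\<xi> \<in> trees_with (out_alph A) (syn A \<times> {1..k} \<union> inh A \<times> {0})"
      by (auto simp: is_att_rule_def)
    have "child v i \<in> nodes (marked s)" if "i \<le> k" for i
      using nodes_marked_child[OF _ s ra k(1) that] x Some by simp
    then show ?thesis
      using k(2) unfolding instantiate_def
      by (auto simp: attribute_instances_def elim!: map_tree_trees_with)
  qed
qed

lemma steps_inner:
  assumes "(step A s)\<^sup>*\<^sup>* t t'" "Node f (us @ t # ws) \<in> trees_with (out_alph A) (attribute_instances A s)"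
  shows "(step A s)\<^sup>*\<^sup>* (Node f (us @ t # ws)) (Node f (us @ t' # ws))"
  using assms
proof (induction rule: converse_rtranclp_induct)
  case (step t1 t2)
  have "step A s (Node f (us @ t1 # ws)) (Node f (us @ t2 # ws))"
    using step(1,4) by (cases f) (auto simp: step_def intro: rewrite.inner)
  moreover have "Node f (us @ t2 # ws) \<in> trees_with (out_alph A) (attribute_instances A s)"
    using calculation by (simp add: step_def)
  ultimately show ?case using step.IH by (meson converse_rtranclp_into_rtranclp)
qed simp

text \<open>The children are rewritten from left to right; \<open>vs\<close> collects those that are
  finished, so that \<open>steps_inner\<close> applies to the next one.\<close>

lemma steps_children:
  assumes "list_all2 (\<lambda>t u. t \<in> W \<and> (step A s)\<^sup>*\<^sup>* t u \<and> u \<in> W) ts us"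
    "W = trees_with (out_alph A) (attribute_instances A s)" "Node (Inl f) (vs @ ts) \<in> W"
  shows "(step A s)\<^sup>*\<^sup>* (Node (Inl f) (vs @ ts)) (Node (Inl f) (vs @ us)) \<and> Node (Inl f) (vs @ us) \<in> W"
  using assms
proof (induction ts us arbitrary: vs rule: list_all2_induct)
  case (Cons t ts u us)
  have "(step A s)\<^sup>*\<^sup>* (Node (Inl f) (vs @ t # ts)) (Node (Inl f) (vs @ u # ts))"
    using Cons by (intro steps_inner) auto
  moreover have "Node (Inl f) ((vs @ [u]) @ ts) \<in> W"
    using Cons by auto
  ultimately show ?case using Cons.IH[of "vs @ [u]"] Cons.prems by auto
qed simp

lemma gen_steps:
  assumes A: "is_att A" and s: "s \<in> trees (in_alph A)"
  shows "gen A s X u \<Longrightarrow> X \<in> trees_with (out_alph A) (attribute_instances A s) \<Longrightarrow>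
    (step A s)\<^sup>*\<^sup>* X (map_tree Inl u) \<and>
    map_tree Inl u \<in> trees_with (out_alph A) (attribute_instances A s)"
proof (induction rule: gen.induct)
  case (gen_Inl ts us f)
  then have "list_all2 (\<lambda>t u. t \<in> trees_with (out_alph A) (attribute_instances A s) \<and>
      (step A s)\<^sup>*\<^sup>* t u \<and> u \<in> trees_with (out_alph A) (attribute_instances A s)) ts (map (map_tree Inl) us)"
    by (auto simp: list_all2_conv_all_nth)
  from steps_children[OF this refl, of f "[]"] gen_Inl.prems show ?case by simp
next
  case (gen_Inr v x \<gamma> i \<xi> u)
  note inst = instantiate_in_trees_with[OF A s gen_Inr.hyps(1,2)]
  have "step A s (Node (Inr (\<gamma>, child v i)) []) (instantiate v \<xi>)"
    using gen_Inr inst is_att_ruleD(1)[OF A gen_Inr.hyps(2)] by (auto simp: step_def intro: rewrite.leaf)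
  then show ?case using gen_Inr inst by (meson converse_rtranclp_into_rtranclp)
qed

lemma att_translation_iff:
  assumes "is_att A"
  shows "(s, t) \<in> att_translation A \<longleftrightarrow>
    s \<in> trees (in_alph A) \<and> gen A s (Node (Inr (init A, [1])) []) t"
proof
  assume "(s, t) \<in> att_translation A"
  then show "s \<in> trees (in_alph A) \<and> gen A s (Node (Inr (init A, [1])) []) t"
    by (auto simp: att_translation_def steps_gen)
next
  assume *: "s \<in> trees (in_alph A) \<and> gen A s (Node (Inr (init A, [1])) []) t"
  have "[1] \<in> nodes (marked s)" by (cases s) (simp add: marked_def nodes_def)
  then have "(init A, [1]) \<in> attribute_instances A s"
    using assms by (auto simp: attribute_instances_def is_att_def)
  then show "(s, t) \<in> att_translation A"
    using gen_steps[OF assms, of s] * map_tree_Inl_in_trees_with by (fastforce simp: att_translation_def)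
qed

lemma gen_instantiate_ex:
  assumes "\<xi> \<in> trees_with \<Sigma> \<Lambda>" "\<And>\<gamma> i. Inr (\<gamma>, i) \<in> set_tree \<xi> \<Longrightarrow> defd A s \<gamma> (child v i)"
  shows "\<exists>u. gen A s (instantiate v \<xi>) u"
  using assms
proof (induction \<xi>)
  case (Node f ts)
  show ?case
  proof (cases f)
    case (Inl g)
    have "\<exists>u. gen A s (instantiate v t) u" if "t \<in> set ts" for t
      using Node that Inl by (auto intro!: Node.IH)
    then obtain h where "\<And>t. t \<in> set ts \<Longrightarrow> gen A s (instantiate v t) (h t)" by metis
    then have "list_all2 (gen A s) (map (instantiate v) ts) (map h ts)"
      by (auto simp: list_all2_conv_all_nth)
    then show ?thesis using Inl by (auto intro: gen_Inl)
  next
    case (Inr y)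
    then show ?thesis using Node.prems by (cases y) (auto simp: defd_def)
  qed
qed

text \<open>Definedness is propagated without mention of the outputs, which is all that the
  comparison of domains requires.\<close>

lemma defd_rule:
  assumes "is_att A" "label_at (marked s) v = Some x" "(x, (\<gamma>, i), \<xi>) \<in> rules A"
    "\<And>\<gamma>' i'. Inr (\<gamma>', i') \<in> set_tree \<xi> \<Longrightarrow> defd A s \<gamma>' (child v i')"
  shows "defd A s \<gamma> (child v i)"
  using gen_instantiate_ex[OF is_att_ruleD(2)[OF assms(1,3)], of A s v] assms(2-4)
  unfolding defd_def by (blast intro: gen_Inr)

section \<open>Relabelings\<close>

definition td_rhs :: "'b \<Rightarrow> 'q list \<Rightarrow> ('b + 'q \<times> nat) tree" where
  "td_rhs h qs = Node (Inl h) (map (\<lambda>i. Node (Inr (qs ! i, Suc i)) []) [0..<length qs])"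

lemma td_rhs_eq_iff [simp]: "td_rhs h qs = td_rhs g ps \<longleftrightarrow> h = g \<and> qs = ps"
proof
  assume eq: "td_rhs h qs = td_rhs g ps"
  then have "map (\<lambda>i. Node (Inr (qs ! i, Suc i)) []) [0..<length qs] =
      (map (\<lambda>i. Node (Inr (ps ! i, Suc i)) []) [0..<length ps] :: ('a + 'b \<times> nat) tree list)"
    by (simp add: td_rhs_def)
  then have n: "length qs = length ps" "i < length qs \<Longrightarrow> qs ! i = ps ! i" for i
    using map_eq_imp_length_eq map_eq_conv by fastforce+
  then have "qs = ps" by (rule nth_equalityI)
  then show "h = g \<and> qs = ps" using eq by (simp add: td_rhs_def)
qed simp

text \<open>Without inherited attributes the result at a node depends only on the subtree there, so
  the surrounding tree and the address can be forgotten.\<close>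

inductive td_run :: "('q, 'a, 'b) att \<Rightarrow> 'q \<Rightarrow> 'a tree \<Rightarrow> 'b tree \<Rightarrow> bool" for T where
  "(Some g, (q, 0), td_rhs h qs) \<in> rules T \<Longrightarrow> length ts = length qs \<Longrightarrow> length us = length qs \<Longrightarrow>
    \<forall>i<length qs. td_run T (qs ! i) (ts ! i) (us ! i) \<Longrightarrow> td_run T q (Node g ts) (Node h us)"

lemma td_run_gen:
  "td_run T q t u \<Longrightarrow> subtree (marked s) v = Some (map_tree Some t) \<Longrightarrow>
    gen T s (Node (Inr (q, v)) []) u"
proof (induction arbitrary: v rule: td_run.induct)
  case (1 g q h qs ts us)
  have "gen T s (Node (Inr (qs ! i, v @ [Suc i])) []) (us ! i)" if "i < length qs" for i
    using 1 that subtree_snoc[OF 1(5)[simplified], of "Suc i"] by simp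
  then have "gen T s (instantiate v (td_rhs h qs)) (Node h us)"
    using 1(3) by (auto simp: td_rhs_def list_all2_conv_all_nth child_def intro!: gen_Inl)
  moreover have "label_at (marked s) v = Some (Some g)" using 1(5) label_at_iff by fastforce
  ultimately have "gen T s (Node (Inr (q, child v 0)) []) (Node h us)"
    using gen_Inr[OF _ 1(1)] by metis
  then show ?case by (simp add: child_def)
qed

lemma is_td_relabeling_ruleD:
  assumes "is_td_relabeling T" "(x, (q, i), \<xi>) \<in> rules T"
  shows "\<exists>f g qs. x = Some f \<and> i = 0 \<and> \<xi> = td_rhs g qs \<and> (f, length qs) \<in> in_alph T \<and>
    (g, length qs) \<in> out_alph T"
proof -
  have "is_att T" "inh T = {}" using assms(1) by (auto simp: is_td_relabeling_def is_datt_def)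
  then have "i = 0" using is_att_ruleD(1)[OF _ assms(2)] by auto
  then show ?thesis using assms unfolding is_td_relabeling_def td_rhs_def by fastforce
qed

lemma gen_td_run:
  assumes T: "is_td_relabeling T"
  shows "gen T s (Node (Inr (q, v)) []) u \<Longrightarrow> subtree (marked s) v = Some (map_tree Some t) \<Longrightarrow>
    t \<in> trees (in_alph T) \<Longrightarrow> td_run T q t u"
proof (induction t arbitrary: q v u)
  case (Node g ts)
  from Node.prems(1) obtain w i x \<xi> where r: "v = child w i" "label_at (marked s) w = Some x"
    "(x, (q, i), \<xi>) \<in> rules T" "gen T s (instantiate w \<xi>) u"
    by (auto elim: gen_InrE)
  from is_td_relabeling_ruleD[OF T r(3)] obtain f h qs where f: "x = Some f" "i = 0"
    "\<xi> = td_rhs h qs" "(f, length qs) \<in> in_alph T" "(h, length qs) \<in> out_alph T"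
    by blast
  \<comment> \<open>Left-hand sides of a top-down relabeling are synthesized, so the index is 0 and
    the rule lives at the node itself.\<close>
  have v: "w = v" using r(1) f(2) by (simp add: child_def)
  have fg: "f = g" using r(2) Node.prems(2) f(1) by (auto simp: v label_at_iff)
  have len: "length ts = length qs"
    using T f(4) Node.prems(3) unfolding Node_in_trees_iff fg
    by (auto simp: is_td_relabeling_def is_datt_def is_att_def ranked_alphabet_def dest: single_valuedD)
  from r(4) obtain us where us: "u = Node h us"
    "list_all2 (gen T s) (map (instantiate v) (map (\<lambda>i. Node (Inr (qs ! i, Suc i)) []) [0..<length qs])) us"
    unfolding f(3) td_rhs_def v by (auto elim: gen_InlE)
  then have len': "length us = length qs" by (auto dest: list_all2_lengthD)
  have "td_run T (qs ! i) (ts ! i) (us ! i)" if i: "i < length qs" for i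
  proof (rule Node.IH)
    show "ts ! i \<in> set ts" using i len by simp
    show "gen T s (Node (Inr (qs ! i, v @ [Suc i])) []) (us ! i)"
      using us(2) i by (auto simp: list_all2_conv_all_nth child_def)
    show "subtree (marked s) (v @ [Suc i]) = Some (map_tree Some (ts ! i))"
      using subtree_snoc[of "marked s" v "Some g" "map (map_tree Some) ts" "Suc i"] Node.prems(2) i len
      by simp
    show "ts ! i \<in> trees (in_alph T)" using Node.prems(3) i len by (simp add: Node_in_trees_iff)
  qed
  then show ?case
    using r(3) len len' by (auto simp: us(1) f fg intro!: td_run.intros)
qed

lemma td_translation_iff:
  assumes "is_td_relabeling T"
  shows "(s, t) \<in> att_translation T \<longleftrightarrow> s \<in> trees (in_alph T) \<and> td_run T (init T) s t"
proof -
  have T: "is_att T" using assms by (simp add: is_td_relabeling_def is_datt_def)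
  have "subtree (marked s) [1] = Some (map_tree Some s)" using subtree_marked[of s "[]"] by simp
  then show ?thesis
    unfolding att_translation_iff[OF T]
    using gen_td_run[OF assms, of s "init T" "[1]" t s] td_run_gen[of T "init T" s t s "[1]"] by argo
qed

lemma td_run_out: "is_td_relabeling T \<Longrightarrow> td_run T q s t \<Longrightarrow> t \<in> trees (out_alph T)"
proof (rotate_tac, induction rule: td_run.induct)
  case (1 g q h qs ts us)
  from is_td_relabeling_ruleD[OF 1(5,1)] have "(h, length qs) \<in> out_alph T"
    by auto
  then show ?case using 1 by (auto simp: Node_in_trees_iff in_set_conv_nth)
qed

lemma td_run_in: "is_td_relabeling T \<Longrightarrow> td_run T q s t \<Longrightarrow> s \<in> trees (in_alph T)"
proof (rotate_tac, induction rule: td_run.induct)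
  case (1 g q h qs ts us)
  from is_td_relabeling_ruleD[OF 1(5,1)] have "(g, length qs) \<in> in_alph T"
    by auto
  then show ?case using 1 by (auto simp: Node_in_trees_iff in_set_conv_nth)
qed

section \<open>The construction\<close>

primrec lists_upto :: "nat \<Rightarrow> 'a list \<Rightarrow> 'a list list" where
  "lists_upto 0 xs = [[]]"
| "lists_upto (Suc n) xs = [] # concat (map (\<lambda>x. map (Cons x) (lists_upto n xs)) xs)"

lemma set_lists_upto: "set (lists_upto n xs) = {l. set l \<subseteq> set xs \<and> length l \<le> n}"
proof (induction n)
  case (Suc n)
  show ?case
  proof (rule set_eqI)
    show "l \<in> set (lists_upto (Suc n) xs) \<longleftrightarrow> l \<in> {l. set l \<subseteq> set xs \<and> length l \<le> Suc n}" for l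
      by (cases l) (auto simp: Suc)
  qed
qed auto

definition tuples :: "nat \<Rightarrow> 'a list \<Rightarrow> 'a list list" where
  "tuples k xs = filter (\<lambda>l. length l = k) (lists_upto k xs)"

lemma set_tuples: "set (tuples k xs) = {l. set l \<subseteq> set xs \<and> length l = k}"
  by (auto simp: tuples_def set_lists_upto)

definition numbered :: "'a list \<Rightarrow> (nat \<times> 'a) list" where
  "numbered xs = zip [0..<length xs] xs"

lemma mem_numbered: "(j, r) \<in> set (numbered xs) \<longleftrightarrow> j < length xs \<and> r = xs ! j"
  by (auto simp: numbered_def set_zip intro!: exI[of _ j])

lemma Ball_numbered: "(\<forall>z\<in>set (numbered xs). P z) \<longleftrightarrow> (\<forall>i<length xs. P (i, xs ! i))"
  by (auto simp: Ball_def mem_numbered)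

definition leaf_refs :: "('b + 'l) tree \<Rightarrow> 'l list" where
  "leaf_refs \<xi> = concat (map (\<lambda>y. case y of Inl _ \<Rightarrow> [] | Inr z \<Rightarrow> [z]) (labels \<xi>))"

lemma mem_leaf_refs: "z \<in> set (leaf_refs \<xi>) \<longleftrightarrow> Inr z \<in> set_tree \<xi>"
  by (force simp: leaf_refs_def set_labels split: sum.splits)

text \<open>Together with \<open>leaf_refs\<close> this recovers the symbol and the states from a
  tree of the form \<open>td_rhs h qs\<close>; the default 0 does not arise for such trees.\<close>

definition root_symbol :: "(nat + 'l) tree \<Rightarrow> nat" where
  "root_symbol \<xi> = (case labels \<xi> of [] \<Rightarrow> 0 | y # _ \<Rightarrow> (case y of Inl h \<Rightarrow> h | Inr _ \<Rightarrow> 0))"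

lemma root_symbol_td_rhs [simp]: "root_symbol (td_rhs h qs) = h"
  by (simp add: root_symbol_def td_rhs_def)

lemma leaf_refs_td_rhs [simp]: "map fst (leaf_refs (td_rhs h qs)) = qs"
proof -
  have "concat (map (\<lambda>y. case y of Inl _ \<Rightarrow> [] | Inr z \<Rightarrow> [z])
      (concat (map (\<lambda>i. [Inr (qs ! i, Suc i)]) is))) = map (\<lambda>i. (qs ! i, Suc i)) is" for "is"
    by (induction "is") simp_all
  then show ?thesis by (simp add: leaf_refs_def td_rhs_def o_def map_nth)
qed

type_synonym nat_att_rule = "(nat, nat, nat) att_rule"

text \<open>An entry \<open>((\<alpha>, i), j)\<close> says that the instance \<open>\<alpha>(\<pi> i)\<close> is evaluated with the \<open>j\<close>-th rule of
  the transducer. A list of entries is in the reverse order of evaluation: an entry only depends on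
  the entries behind it. Which rule is used for \<open>\<alpha>(\<pi> i)\<close> can be checked at \<open>\<pi>\<close> only if \<open>\<alpha>\<close> is
  synthesized and \<open>i = 0\<close>, or \<open>\<alpha>\<close> is inherited and \<open>i > 0\<close>. Schedules belong to a node together
  with its children, and their restrictions to a single node are lists of pairs \<open>(\<alpha>, j)\<close>.\<close>

type_synonym entry = "(nat \<times> nat) \<times> nat"
type_synonym plan = "(nat \<times> nat) list"

text \<open>The synthesized attributes, the inherited attributes and the rules of the transducer.\<close>

type_synonym att_data = "nat list \<times> nat list \<times> nat_att_rule list"

definition attributes :: "att_data \<Rightarrow> nat list" where
  "attributes X = fst X @ fst (snd X)"

definition justified :: "att_data \<Rightarrow> nat option \<Rightarrow> entry list \<Rightarrow> entry \<Rightarrow> bool" where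
  "justified X x M e \<longleftrightarrow> ((snd (fst e) = 0) = (fst (fst e) \<in> set (fst X)) \<longrightarrow>
    (\<exists>r\<in>set (numbered (snd (snd X))). fst r = snd e \<and> fst (snd r) = x \<and> fst (snd (snd r)) = fst e \<and>
      (\<forall>z\<in>set (leaf_refs (snd (snd (snd r)))). \<exists>e'\<in>set M. fst e' = z)))"

text \<open>Listing each instance at most once bounds the length of a schedule, so that a node has
  only finitely many of them.\<close>

primrec schedule :: "att_data \<Rightarrow> nat option \<Rightarrow> entry list \<Rightarrow> bool" where
  "schedule X x [] \<longleftrightarrow> True"
| "schedule X x (e # M) \<longleftrightarrow> schedule X x M \<and> (\<forall>e'\<in>set M. fst e' \<noteq> fst e) \<and> justified X x M e"

definition restr :: "nat \<Rightarrow> entry list \<Rightarrow> plan" where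
  "restr i M = map (\<lambda>e. (fst (fst e), snd e)) (filter (\<lambda>e. snd (fst e) = i) M)"

definition plans :: "att_data \<Rightarrow> plan list" where
  "plans X = lists_upto (length (attributes X)) (List.product (attributes X) [0..<length (snd (snd X))])"

text \<open>A schedule has at most one entry per attribute at each of the \<open>Suc k\<close> nodes
  of the neighbourhood, hence the bound on the length. Lists that are no schedules are included here
  and discarded by \<open>fits\<close>.\<close>

definition entry_lists :: "att_data \<Rightarrow> nat \<Rightarrow> entry list list" where
  "entry_lists X k = lists_upto (length (attributes X) * Suc k)
    (List.product (List.product (attributes X) [0..<Suc k]) [0..<length (snd (snd X))])"

definition fits :: "att_data \<Rightarrow> nat \<Rightarrow> nat list \<Rightarrow> (nat \<times> plan) list list \<Rightarrow> entry list \<Rightarrow> bool" where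
  "fits X h qs Qs M \<longleftrightarrow> length qs = length Qs \<and> schedule X (Some h) M \<and> restr 0 M \<in> set (plans X) \<and>
    (\<forall>z\<in>set (numbered (zip qs Qs)). (fst (snd z), restr (Suc (fst z)) M) \<in> set (snd (snd z)))"

text \<open>The given top-down relabeling is simulated here. A schedule has to suit the symbol that
  its rule writes, not the symbol \<open>g\<close> that it reads, so rule and schedule are chosen
  together.\<close>

definition choices :: "att_data \<Rightarrow> nat_att_rule list \<Rightarrow> nat \<Rightarrow> nat \<Rightarrow> (nat \<times> plan) list list \<Rightarrow>
    (nat \<times> nat list \<times> entry list) list" where
  "choices X RT g q Qs = concat (map (\<lambda>r. if fst r = Some g \<and> fst (snd r) = (q, 0)
    then map (\<lambda>M. (root_symbol (snd (snd r)), map fst (leaf_refs (snd (snd r))), M))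
      (filter (fits X (root_symbol (snd (snd r))) (map fst (leaf_refs (snd (snd r)))) Qs)
        (entry_lists X (length Qs)))
    else []) RT)"

definition state_plans :: "att_data \<Rightarrow> nat list \<Rightarrow> (nat \<times> plan) list" where
  "state_plans X ST = List.product ST (plans X)"

text \<open>\<open>step_set\<close> is the transition of the subset construction: the pairs of a state of the given
  top-down relabeling and a plan that are feasible at a node, given the feasible pairs of the
  children.\<close>

definition step_set :: "att_data \<Rightarrow> nat list \<Rightarrow> nat_att_rule list \<Rightarrow> nat \<Rightarrow> (nat \<times> plan) list list \<Rightarrow>
    (nat \<times> plan) list" where
  "step_set X ST RT g Qs = filter (\<lambda>z. \<exists>c\<in>set (choices X RT g (fst z) Qs). restr 0 (snd (snd c)) = snd z)
    (state_plans X ST)"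

text \<open>Sets of pairs are represented by lists. Values of \<open>step_set\<close> are filtered
  copies of \<open>state_plans\<close>, hence occur here, and are determined by the values at the
  children, so they can serve as states of a deterministic automaton.\<close>

definition feasibles :: "att_data \<Rightarrow> nat list \<Rightarrow> (nat \<times> plan) list list" where
  "feasibles X ST = lists_upto (length (state_plans X ST)) (state_plans X ST)"

definition B_states :: "att_data \<Rightarrow> nat list \<Rightarrow> nat list \<Rightarrow> nat list" where
  "B_states X ST ps = map enc (List.product ps (feasibles X ST))"

text \<open>The new symbol records the feasible sets of the children: the top-down relabeling has to
  choose a schedule for a node and its children, but reads only the label of the node.\<close>

definition B_out :: "att_data \<Rightarrow> nat list \<Rightarrow> (nat \<times> nat) list \<Rightarrow> (nat \<times> nat) list" where
  "B_out X ST b = concat (map (\<lambda>y. map (\<lambda>Qs. (enc (fst y, Qs), snd y)) (tuples (snd y) (feasibles X ST))) b)"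

definition B_rules :: "att_data \<Rightarrow> nat list \<Rightarrow> nat_att_rule list \<Rightarrow> (nat \<times> nat list \<times> nat \<times> nat) list \<Rightarrow>
    (nat \<times> nat list \<times> nat \<times> nat) list" where
  "B_rules X ST RT rs = concat (map (\<lambda>(f, ps, p, g). map (\<lambda>Qs.
      (f, map enc (zip ps Qs), enc (p, step_set X ST RT g Qs), enc (g, Qs)))
    (tuples (length ps) (feasibles X ST))) rs)"

text \<open>A state \<open>Some L'\<close> hands down the plan that the parent has chosen for this
  node. At the root no plan is prescribed; instead it must be a schedule for the root marker, whose
  first child is the root (hence the index 1), and it must evaluate the initial attribute.\<close>

definition state_ok :: "att_data \<Rightarrow> nat \<Rightarrow> plan option \<Rightarrow> plan \<Rightarrow> bool" where
  "state_ok X a0 st L \<longleftrightarrow> (case st of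
      None \<Rightarrow> schedule X None (map (\<lambda>e. ((fst e, 1), snd e)) L) \<and> (\<exists>e\<in>set L. fst e = a0)
    | Some L' \<Rightarrow> L' = L)"

definition T_states :: "att_data \<Rightarrow> nat list \<Rightarrow> (nat \<times> plan option) list" where
  "T_states X ST = List.product ST (None # map Some (plans X))"

definition T_out :: "att_data \<Rightarrow> (nat \<times> nat) list \<Rightarrow> (nat \<times> nat) list" where
  "T_out X b = map (\<lambda>z. (enc (fst (fst z), snd z), snd (fst z))) (List.product b (plans X))"

definition T_rhs :: "nat \<times> nat list \<times> entry list \<Rightarrow> (nat + nat \<times> nat) tree" where
  "T_rhs c = Node (Inl (enc (fst c, restr 0 (snd (snd c)))))
    (map (\<lambda>z. Node (Inr (enc (snd z, Some (restr (Suc (fst z)) (snd (snd c)))), Suc (fst z))) [])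
      (numbered (fst (snd c))))"

definition T_choice :: "att_data \<Rightarrow> nat \<Rightarrow> nat_att_rule list \<Rightarrow> nat \<Rightarrow> (nat \<times> plan) list list \<Rightarrow>
    nat \<times> plan option \<Rightarrow> (nat \<times> nat list \<times> entry list) list" where
  "T_choice X a0 RT g Qs z = filter (\<lambda>c. state_ok X a0 (snd z) (restr 0 (snd (snd c)))) (choices X RT g (fst z) Qs)"

text \<open>Taking the first admissible choice makes the relabeling deterministic. Feasibility has
  been settled bottom-up, so this choice cannot lead to a failure further down.\<close>

definition T_rule :: "att_data \<Rightarrow> nat \<Rightarrow> nat_att_rule list \<Rightarrow> nat \<Rightarrow> (nat \<times> plan) list list \<Rightarrow>
    nat \<times> plan option \<Rightarrow> nat_att_rule list" where
  "T_rule X a0 RT g Qs z = (case T_choice X a0 RT g Qs z of [] \<Rightarrow> []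
    | c # _ \<Rightarrow> [(Some (enc (g, Qs)), (enc z, 0), T_rhs c)])"

definition T_rules :: "att_data \<Rightarrow> nat \<Rightarrow> nat list \<Rightarrow> nat_att_rule list \<Rightarrow> (nat \<times> nat) list \<Rightarrow>
    nat_att_rule list" where
  "T_rules X a0 ST RT b = concat (map (\<lambda>y. concat (map (\<lambda>Qs. concat (map (T_rule X a0 RT (fst y) Qs) (T_states X ST)))
      (tuples (snd y) (feasibles X ST)))) b)"

text \<open>The new transducer has the attributes \<open>(a, 0)\<close> for synthesized \<open>a\<close>, whose rule is looked up in
  the plan at the node, and \<open>(b, j)\<close> for inherited \<open>b\<close>, where \<open>j\<close> is the rule to be used at the
  parent.\<close>

definition D_syn :: "att_data \<Rightarrow> nat list" where
  "D_syn X = map (\<lambda>a. enc (a, 0 :: nat)) (fst X)"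

definition D_inh :: "att_data \<Rightarrow> nat list" where
  "D_inh X = map enc (List.product (fst (snd X)) [0..<Suc (length (snd (snd X)))])"

text \<open>The default 0 stands for attributes absent from the plan. If there are no rules, it is
  not a rule number; therefore \<open>lookup_le\<close> and \<open>D_inh\<close> admit the total
  number of rules as an upper bound, inclusively.\<close>

definition lookup :: "plan \<Rightarrow> nat \<Rightarrow> nat" where
  "lookup L \<alpha> = foldr (\<lambda>e r. if fst e = \<alpha> then snd e else r) L 0"

definition D_attr :: "att_data \<Rightarrow> nat \<Rightarrow> nat \<Rightarrow> nat" where
  "D_attr X \<alpha> j = enc (\<alpha>, if \<alpha> \<in> set (fst X) then 0 else j)"

text \<open>Inherited attributes on a right-hand side belong to the node itself, so its plan
  \<open>L\<close> gives the rule number to be put into the name. References to synthesized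
  attributes of children carry no number, because each child looks it up in its own plan.\<close>

definition D_rhs :: "att_data \<Rightarrow> plan \<Rightarrow> (nat + nat \<times> nat) tree \<Rightarrow> (nat + nat \<times> nat) tree" where
  "D_rhs X L \<xi> = map_tree (\<lambda>y. case y of Inl f \<Rightarrow> Inl f
    | Inr z \<Rightarrow> Inr (D_attr X (fst z) (lookup L (fst z)), snd z)) \<xi>"

text \<open>For an inherited left-hand side the number in the attribute name selects the rule, so
  the plan of the parent imposes no condition. The rule is still copied for each plan, as the plan
  is part of the input symbol and fixes the names on the right-hand side.\<close>

definition D_rule :: "att_data \<Rightarrow> (nat \<times> nat_att_rule) \<times> plan \<Rightarrow> nat_att_rule list" where
  "D_rule X = (\<lambda>((j, x, (\<alpha>, i), \<xi>), L).
    if \<alpha> \<in> set (fst X) \<longrightarrow> lookup L \<alpha> = j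
    then [(case x of None \<Rightarrow> None | Some h \<Rightarrow> Some (enc (h, L)), (D_attr X \<alpha> j, i), D_rhs X L \<xi>)]
    else [])"

definition D_rules :: "att_data \<Rightarrow> nat_att_rule list" where
  "D_rules X = concat (map (D_rule X) (List.product (numbered (snd (snd X))) (plans X)))"

section \<open>Elementary facts about schedules, restrictions and plans\<close>

lemma schedule_append: "schedule X x (P @ M) \<Longrightarrow> schedule X x M"
  by (induction P) auto

lemma schedule_distinct: "schedule X x M \<Longrightarrow> distinct (map fst M)"
  by (induction M) auto

lemma restr_simps [simp]:
  "restr i [] = []"
  "restr i (e # M) = (if snd (fst e) = i then (fst (fst e), snd e) # restr i M else restr i M)"
  "restr i (P @ M) = restr i P @ restr i M"
  by (simp_all add: restr_def)

lemma mem_restr: "(\<alpha>, j) \<in> set (restr i M) \<longleftrightarrow> ((\<alpha>, i), j) \<in> set M"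
  by (force simp: restr_def)

lemma distinct_restr: "distinct (map fst M) \<Longrightarrow> distinct (map fst (restr i M))"
proof (induction M)
  case (Cons e M)
  then show ?case by (cases e) (force simp: mem_restr)
qed simp

lemma lookup_eq: "distinct (map fst L) \<Longrightarrow> (\<alpha>, j) \<in> set L \<Longrightarrow> lookup L \<alpha> = j"
  by (induction L) (auto simp: lookup_def, force)

lemma lookup_cases: "lookup L \<alpha> = 0 \<or> (\<alpha>, lookup L \<alpha>) \<in> set L"
  by (induction L) (auto simp: lookup_def)

lemma length_le_product:
  assumes "distinct (map fst L)" "fst ` set L \<subseteq> C" "finite C" "card C \<le> n"
  shows "length L \<le> n"
proof -
  have "length L = card (fst ` set L)"
    using distinct_card[OF assms(1)] by simp
  then show ?thesis using card_mono[OF assms(3,2)] assms(4) by simp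
qed

lemma step_set_feasible: "step_set X ST RT g Qs \<in> set (feasibles X ST)"
  by (auto simp: feasibles_def set_lists_upto step_set_def)

lemma T_rhs_eq: "T_rhs (h, qs, M) = td_rhs (enc (h, restr 0 M))
    (map (\<lambda>z. enc (snd z, Some (restr (Suc (fst z)) M))) (numbered qs))"
  by (auto simp: T_rhs_def td_rhs_def numbered_def intro!: nth_equalityI)

text \<open>The components are lists, as read off a code in whatever order. The list
  \<open>bB\<close> is shared as output alphabet of \<open>B0\<close> and input alphabet of
  \<open>T0\<close>, and \<open>oT\<close> links \<open>T0\<close> and \<open>A0\<close> in the same
  way.\<close>

locale look_around_att =
  fixes sB fB :: "nat list" and aB bB :: "(nat \<times> nat) list"
    and rB :: "(nat \<times> nat list \<times> nat \<times> nat) list"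
    and ST :: "nat list" and oT :: "(nat \<times> nat) list" and q0 :: nat and RT :: "nat_att_rule list"
    and S I :: "nat list" and oA :: "(nat \<times> nat) list" and a0 :: nat and R :: "nat_att_rule list"
    and B0 :: "(nat, nat, nat) bu" and T0 A0 :: "(nat, nat, nat) att"
  assumes B0_def: "B0 = \<lparr>states = set sB, bu_in = set aB, bu_out = set bB, final = set fB, bu_rules = set rB\<rparr>"
    and T0_def: "T0 = \<lparr>syn = set ST, inh = {}, in_alph = set bB, out_alph = set oT, init = q0, rules = set RT\<rparr>"
    and A0_def: "A0 = \<lparr>syn = set S, inh = set I, in_alph = set oT, out_alph = set oA, init = a0, rules = set R\<rparr>"
    and B0: "is_bu_relabeling B0" and T0: "is_td_relabeling T0" and A0: "is_att A0"
begin

definition X :: att_data where "X = (S, I, R)"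

lemma X_sel [simp]: "fst X = S" "fst (snd X) = I" "snd (snd X) = R"
  by (simp_all add: X_def)

definition B :: "(nat, nat, nat) bu" where
  "B = \<lparr>states = set (B_states X ST sB), bu_in = set aB, bu_out = set (B_out X ST bB),
    final = set (B_states X ST fB), bu_rules = set (B_rules X ST RT rB)\<rparr>"

definition T :: "(nat, nat, nat) att" where
  "T = \<lparr>syn = set (map enc (T_states X ST)), inh = {}, in_alph = set (B_out X ST bB),
    out_alph = set (T_out X oT), init = enc (q0, None :: plan option), rules = set (T_rules X a0 ST RT bB)\<rparr>"

definition D :: "(nat, nat, nat) att" where
  "D = \<lparr>syn = set (D_syn X), inh = set (D_inh X), in_alph = set (T_out X oT), out_alph = set oA,
    init = enc (a0, 0 :: nat), rules = set (D_rules X)\<rparr>"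

lemma mem_B_states: "enc (p, Q) \<in> set (B_states X ST ps) \<longleftrightarrow> p \<in> set ps \<and> Q \<in> set (feasibles X ST)"
  by (auto simp: B_states_def image_iff)

lemma mem_B_out: "(n, k) \<in> set (B_out X ST b) \<longleftrightarrow>
    (\<exists>g Qs. n = enc (g, Qs) \<and> (g, k) \<in> set b \<and> set Qs \<subseteq> set (feasibles X ST) \<and> length Qs = k)"
  by (force simp: B_out_def set_tuples)

lemma mem_B_rules: "(f, ps', p', n) \<in> set (B_rules X ST RT rB) \<longleftrightarrow>
    (\<exists>ps p g Qs. (f, ps, p, g) \<in> set rB \<and> set Qs \<subseteq> set (feasibles X ST) \<and> length Qs = length ps \<and>
      ps' = map enc (zip ps Qs) \<and> p' = enc (p, step_set X ST RT g Qs) \<and> n = enc (g, Qs))"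
  by (simp add: B_rules_def set_tuples image_iff Bex_def split_paired_Ex) blast

lemma mem_T_out: "(n, k) \<in> set (T_out X b) \<longleftrightarrow> (\<exists>h L. n = enc (h, L) \<and> (h, k) \<in> set b \<and> L \<in> set (plans X))"
  by (force simp: T_out_def)

lemma mem_plans: "L \<in> set (plans X) \<longleftrightarrow> length L \<le> length (S @ I) \<and>
    (\<forall>(\<alpha>, j)\<in>set L. \<alpha> \<in> set S \<union> set I \<and> j < length R)"
  by (auto simp: plans_def set_lists_upto attributes_def)

lemma mem_entry_lists: "M \<in> set (entry_lists X k) \<longleftrightarrow> length M \<le> length (S @ I) * Suc k \<and>
    (\<forall>((\<alpha>, i), j)\<in>set M. \<alpha> \<in> set S \<union> set I \<and> i \<le> k \<and> j < length R)"
  by (fastforce simp: entry_lists_def set_lists_upto attributes_def)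

lemma T0_rule:
  assumes "(x, (q, i), \<xi>) \<in> set RT"
  shows "\<exists>g h qs. x = Some g \<and> i = 0 \<and> \<xi> = td_rhs h qs \<and> (g, length qs) \<in> set bB \<and> (h, length qs) \<in> set oT"
  using is_td_relabeling_ruleD[OF T0, of x q i \<xi>] assms by (auto simp: T0_def)

lemma T0_rule_states:
  assumes "(Some g, (q, 0), td_rhs h qs) \<in> set RT"
  shows "q \<in> set ST" "set qs \<subseteq> set ST"
proof -
  have att: "is_att T0" using T0 by (simp add: is_td_relabeling_def is_datt_def)
  have r: "(Some g, (q, 0), td_rhs h qs) \<in> rules T0" using assms by (simp add: T0_def)
  show "q \<in> set ST" using is_att_ruleD(1)[OF att r] by (simp add: T0_def)
  have "Inr (qs ! i, Suc i) \<in> set_tree (td_rhs h qs)" if "i < length qs" for i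
    using that by (auto simp: td_rhs_def)
  then show "set qs \<subseteq> set ST"
    using is_att_ruleD(3)[OF att r] by (fastforce simp: T0_def in_set_conv_nth)
qed

text \<open>Every right-hand side of the given relabeling has the form \<open>td_rhs\<close>
  (\<open>T0_rule\<close>), so the symbol and the states kept in a choice retain the whole
  rule.\<close>

lemma mem_choices: "(h, qs, M) \<in> set (choices X RT g q Qs) \<longleftrightarrow>
    (Some g, (q, 0), td_rhs h qs) \<in> set RT \<and> M \<in> set (entry_lists X (length Qs)) \<and> fits X h qs Qs M"
proof
  assume "(h, qs, M) \<in> set (choices X RT g q Qs)"
  then obtain \<xi> where \<xi>: "(Some g, (q, 0), \<xi>) \<in> set RT" "h = root_symbol \<xi>" "qs = map fst (leaf_refs \<xi>)"
    "M \<in> set (entry_lists X (length Qs))" "fits X h qs Qs M"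
    by (auto simp: choices_def split: if_splits)
  from T0_rule[OF \<xi>(1)] \<xi>(2,3) have "\<xi> = td_rhs h qs" by auto
  then show "(Some g, (q, 0), td_rhs h qs) \<in> set RT \<and> M \<in> set (entry_lists X (length Qs)) \<and> fits X h qs Qs M"
    using \<xi> by simp
qed (force simp: choices_def)

lemma fits_iff: "fits X h qs Qs M \<longleftrightarrow> length qs = length Qs \<and> schedule X (Some h) M \<and>
    restr 0 M \<in> set (plans X) \<and> (\<forall>i<length qs. (qs ! i, restr (Suc i) M) \<in> set (Qs ! i))"
  unfolding fits_def Ball_numbered by auto

lemma mem_state_plans: "(q, L) \<in> set (state_plans X ST) \<longleftrightarrow> q \<in> set ST \<and> L \<in> set (plans X)"
  by (auto simp: state_plans_def)

lemma mem_T_states: "(q, st) \<in> set (T_states X ST) \<longleftrightarrow>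
    q \<in> set ST \<and> (case st of None \<Rightarrow> True | Some L \<Rightarrow> L \<in> set (plans X))"
  by (auto simp: T_states_def split: option.splits)

lemma mem_T_rules: "(x, l, \<xi>) \<in> set (T_rules X a0 ST RT bB) \<longleftrightarrow>
    (\<exists>g Qs q st c cs. (g, length Qs) \<in> set bB \<and> set Qs \<subseteq> set (feasibles X ST) \<and>
      (q, st) \<in> set (T_states X ST) \<and> T_choice X a0 RT g Qs (q, st) = c # cs \<and>
      x = Some (enc (g, Qs)) \<and> l = (enc (q, st), 0) \<and> \<xi> = T_rhs c)"
proof -
  have rule: "(x, l, \<xi>) \<in> set (T_rule X a0 RT g Qs z) \<longleftrightarrow> (\<exists>c cs. T_choice X a0 RT g Qs z = c # cs \<and>
      x = Some (enc (g, Qs)) \<and> l = (enc z, 0) \<and> \<xi> = T_rhs c)" for g Qs z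
    by (cases "T_choice X a0 RT g Qs z") (simp_all add: T_rule_def)
  show ?thesis
    by (simp add: T_rules_def set_tuples rule Bex_def split_paired_Ex) blast
qed

lemma mem_T_choice: "(h, qs, M) \<in> set (T_choice X a0 RT g Qs (q, st)) \<longleftrightarrow>
    (h, qs, M) \<in> set (choices X RT g q Qs) \<and> state_ok X a0 st (restr 0 M)"
  by (auto simp: T_choice_def)

lemma mem_D_rules: "(y, l, \<zeta>) \<in> set (D_rules X) \<longleftrightarrow>
    (\<exists>j x \<alpha> i \<xi> L. j < length R \<and> R ! j = (x, (\<alpha>, i), \<xi>) \<and> L \<in> set (plans X) \<and>
      (\<alpha> \<in> set S \<longrightarrow> lookup L \<alpha> = j) \<and> y = map_option (\<lambda>h. enc (h, L)) x \<and>
      l = (D_attr X \<alpha> j, i) \<and> \<zeta> = D_rhs X L \<xi>)"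
proof -
  have rule: "(y, l, \<zeta>) \<in> set (D_rule X ((j, x, (\<alpha>, i), \<xi>), L)) \<longleftrightarrow> (\<alpha> \<in> set S \<longrightarrow> lookup L \<alpha> = j) \<and>
      y = map_option (\<lambda>h. enc (h, L)) x \<and> l = (D_attr X \<alpha> j, i) \<and> \<zeta> = D_rhs X L \<xi>" for j x \<alpha> i \<xi> L
    by (cases x) (auto simp: D_rule_def)
  have "(j, x, (\<alpha>, i), \<xi>) \<in> set (numbered R) \<longleftrightarrow> j < length R \<and> R ! j = (x, (\<alpha>, i), \<xi>)" for j x \<alpha> i \<xi>
    by (auto simp: mem_numbered)
  then show ?thesis
    by (simp add: D_rules_def Bex_def split_paired_Ex rule)
qed

lemma A0_rule:
  assumes "j < length R" "R ! j = (x, (\<alpha>, i), \<xi>)"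
  shows "(x, (\<alpha>, i), \<xi>) \<in> rules A0"
  using assms nth_mem[of j R] by (simp add: A0_def)

lemma disjoint: "\<alpha> \<in> set S \<Longrightarrow> \<alpha> \<in> set I \<Longrightarrow> False"
  using A0 by (auto simp: is_att_def A0_def)

lemma D_attr_mem: "\<alpha> \<in> set S \<Longrightarrow> D_attr X \<alpha> j \<in> syn D"
  "\<alpha> \<in> set I \<Longrightarrow> j \<le> length R \<Longrightarrow> D_attr X \<alpha> j \<in> inh D"
  using disjoint by (auto simp: D_def D_attr_def D_syn_def D_inh_def)

lemma lookup_le: "L \<in> set (plans X) \<Longrightarrow> lookup L \<alpha> \<le> length R"
  using lookup_cases[of L \<alpha>] by (fastforce simp: mem_plans)

lemma sv_bB: "single_valued (set bB)" and sv_oT: "single_valued (set oT)"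
  using B0 A0 by (auto simp: is_bu_relabeling_def is_att_def ranked_alphabet_def B0_def A0_def)

section \<open>Well-formedness of the constructed transducer\<close>

lemma is_bu_relabeling_B: "is_bu_relabeling B"
proof -
  have B0': "set fB \<subseteq> set sB" "ranked_alphabet (set aB)"
    "\<And>f ps p g. (f, ps, p, g) \<in> set rB \<Longrightarrow> set ps \<subseteq> set sB \<and> p \<in> set sB \<and>
      (f, length ps) \<in> set aB \<and> (g, length ps) \<in> set bB"
    "\<And>f ps p g p' g'. (f, ps, p, g) \<in> set rB \<Longrightarrow> (f, ps, p', g') \<in> set rB \<Longrightarrow> p = p' \<and> g = g'"
    using B0 unfolding is_bu_relabeling_def B0_def by fastforce+
  have "ranked_alphabet (set (B_out X ST bB))"
    using sv_bB by (auto simp: ranked_alphabet_def single_valued_def mem_B_out)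
  moreover have "set (B_states X ST fB) \<subseteq> set (B_states X ST sB)"
    using B0'(1) by (auto simp: B_states_def)
  moreover have r3: "set ps' \<subseteq> set (B_states X ST sB) \<and> p' \<in> set (B_states X ST sB) \<and>
      (f, length ps') \<in> set aB \<and> (n, length ps') \<in> set (B_out X ST bB)"
    if "(f, ps', p', n) \<in> set (B_rules X ST RT rB)" for f ps' p' n
    using that B0'(3) unfolding mem_B_rules
    by (fastforce simp: mem_B_states mem_B_out step_set_feasible dest: set_zip_leftD set_zip_rightD)
  moreover have "case r of (f, ps, p, g) \<Rightarrow> set ps \<subseteq> states B \<and> p \<in> states B \<and>
      (f, length ps) \<in> bu_in B \<and> (g, length ps) \<in> bu_out B" if "r \<in> bu_rules B" for r
    using that r3 by (cases r) (simp add: B_def)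
  moreover have "p' = p'' \<and> n = n''"
    if "(f, ps', p', n) \<in> set (B_rules X ST RT rB)" "(f, ps', p'', n'') \<in> set (B_rules X ST RT rB)"
    for f ps' p' n p'' n''
  proof -
    from that(1) obtain ps p g Qs where 1: "(f, ps, p, g) \<in> set rB" "length Qs = length ps"
      "ps' = map enc (zip ps Qs)" "p' = enc (p, step_set X ST RT g Qs)" "n = enc (g, Qs)"
      unfolding mem_B_rules by blast
    from that(2) obtain qs q h Us where 2: "(f, qs, q, h) \<in> set rB" "length Us = length qs"
      "ps' = map enc (zip qs Us)" "p'' = enc (q, step_set X ST RT h Us)" "n'' = enc (h, Us)"
      unfolding mem_B_rules by blast
    \<comment> \<open>As the zipped lists have equal lengths, the coded list of states determines
      the given states and the feasible sets, and so the rule.\<close>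
    have "zip ps Qs = zip qs Us"
      using inj_map_eq_map[of "enc :: nat \<times> (nat \<times> plan) list \<Rightarrow> nat" "zip ps Qs" "zip qs Us"]
        1(3) 2(3) by (simp add: inj_def)
    then have "ps = qs" "Qs = Us"
      using 1(2) 2(2) by (metis map_fst_zip) (metis 1(2) 2(2) \<open>zip ps Qs = zip qs Us\<close> map_snd_zip)
    then show ?thesis using 1 2 B0'(4) by blast
  qed
  ultimately show ?thesis
    unfolding is_bu_relabeling_def using B0'(2) by (simp add: B_def) blast
qed

lemma is_td_relabeling_T: "is_td_relabeling T"
proof -
  have bout: "ranked_alphabet (set (B_out X ST bB))"
    using is_bu_relabeling_B by (simp add: is_bu_relabeling_def B_def)
  have tout: "ranked_alphabet (set (T_out X oT))"
    using sv_oT by (auto simp: ranked_alphabet_def single_valued_def mem_T_out)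
  have rule: "\<exists>f g qs q. x = Some f \<and> l = (q, 0) \<and> \<xi> = td_rhs g qs \<and> (f, length qs) \<in> in_alph T \<and>
      (g, length qs) \<in> out_alph T \<and> q \<in> syn T \<and> set qs \<subseteq> syn T"
    if "(x, l, \<xi>) \<in> rules T" for x l \<xi>
  proof -
    from that obtain g Qs q st h qs M cs where r: "(g, length Qs) \<in> set bB"
      "set Qs \<subseteq> set (feasibles X ST)" "(q, st) \<in> set (T_states X ST)"
      "T_choice X a0 RT g Qs (q, st) = (h, qs, M) # cs"
      "x = Some (enc (g, Qs))" "l = (enc (q, st), 0)" "\<xi> = T_rhs (h, qs, M)"
      by (auto simp: T_def mem_T_rules)
    have "(h, qs, M) \<in> set (T_choice X a0 RT g Qs (q, st))" using r(4) by simp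
    then have c: "(Some g, (q, 0), td_rhs h qs) \<in> set RT" "fits X h qs Qs M"
      by (auto simp: mem_T_choice mem_choices)
    then have len: "length qs = length Qs" and pl: "restr 0 M \<in> set (plans X)"
      and ch: "\<And>i. i < length qs \<Longrightarrow> (qs ! i, restr (Suc i) M) \<in> set (Qs ! i)"
      by (auto simp: fits_iff)
    have "enc (qs ! i, Some (restr (Suc i) M)) \<in> syn T" if i: "i < length qs" for i
    proof -
      have "Qs ! i \<in> set (feasibles X ST)" using r(2) i len by auto
      then have "(qs ! i, restr (Suc i) M) \<in> set (state_plans X ST)"
        using ch[OF i] by (auto simp: feasibles_def set_lists_upto)
      then show ?thesis by (auto simp: T_def mem_state_plans mem_T_states)
    qed
    then have "set (map (\<lambda>z. enc (snd z, Some (restr (Suc (fst z)) M))) (numbered qs)) \<subseteq> syn T"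
      by (auto simp: mem_numbered)
    moreover have "length (numbered qs) = length Qs" by (simp add: numbered_def len)
    moreover have "(enc (g, Qs), length Qs) \<in> in_alph T"
      using r(1,2) by (auto simp: T_def mem_B_out)
    moreover have "(enc (h, restr 0 M), length Qs) \<in> out_alph T"
      using T0_rule[OF c(1)] pl len by (auto simp: T_def mem_T_out)
    moreover have "enc (q, st) \<in> syn T" using r(3) by (simp add: T_def)
    ultimately show ?thesis using r(5-7) by (auto simp: T_rhs_eq)
  qed
  have "is_att_rule T r" if "r \<in> rules T" for r
  proof -
    obtain x \<gamma> i \<xi> where fields: "r = (x, (\<gamma>, i), \<xi>)" by (metis surj_pair)
    from rule[of x "(\<gamma>, i)" \<xi>] that fields obtain f g qs where "x = Some f" "i = 0" "\<xi> = td_rhs g qs"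
      "(f, length qs) \<in> in_alph T" "(g, length qs) \<in> out_alph T" "\<gamma> \<in> syn T" "set qs \<subseteq> syn T"
      by auto
    then show ?thesis
      by (auto simp: fields is_att_rule_def td_rhs_def intro!: exI[of _ "length qs"])
  qed
  moreover have "init T \<in> syn T"
    using T0 by (auto simp: is_td_relabeling_def is_datt_def is_att_def T0_def T_def mem_T_states)
  moreover have "deterministic T"
    unfolding deterministic_def T_def by (auto simp: mem_T_rules)
  moreover have "finite (syn T)" "inh T = {}" "finite (rules T)" by (simp_all add: T_def)
  ultimately have "is_datt T"
    using bout tout by (simp add: is_datt_def is_att_def T_def)
  then show ?thesis
    unfolding is_td_relabeling_def using rule \<open>inh T = {}\<close> by (fastforce simp: td_rhs_def)
qed

lemma D_rhs_trees_with:
  assumes "\<xi> \<in> trees_with \<Sigma> \<Lambda>" "\<And>\<gamma> i. (\<gamma>, i) \<in> \<Lambda> \<Longrightarrow> (D_attr X \<gamma> (lookup L \<gamma>), i) \<in> \<Lambda>'"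
  shows "D_rhs X L \<xi> \<in> trees_with \<Sigma> \<Lambda>'"
proof -
  have "D_rhs X L \<xi> = map_tree (map_sum id (\<lambda>z. (D_attr X (fst z) (lookup L (fst z)), snd z))) \<xi>"
    unfolding D_rhs_def by (rule tree.map_cong0) (auto split: sum.split)
  then show ?thesis using assms(2) by (auto intro!: map_tree_trees_with[OF assms(1)])
qed

lemma is_datt_D: "is_datt D"
proof -
  have ranked: "ranked_alphabet (set (T_out X oT))" "ranked_alphabet (set oA)"
    using sv_oT A0 by (auto simp: ranked_alphabet_def single_valued_def mem_T_out is_att_def A0_def)
  have rule: "is_att_rule D (y, l, \<zeta>)" if yl: "(y, l, \<zeta>) \<in> rules D" for y l \<zeta>
  proof -
    from yl obtain j x \<alpha> i \<xi> L where r: "j < length R" "R ! j = (x, (\<alpha>, i), \<xi>)" "L \<in> set (plans X)"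
      "\<alpha> \<in> set S \<longrightarrow> lookup L \<alpha> = j" "y = map_option (\<lambda>h. enc (h, L)) x" "l = (D_attr X \<alpha> j, i)"
      "\<zeta> = D_rhs X L \<xi>"
      by (auto simp: D_def mem_D_rules)
    have A: "is_att_rule A0 (x, (\<alpha>, i), \<xi>)"
      using A0 A0_rule[OF r(1,2)] by (auto simp: is_att_def)
    show ?thesis
    proof (cases x)
      case None
      then have "\<alpha> \<in> set I" "i = 1" "\<xi> \<in> trees_with (set oA) (set S \<times> {1})"
        using A by (auto simp: is_att_rule_def A0_def)
      moreover have "D_rhs X L \<xi> \<in> trees_with (set oA) (syn D \<times> {1})"
        by (rule D_rhs_trees_with[OF calculation(3)]) (auto simp: D_attr_mem)
      moreover have "out_alph D = set oA" by (simp add: D_def)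
      ultimately show ?thesis using r None by (auto simp: is_att_rule_def D_attr_mem)
    next
      case (Some h)
      then obtain k where k: "(h, k) \<in> set oT" "\<alpha> \<in> set S \<and> i = 0 \<or> \<alpha> \<in> set I \<and> i \<in> {1..k}"
        "\<xi> \<in> trees_with (set oA) (set S \<times> {1..k} \<union> set I \<times> {0})"
        using A by (auto simp: is_att_rule_def A0_def)
      have "D_rhs X L \<xi> \<in> trees_with (set oA) (syn D \<times> {1..k} \<union> inh D \<times> {0})"
        by (rule D_rhs_trees_with[OF k(3)]) (auto simp: D_attr_mem lookup_le[OF r(3)])
      moreover have "(enc (h, L), k) \<in> in_alph D" using k(1) r(3) by (auto simp: D_def mem_T_out)
      moreover have "D_attr X \<alpha> j \<in> syn D \<and> i = 0 \<or> D_attr X \<alpha> j \<in> inh D \<and> i \<in> {1..k}"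
        using k(2) r(1) by (auto simp: D_attr_mem)
      moreover have "out_alph D = set oA" by (simp add: D_def)
      ultimately show ?thesis using r Some by (auto simp: is_att_rule_def)
    qed
  qed
  have "\<zeta> = \<zeta>'" if yl: "(y, l, \<zeta>) \<in> rules D" "(y, l, \<zeta>') \<in> rules D" for y l \<zeta> \<zeta>'
  proof -
    from yl(1) obtain j x \<alpha> i \<xi> L where r: "j < length R" "R ! j = (x, (\<alpha>, i), \<xi>)" "L \<in> set (plans X)"
      "\<alpha> \<in> set S \<longrightarrow> lookup L \<alpha> = j" "y = map_option (\<lambda>h. enc (h, L)) x" "l = (D_attr X \<alpha> j, i)"
      "\<zeta> = D_rhs X L \<xi>"
      by (auto simp: D_def mem_D_rules)
    from yl(2) have "(y, l, \<zeta>') \<in> set (D_rules X)" by (simp add: D_def)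
    then obtain j' x' \<alpha>' i' \<xi>' L' where r': "j' < length R" "R ! j' = (x', (\<alpha>', i'), \<xi>')"
      "\<alpha>' \<in> set S \<longrightarrow> lookup L' \<alpha>' = j'" "y = map_option (\<lambda>h. enc (h, L')) x'"
      "l = (D_attr X \<alpha>' j', i')" "\<zeta>' = D_rhs X L' \<xi>'"
      unfolding mem_D_rules by blast
    have \<alpha>: "\<alpha> = \<alpha>'" "\<alpha> \<notin> set S \<Longrightarrow> j = j'"
      using r(6) r'(5) by (auto simp: D_attr_def split: if_splits)
    show ?thesis
    proof (cases y)
      case None
      \<comment> \<open>The root marker carries no plan, so \<open>L\<close> and \<open>L'\<close>
        may differ. But left-hand sides there are inherited and name their rule, and right-hand
        sides contain only synthesized attributes, whose new names are independent of the
        plan.\<close>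
      then have x: "x = None" "x' = None" using r(5) r'(4) by auto
      have "\<alpha> \<notin> set S"
        using is_att_ruleD(6)[OF A0 A0_rule[OF r(1,2)] x(1)] disjoint by (auto simp: A0_def)
      then have "\<xi> = \<xi>'" using \<alpha> r(2) r'(2) by simp
      moreover have "\<gamma> \<in> set S" if "Inr (\<gamma>, n) \<in> set_tree \<xi>" for \<gamma> n
        using is_att_ruleD(5)[OF A0 A0_rule[OF r(1,2)] x(1) that] by (simp add: A0_def)
      ultimately show ?thesis
        unfolding r(7) r'(6) D_rhs_def by (auto intro!: tree.map_cong0 simp: D_attr_def split: sum.split)
    next
      case (Some n)
      then have "L = L'" using r(5) r'(4) by auto
      then have "j = j'" using \<alpha> r(4) r'(3) by (cases "\<alpha> \<in> set S") auto
      then show ?thesis using r(2,7) r'(2,6) \<open>L = L'\<close> by simp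
    qed
  qed
  then have "deterministic D" unfolding deterministic_def by blast
  moreover have "syn D \<inter> inh D = {}"
    using disjoint by (auto simp: D_def D_syn_def D_inh_def)
  moreover have "init D \<in> syn D"
    using A0 by (auto simp: is_att_def A0_def D_def D_syn_def)
  moreover have "\<forall>r\<in>rules D. is_att_rule D r" using rule by auto
  moreover have "finite (syn D)" "finite (inh D)" "finite (rules D)"
    "in_alph D = set (T_out X oT)" "out_alph D = set oA"
    by (simp_all add: D_def)
  ultimately show ?thesis
    using ranked by (simp add: is_datt_def is_att_def)
qed

lemma is_dattU: "is_dattU ((B, T), D)"
  using is_bu_relabeling_B is_td_relabeling_T is_datt_D
  by (simp add: is_dattU_def is_attU_def is_look_around_def is_datt_def) (simp add: B_def T_def D_def)

end

section \<open>Correctness of the construction\<close>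

lemma child_inject [simp]: "child v i = child v j \<longleftrightarrow> i = j"
  by (simp add: child_def)

definition plan_at :: "node \<Rightarrow> ((nat \<times> node) \<times> nat) list \<Rightarrow> plan" where
  "plan_at v W = map (\<lambda>e. (fst (fst e), snd e)) (filter (\<lambda>e. snd (fst e) = v) W)"

definition child_index :: "node \<Rightarrow> nat \<Rightarrow> node \<Rightarrow> nat option" where
  "child_index v k w = (if \<exists>i\<le>k. w = child v i then Some (THE i. w = child v i) else None)"

lemma child_index_eq_Some: "child_index v k w = Some i \<longleftrightarrow> i \<le> k \<and> w = child v i"
  unfolding child_index_def by auto

definition entries_at :: "node \<Rightarrow> nat \<Rightarrow> ((nat \<times> node) \<times> nat) list \<Rightarrow> entry list" where
  "entries_at v k W = concat (map (\<lambda>e. case child_index v k (snd (fst e)) of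
      None \<Rightarrow> [] | Some i \<Rightarrow> [((fst (fst e), i), snd e)]) W)"

lemma mem_entries_at: "((\<gamma>, i), j) \<in> set (entries_at v k W) \<longleftrightarrow> i \<le> k \<and> ((\<gamma>, child v i), j) \<in> set W"
proof -
  have "((\<gamma>, i), j) \<in> set (entries_at v k W) \<longleftrightarrow>
      (\<exists>w. ((\<gamma>, w), j) \<in> set W \<and> child_index v k w = Some i)"
    by (force simp: entries_at_def split: option.splits)
  then show ?thesis by (auto simp: child_index_eq_Some)
qed

text \<open>Agreement of neighbouring schedules: the plan of a node comes out the same from its own
  local schedule (index 0) and from that of its parent.\<close>

lemma restr_entries_at: "i \<le> k \<Longrightarrow> restr i (entries_at v k W) = plan_at (child v i) W"
proof (induction W)
  case (Cons e W)
  have i: "child_index v k (child v i) = Some i" using Cons.prems by (simp add: child_index_eq_Some)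
  show ?case
  proof (cases "child_index v k (snd (fst e))")
    case None
    then have "snd (fst e) \<noteq> child v i" using i by auto
    then show ?thesis using Cons None by (simp add: entries_at_def plan_at_def)
  next
    case (Some i')
    then have "snd (fst e) = child v i'" by (simp add: child_index_eq_Some)
    then show ?thesis using Cons Some by (simp add: entries_at_def plan_at_def)
  qed
qed (simp add: entries_at_def plan_at_def)

text \<open>Lifts a suffix of the plan of a node to a moment in the evaluation of the whole
  neighbourhood.\<close>

lemma suffix_of_restr: "restr i M = P @ L \<Longrightarrow> \<exists>P' M'. M = P' @ M' \<and> restr i M' = L"
proof (induction M arbitrary: P)
  case (Cons e M)
  show ?case
  proof (cases "snd (fst e) = i \<and> P = []")
    case True
    then show ?thesis using Cons.prems by (intro exI[of _ "[]"] exI[of _ "e # M"]) simp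
  next
    case False
    then obtain P1 where "restr i M = P1 @ L"
      using Cons.prems by (cases P) (auto split: if_splits)
    from Cons.IH[OF this] obtain P' M' where "M = P' @ M'" "restr i M' = L" by blast
    then show ?thesis by (intro exI[of _ "e # P'"] exI[of _ M']) simp
  qed
qed auto

context look_around_att
begin

section \<open>Runs of the new look-around compared with those of the given one\<close>

primrec feasible :: "nat tree \<Rightarrow> (nat \<times> plan) list" where
  "feasible (Node g ts) = step_set X ST RT g (map feasible ts)"

primrec annotate :: "nat tree \<Rightarrow> nat tree" where
  "annotate (Node g ts) = Node (enc (g, map feasible ts)) (map annotate ts)"

lemma feasible_mem: "feasible t \<in> set (feasibles X ST)"
  by (cases t) (simp add: step_set_feasible)

lemma bu_run_B: "bu_run B0 s p s1 \<Longrightarrow> bu_run B s (enc (p, feasible s1)) (annotate s1)"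
proof (induction rule: bu_run.induct)
  case (1 f ps p g ts ts')
  let ?Qs = "map feasible ts'"
  have "(f, map enc (zip ps ?Qs), enc (p, step_set X ST RT g ?Qs), enc (g, ?Qs)) \<in> bu_rules B"
    using 1(1-3) feasible_mem unfolding B_def
    by (auto simp: mem_B_rules B0_def intro!: exI[of _ ps] exI[of _ p] exI[of _ g] exI[of _ ?Qs])
  then show ?case
    using 1 by (auto intro!: bu_run.intros[where ps = "map enc (zip ps ?Qs)"])
qed

lemma bu_run_BD: "bu_run B s P u \<Longrightarrow>
    \<exists>p s1. P = enc (p, feasible s1) \<and> u = annotate s1 \<and> bu_run B0 s p s1"
proof (induction rule: bu_run.induct)
  case (1 f ps' p' n ts us)
  from 1(1) obtain ps p g Qs where r: "(f, ps, p, g) \<in> set rB" "length Qs = length ps"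
    "ps' = map enc (zip ps Qs)" "p' = enc (p, step_set X ST RT g Qs)" "n = enc (g, Qs)"
    by (auto simp: B_def mem_B_rules)
  have len: "length ps = length ts" "length Qs = length ts" using 1(2) r(2,3) by auto
  have "\<exists>s1. Qs ! i = feasible s1 \<and> us ! i = annotate s1 \<and> bu_run B0 (ts ! i) (ps ! i) s1"
    if "i < length ts" for i
    using 1(4) that len by (auto simp: r(3))
  then obtain c where c: "\<And>i. i < length ts \<Longrightarrow> Qs ! i = feasible (c i) \<and> us ! i = annotate (c i) \<and>
      bu_run B0 (ts ! i) (ps ! i) (c i)" by metis
  let ?s1 = "Node g (map c [0..<length ts])"
  have "Qs = map feasible (map c [0..<length ts])" "us = map annotate (map c [0..<length ts])"
    using c len 1(3) by (auto intro!: nth_equalityI)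
  moreover have "bu_run B0 (Node f ts) p ?s1"
    using c len r(1) by (auto intro!: bu_run.intros[where ps = ps] simp: B0_def)
  ultimately show ?case using r(4,5) by (intro exI[of _ p] exI[of _ ?s1]) simp
qed

definition input_symbol :: "nat \<Rightarrow> nat" where
  "input_symbol n = fst (dec n :: nat \<times> plan)"

lemma input_symbol_enc [simp]: "input_symbol (enc (h, L :: plan)) = h"
  by (simp add: input_symbol_def)

text \<open>Each rule of \<open>T\<close> combines a rule of \<open>T0\<close> with a schedule, so
  erasing the plans from the output leaves a run of the given relabeling.\<close>

lemma td_run_TD: "td_run T n u t \<Longrightarrow> u = annotate s1 \<Longrightarrow> n = enc (q, st :: plan option) \<Longrightarrow>
    td_run T0 q s1 (map_tree input_symbol t)"
proof (induction arbitrary: s1 q st rule: td_run.induct)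
  case (1 g' n h' qs' ts us)
  from 1(1) obtain g Qs q' st' h qs M cs where r: "g' = enc (g, Qs)" "n = enc (q', st' :: plan option)"
    "T_choice X a0 RT g Qs (q', st') = (h, qs, M) # cs" "td_rhs h' qs' = T_rhs (h, qs, M)"
    by (auto simp: T_def mem_T_rules)
  have "(h, qs, M) \<in> set (T_choice X a0 RT g Qs (q', st'))" using r(3) by simp
  then have c: "(Some g, (q', 0), td_rhs h qs) \<in> set RT" "fits X h qs Qs M"
    by (auto simp: mem_T_choice mem_choices)
  have q: "q' = q" using r(2) 1(6) by simp
  obtain ts1 where s1: "s1 = Node g ts1" "ts = map annotate ts1"
    using 1(5) r(1) by (cases s1) auto
  have h': "h' = enc (h, restr 0 M)"
    "qs' = map (\<lambda>z. enc (snd z, Some (restr (Suc (fst z)) M))) (numbered qs)"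
    using r(4) by (simp_all add: T_rhs_eq)
  have len: "length qs = length qs'" by (simp add: h'(2) numbered_def)
  have qs': "qs' ! i = enc (qs ! i, Some (restr (Suc i) M))" if "i < length qs" for i
    using that by (simp add: h'(2) numbered_def)
  have "td_run T0 (qs ! i) (ts1 ! i) (map_tree input_symbol (us ! i))" if "i < length qs" for i
    using 1(4) that len qs'[OF that] 1(2) s1(2) by auto
  then show ?case
    using c(1) len 1(2,3) by (auto simp: s1 q h' T0_def intro!: td_run.intros)
qed

text \<open>The guarantee given by the look-around: neighbouring plans are restrictions of a common
  schedule \<open>M\<close>. Only the plan of the node is stored in the label, while
  \<open>M\<close> is merely known to exist. The bound on the indices ensures that every entry
  belongs to an actual child or to the node.\<close>

inductive consistent :: "nat tree \<Rightarrow> plan \<Rightarrow> bool" where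
  "schedule X (Some h) M \<Longrightarrow> restr 0 M \<in> set (plans X) \<Longrightarrow>
    \<forall>e\<in>set M. snd (fst e) \<le> length ts \<Longrightarrow>
    \<forall>i<length ts. consistent (ts ! i) (restr (Suc i) M) \<Longrightarrow>
    consistent (Node (enc (h, restr 0 M)) ts) (restr 0 M)"

text \<open>The plan \<open>L\<close> may differ from \<open>L0\<close>, since with state
  \<open>None\<close> the first admissible choice is taken. A state \<open>Some L'\<close> admits
  only \<open>L'\<close> itself; this keeps the plans chosen below equal to those handed
  down.\<close>

lemma td_run_T:
  assumes "s1 \<in> trees (set bB)" "(q, L0) \<in> set (feasible s1)" "state_ok X a0 st L0"
    "(q, st) \<in> set (T_states X ST)"
  shows "\<exists>t L. td_run T (enc (q, st)) (annotate s1) t \<and> consistent t L \<and> state_ok X a0 st L"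
  using assms
proof (induction s1 arbitrary: q L0 st rule: tree.induct)
  case (Node g ts)
  let ?Qs = "map feasible ts"
  from Node.prems(2) obtain h0 qs0 M0 where "(h0, qs0, M0) \<in> set (choices X RT g q ?Qs)" "restr 0 M0 = L0"
    by (auto simp: step_set_def)
  then have "(h0, qs0, M0) \<in> set (T_choice X a0 RT g ?Qs (q, st))"
    using Node.prems(3) by (simp add: mem_T_choice)
  then obtain h qs M cs where T_choice: "T_choice X a0 RT g ?Qs (q, st) = (h, qs, M) # cs"
    by (cases "T_choice X a0 RT g ?Qs (q, st)") auto
  then have "(h, qs, M) \<in> set (T_choice X a0 RT g ?Qs (q, st))" by simp
  then have ok: "state_ok X a0 st (restr 0 M)" and M: "M \<in> set (entry_lists X (length ts))"
    and f: "fits X h qs ?Qs M"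
    by (auto simp: mem_T_choice mem_choices)
  have len: "length qs = length ts" using f by (simp add: fits_iff)
  have "\<exists>t. td_run T (enc (qs ! i, Some (restr (Suc i) M))) (annotate (ts ! i)) t \<and>
      consistent t (restr (Suc i) M)" if i: "i < length ts" for i
  proof -
    have m: "(qs ! i, restr (Suc i) M) \<in> set (feasible (ts ! i))"
      using f i len by (simp add: fits_iff)
    then have "(qs ! i, restr (Suc i) M) \<in> set (state_plans X ST)"
      using feasible_mem[of "ts ! i"] by (auto simp: feasibles_def set_lists_upto)
    then have "(qs ! i, Some (restr (Suc i) M)) \<in> set (T_states X ST)"
      by (simp add: mem_state_plans mem_T_states)
    moreover have "ts ! i \<in> trees (set bB)" using Node.prems(1) i by (simp add: Node_in_trees_iff)
    ultimately show ?thesis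
      using Node.IH[of "ts ! i" "qs ! i" "restr (Suc i) M" "Some (restr (Suc i) M)"] m i
      by (auto simp: state_ok_def)
  qed
  then obtain c where c: "\<And>i. i < length ts \<Longrightarrow>
      td_run T (enc (qs ! i, Some (restr (Suc i) M))) (annotate (ts ! i)) (c i) \<and>
      consistent (c i) (restr (Suc i) M)" by metis
  let ?t = "Node (enc (h, restr 0 M)) (map c [0..<length ts])"
  let ?qs = "map (\<lambda>z. enc (snd z, Some (restr (Suc (fst z)) M))) (numbered qs)"
  have "(Some (enc (g, ?Qs)), (enc (q, st), 0), td_rhs (enc (h, restr 0 M)) ?qs) \<in> rules T"
    using Node.prems(1,4) T_choice feasible_mem
    unfolding T_def att.simps
    by (intro mem_T_rules[THEN iffD2], rule_tac exI[of _ g], rule_tac exI[of _ ?Qs],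
        rule_tac exI[of _ q], rule_tac exI[of _ st])
      (auto simp: Node_in_trees_iff T_rhs_eq)
  then have "td_run T (enc (q, st)) (annotate (Node g ts)) ?t"
    using c len by (auto simp: numbered_def intro!: td_run.intros)
  moreover have "consistent ?t (restr 0 M)"
    using f c M by (intro consistent.intros) (auto simp: fits_iff mem_entry_lists)
  ultimately show ?case using ok by blast
qed

text \<open>Global counterpart of \<open>schedule\<close>, with addresses in the whole tree: the
  entry evaluated last comes first and refers only to entries behind it.\<close>

primrec evaluation :: "nat tree \<Rightarrow> ((nat \<times> node) \<times> nat) list \<Rightarrow> bool" where
  "evaluation s [] \<longleftrightarrow> True"
| "evaluation s (e # W) \<longleftrightarrow> evaluation s W \<and> (\<forall>e'\<in>set W. fst e' \<noteq> fst e) \<and>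
    (\<exists>v i x \<xi>. snd (fst e) = child v i \<and> snd e < length R \<and> R ! snd e = (x, (fst (fst e), i), \<xi>) \<and>
      label_at (marked s) v = Some x \<and>
      (\<forall>\<gamma> i'. Inr (\<gamma>, i') \<in> set_tree \<xi> \<longrightarrow> (\<gamma>, child v i') \<in> fst ` set W))"

lemma set_tree_instantiate:
  fixes \<xi> :: "('b + 'c \<times> nat) tree"
  shows "Inr z \<in> set_tree (instantiate v \<xi>) \<longleftrightarrow> (\<exists>\<gamma> i. Inr (\<gamma>, i) \<in> set_tree \<xi> \<and> z = (\<gamma>, child v i))"
proof -
  have "Inr z = map_sum id (\<lambda>(\<gamma>, i). (\<gamma>, child v i)) y \<longleftrightarrow>
      (\<exists>\<gamma> i. y = Inr (\<gamma>, i) \<and> z = (\<gamma>, child v i))" for y :: "'b + 'c \<times> nat"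
    by (cases y) auto
  then show ?thesis by (auto simp: instantiate_def tree.set_map image_iff)
qed

text \<open>A derivation is linearized by evaluating the references of a rule before its left-hand
  side. Allowing an arbitrary \<open>W\<close> lets entries made for one part of a right-hand side
  be reused for the next. The output \<open>u\<close> is absent from the conclusion: copies of an
  instance that were derived by different rules now share one.\<close>

lemma evaluation_extend:
  "gen A0 s Y u \<Longrightarrow> evaluation s W \<Longrightarrow>
    \<exists>Z. evaluation s (Z @ W) \<and> (\<forall>z. Inr z \<in> set_tree Y \<longrightarrow> z \<in> fst ` set (Z @ W))"
proof (induction arbitrary: W rule: gen.induct)
  case (gen_Inl ts us f)
  have "\<exists>Z. evaluation s (Z @ W) \<and> (\<forall>t\<in>set ts. \<forall>z. Inr z \<in> set_tree t \<longrightarrow> z \<in> fst ` set (Z @ W))"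
    using gen_Inl
  proof (induction ts us arbitrary: W rule: list_all2_induct)
    case Nil
    then show ?case by (intro exI[of _ "[]"]) simp
  next
    case (Cons t ts u us)
    then obtain Z where Z: "evaluation s (Z @ W)" "\<forall>z. Inr z \<in> set_tree t \<longrightarrow> z \<in> fst ` set (Z @ W)"
      by blast
    from Cons.IH[OF Z(1)] obtain Z' where "evaluation s (Z' @ Z @ W)"
      "\<forall>t\<in>set ts. \<forall>z. Inr z \<in> set_tree t \<longrightarrow> z \<in> fst ` set (Z' @ Z @ W)" by blast
    then show ?case using Z(2) by (intro exI[of _ "Z' @ Z"]) (auto simp: image_Un)
  qed
  then show ?case by auto
next
  case (gen_Inr v x \<gamma> i \<xi> u)
  from gen_Inr.IH[OF gen_Inr.prems] obtain Z where Z: "evaluation s (Z @ W)"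
    "\<forall>z. Inr z \<in> set_tree (instantiate v \<xi>) \<longrightarrow> z \<in> fst ` set (Z @ W)" by blast
  show ?case
  \<comment> \<open>An instance that occurs already keeps its earlier rule. In a circular derivation
    it may even have been evaluated within its own sub-derivation.\<close>
  proof (cases "(\<gamma>, child v i) \<in> fst ` set (Z @ W)")
    case True
    then show ?thesis using Z(1) by (intro exI[of _ Z]) auto
  next
    case False
    from gen_Inr.hyps(2) obtain j where j: "j < length R" "R ! j = (x, (\<gamma>, i), \<xi>)"
      by (auto simp: A0_def in_set_conv_nth)
    have "evaluation s (((\<gamma>, child v i), j) # Z @ W)"
      unfolding evaluation.simps fst_conv snd_conv
    proof (intro conjI exI)
      show "\<forall>\<gamma>' i'. Inr (\<gamma>', i') \<in> set_tree \<xi> \<longrightarrow> (\<gamma>', child v i') \<in> fst ` set (Z @ W)"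
        using Z(2) set_tree_instantiate by blast
      show "\<forall>e'\<in>set (Z @ W). fst e' \<noteq> (\<gamma>, child v i)" using False by (metis imageI)
    qed (use Z(1) j gen_Inr.hyps(1) in auto)
    then show ?thesis by (intro exI[of _ "((\<gamma>, child v i), j) # Z"]) auto
  qed
qed

lemma evaluation_mem: "evaluation s W \<Longrightarrow> ((\<gamma>, w), j) \<in> set W \<Longrightarrow> \<gamma> \<in> set S \<union> set I \<and> j < length R"
proof (induction W)
  case (Cons e W)
  show ?case
  proof (cases "e = ((\<gamma>, w), j)")
    case True
    then obtain i x \<xi> where "j < length R" "R ! j = (x, (\<gamma>, i), \<xi>)" using Cons.prems(1) by auto
    then show ?thesis using is_att_ruleD(1)[OF A0 A0_rule] by (fastforce simp: A0_def)
  qed (use Cons in auto)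
qed simp

text \<open>An address can be split into node and index in two ways, with index 0 or as a proper
  child. The kind of the attribute decides: its rules have index 0 if it is synthesized and a
  positive index if it is inherited.\<close>

lemma evaluation_Cons:
  assumes "evaluation s (((\<gamma>, child v i), j) # W)" "(i = 0) = (\<gamma> \<in> set S)"
  obtains x \<xi> where "j < length R" "R ! j = (x, (\<gamma>, i), \<xi>)" "label_at (marked s) v = Some x"
    "\<And>\<gamma>' i'. Inr (\<gamma>', i') \<in> set_tree \<xi> \<Longrightarrow> (\<gamma>', child v i') \<in> fst ` set W"
proof -
  from assms(1) obtain v' i' x \<xi> where r: "child v i = child v' i'" "j < length R"
    "R ! j = (x, (\<gamma>, i'), \<xi>)" "label_at (marked s) v' = Some x"
    "\<And>\<gamma>' i''. Inr (\<gamma>', i'') \<in> set_tree \<xi> \<Longrightarrow> (\<gamma>', child v' i'') \<in> fst ` set W" by auto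
  have "\<gamma> \<in> set S \<and> i' = 0 \<or> \<gamma> \<in> set I \<and> i' > 0"
    using is_att_ruleD(1)[OF A0 A0_rule[OF r(2,3)]] by (simp add: A0_def)
  then have "i' = i" "v' = v" using assms(2) r(1) disjoint by (auto simp: child_def split: if_splits)
  then show ?thesis using r that by blast
qed

text \<open>A rule at \<open>v\<close> refers only to \<open>v\<close> and its \<open>k\<close>
  children, so no dependency is lost when the evaluation is cut down to this neighbourhood, and the
  order is inherited. Entries whose rules live elsewhere are left free by
  \<open>justified\<close>.\<close>

lemma schedule_entries_at:
  assumes "label_at (marked s) v = Some (Some h)" "(h, k) \<in> set oT"
  shows "evaluation s W \<Longrightarrow> schedule X (Some h) (entries_at v k W)"
proof (induction W)
  case (Cons e W)
  obtain \<gamma> w j where e: "e = ((\<gamma>, w), j)" by (metis surj_pair)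
  have IH: "schedule X (Some h) (entries_at v k W)" using Cons by simp
  show ?case
  proof (cases "child_index v k w")
    case (Some i)
    then have i: "i \<le> k" "w = child v i" by (simp_all add: child_index_eq_Some)
    have new: "\<forall>e'\<in>set (entries_at v k W). fst e' \<noteq> (\<gamma>, i)"
    proof (intro ballI notI)
      fix e' assume e': "e' \<in> set (entries_at v k W)" "fst e' = (\<gamma>, i)"
      then have "((\<gamma>, i), snd e') \<in> set (entries_at v k W)" by (metis prod.collapse)
      then have "((\<gamma>, child v i), snd e') \<in> set W" by (simp add: mem_entries_at)
      moreover have "\<forall>e'\<in>set W. fst e' \<noteq> (\<gamma>, child v i)" using Cons.prems by (simp add: e i)
      ultimately show False by fastforce
    qed
    have "justified X (Some h) (entries_at v k W) ((\<gamma>, i), j)"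
    proof (cases "(i = 0) = (\<gamma> \<in> set S)")
      case True
      from evaluation_Cons[OF Cons.prems[unfolded e i(2)] True] obtain x \<xi> where
        r: "j < length R" "R ! j = (x, (\<gamma>, i), \<xi>)" "label_at (marked s) v = Some x"
        and d: "\<And>\<gamma>' i'. Inr (\<gamma>', i') \<in> set_tree \<xi> \<Longrightarrow> (\<gamma>', child v i') \<in> fst ` set W" by blast
      have x: "x = Some h" using r(3) assms(1) by simp
      have "\<exists>e'\<in>set (entries_at v k W). fst e' = (\<gamma>', i')" if l: "Inr (\<gamma>', i') \<in> set_tree \<xi>" for \<gamma>' i'
      proof -
        have "i' \<le> k" using is_att_ruleD(4)[OF A0 A0_rule[OF r(1,2)] x _ l] assms(2) by (simp add: A0_def)
        moreover obtain j' where "((\<gamma>', child v i'), j') \<in> set W" using d[OF l] by force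
        ultimately have "((\<gamma>', i'), j') \<in> set (entries_at v k W)" by (simp add: mem_entries_at)
        then show ?thesis by force
      qed
      then show ?thesis
        unfolding justified_def using r x
        by (auto simp: mem_leaf_refs mem_numbered intro!: bexI[of _ "(j, R ! j)"])
    qed (simp add: justified_def)
    then show ?thesis using IH new Some by (simp add: entries_at_def e)
  qed (use IH in \<open>simp add: entries_at_def e\<close>)
qed (simp add: entries_at_def)

lemma entries_at_mem:
  assumes "evaluation s W" "schedule X x (entries_at v k W)"
  shows "entries_at v k W \<in> set (entry_lists X k)" "plan_at v W \<in> set (plans X)"
proof -
  let ?M = "entries_at v k W"
  have mem: "\<gamma> \<in> set S \<union> set I \<and> i \<le> k \<and> j < length R" if "((\<gamma>, i), j) \<in> set ?M" for \<gamma> i j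
    using that evaluation_mem[OF assms(1)] by (auto simp: mem_entries_at)
  have card: "card (set S \<union> set I) \<le> length (S @ I)"
    using card_length[of "S @ I"] by simp
  have dist: "distinct (map fst ?M)" using schedule_distinct[OF assms(2)] .
  have "length ?M \<le> length (S @ I) * Suc k"
  proof (rule length_le_product[OF dist])
    show "fst ` set ?M \<subseteq> (set S \<union> set I) \<times> {..k}" using mem by fastforce
    show "card ((set S \<union> set I) \<times> {..k}) \<le> length (S @ I) * Suc k"
      using mult_le_mono1[OF card, of "Suc k"] by (simp add: card_cartesian_product)
  qed simp
  then show "?M \<in> set (entry_lists X k)" using mem by (auto simp: mem_entry_lists)
  have plan: "plan_at v W = restr 0 ?M" using restr_entries_at[of 0 k v W] by (simp add: child_def)
  have "length (restr 0 ?M) \<le> length (S @ I)"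
  proof (rule length_le_product[OF distinct_restr[OF dist] _ _ card])
    show "fst ` set (restr 0 ?M) \<subseteq> set S \<union> set I" using mem by (force simp: mem_restr)
  qed simp
  moreover have "\<alpha> \<in> set S \<union> set I \<and> j < length R" if "(\<alpha>, j) \<in> set (restr 0 ?M)" for \<alpha> j
    using mem that unfolding mem_restr by blast
  ultimately show "plan_at v W \<in> set (plans X)" unfolding plan mem_plans by fastforce
qed

text \<open>Completeness of the subset construction: the local schedules cut out of an actual
  evaluation witness the required choices at all nodes.\<close>

lemma feasible_plan_at:
  "td_run T0 q s1 t \<Longrightarrow> subtree (marked s) v = Some (map_tree Some t) \<Longrightarrow> evaluation s W \<Longrightarrow>
    (q, plan_at v W) \<in> set (feasible s1)"
proof (induction arbitrary: v rule: td_run.induct)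
  case (1 g q h qs ts us)
  let ?k = "length qs" let ?M = "entries_at v ?k W" let ?Qs = "map feasible ts"
  have r: "(Some g, (q, 0), td_rhs h qs) \<in> set RT" using 1(1) by (simp add: T0_def)
  have hk: "(h, ?k) \<in> set oT" using T0_rule[OF r] by auto
  have "label_at (marked s) v = Some (Some h)" using 1(5) by (auto simp: label_at_iff)
  then have sched: "schedule X (Some h) ?M" using schedule_entries_at[OF _ hk 1(6)] by blast
  have plan: "restr 0 ?M = plan_at v W" using restr_entries_at[of 0 ?k v W] by (simp add: child_def)
  have "(qs ! i, restr (Suc i) ?M) \<in> set (?Qs ! i)" if i: "i < ?k" for i
  proof -
    have "subtree (marked s) (v @ [Suc i]) = Some (map_tree Some (us ! i))"
      using subtree_snoc[of "marked s" v "Some h" "map (map_tree Some) us" "Suc i"] 1(3,5) i by simp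
    then have "(qs ! i, plan_at (v @ [Suc i]) W) \<in> set (feasible (ts ! i))"
      using 1(4,6) i by blast
    then show ?thesis using restr_entries_at[of "Suc i" ?k v W] i 1(2) by (simp add: child_def)
  qed
  then have "fits X h qs ?Qs ?M"
    using sched plan entries_at_mem(2)[OF 1(6) sched] 1(2) by (simp add: fits_iff)
  then have "(h, qs, ?M) \<in> set (choices X RT g q ?Qs)"
    using r entries_at_mem(1)[OF 1(6) sched] 1(2) by (simp add: mem_choices)
  moreover have "(q, plan_at v W) \<in> set (state_plans X ST)"
    using T0_rule_states(1)[OF r] entries_at_mem(2)[OF 1(6) sched] by (simp add: mem_state_plans)
  ultimately show ?case using plan by (force simp: step_set_def)
qed

lemma label_at_marked_Nil: "label_at (marked s) [] = Some None"
  by (simp add: marked_def)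

text \<open>Rules of the root marker have index 1 on both sides, so the plan of the node
  \<open>[1]\<close>, lifted to index 1, contains all their dependencies.\<close>

lemma state_ok_plan_at:
  assumes "evaluation s W" "(a0, [1]) \<in> fst ` set W"
  shows "state_ok X a0 None (plan_at [1] W)"
proof -
  let ?M = "\<lambda>W. map (\<lambda>e. ((fst e, 1), snd e)) (plan_at [1] W)"
  have M: "?M W = map (\<lambda>e. ((fst (fst e), 1), snd e)) (filter (\<lambda>e. snd (fst e) = [1]) W)" for W
    by (simp add: plan_at_def)
  have "schedule X None (?M W)"
    using assms(1) unfolding M
  proof (induction W)
    case (Cons e W)
    obtain \<gamma> w j where e: "e = ((\<gamma>, w), j)" by (metis surj_pair)
    let ?N = "map (\<lambda>e. ((fst (fst e), 1), snd e)) (filter (\<lambda>e. snd (fst e) = [1]) W)"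
    have IH: "schedule X None ?N" using Cons by simp
    show ?case
    proof (cases "w = [1]")
      case True
      have "justified X None ?N ((\<gamma>, 1), j)"
      proof (cases "\<gamma> \<in> set S")
        case False
        have w: "w = child [] 1" by (simp add: True child_def)
        from evaluation_Cons[OF Cons.prems[unfolded e w]] False obtain x \<xi> where
          r: "j < length R" "R ! j = (x, (\<gamma>, 1), \<xi>)" "label_at (marked s) [] = Some x"
          and d: "\<And>\<gamma>' i'. Inr (\<gamma>', i') \<in> set_tree \<xi> \<Longrightarrow> (\<gamma>', child [] i') \<in> fst ` set W"
          by (metis One_nat_def zero_neq_one)
        have x: "x = None" using r(3) by (simp add: label_at_marked_Nil)
        have dep: "\<exists>e'\<in>set ?N. fst e' = (\<gamma>', i')" if l: "Inr (\<gamma>', i') \<in> set_tree \<xi>" for \<gamma>' i'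
        proof -
          have i': "i' = 1" using is_att_ruleD(5)[OF A0 A0_rule[OF r(1,2)] x l] by simp
          obtain j' where "((\<gamma>', [1]), j') \<in> set W" using d[OF l] by (force simp: i' child_def)
          then show ?thesis by (force simp: i')
        qed
        have "\<forall>z\<in>set (leaf_refs \<xi>). \<exists>e'\<in>set ?N. fst e' = z"
        proof
          show "\<exists>e'\<in>set ?N. fst e' = z" if "z \<in> set (leaf_refs \<xi>)" for z
            using dep[of "fst z" "snd z"] that unfolding mem_leaf_refs prod.collapse .
        qed
        then show ?thesis
          unfolding justified_def using r x
          by (intro impI bexI[of _ "(j, R ! j)"]) (simp_all add: mem_numbered)
      qed (simp add: justified_def)
      moreover have "\<forall>e'\<in>set ?N. fst e' \<noteq> (\<gamma>, 1)" using Cons.prems by (auto simp: e True)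
      ultimately show ?thesis using IH by (simp add: e True)
    qed (use IH in \<open>simp add: e\<close>)
  qed simp
  moreover have "\<exists>e\<in>set (plan_at [1] W). fst e = a0" using assms(2) by (force simp: plan_at_def)
  ultimately show ?thesis by (simp add: state_ok_def)
qed

lemma set_tree_D_rhs: "Inr (n, i) \<in> set_tree (D_rhs X L \<xi>) \<Longrightarrow>
    \<exists>\<gamma>. Inr (\<gamma>, i) \<in> set_tree \<xi> \<and> n = D_attr X \<gamma> (lookup L \<gamma>)"
  by (force simp: D_rhs_def tree.set_map split: sum.splits)

lemma is_att_D: "is_att D"
  using is_datt_D by (simp add: is_datt_def)

section \<open>Termination of the new transducer on consistent inputs\<close>

lemma justifiedD:
  assumes "justified X x M ((\<alpha>, i), j)" "(i = 0) = (\<alpha> \<in> set S)"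
  obtains \<xi> where "j < length R" "R ! j = (x, (\<alpha>, i), \<xi>)"
    "\<And>\<gamma> i'. Inr (\<gamma>, i') \<in> set_tree \<xi> \<Longrightarrow> \<exists>j'. ((\<gamma>, i'), j') \<in> set M"
proof -
  from assms obtain r where r: "r \<in> set (numbered R)" "fst r = j" "fst (snd r) = x"
    "fst (snd (snd r)) = (\<alpha>, i)" "\<forall>z\<in>set (leaf_refs (snd (snd (snd r)))). \<exists>e'\<in>set M. fst e' = z"
    by (auto simp: justified_def)
  obtain \<xi> where r': "r = (j, x, (\<alpha>, i), \<xi>)" using r(2-4) by (metis prod.collapse)
  have "\<exists>j'. ((\<gamma>, i'), j') \<in> set M" if "Inr (\<gamma>, i') \<in> set_tree \<xi>" for \<gamma> i'
  proof -
    have "(\<gamma>, i') \<in> set (leaf_refs (snd (snd (snd r))))" using that by (simp add: r' mem_leaf_refs)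
    with r(5) obtain e' where "e' \<in> set M" "fst e' = (\<gamma>, i')" by blast
    then show ?thesis by (metis prod.collapse)
  qed
  moreover have "j < length R" "R ! j = (x, (\<alpha>, i), \<xi>)" using r(1) by (simp_all add: r' mem_numbered)
  ultimately show ?thesis using that by blast
qed

lemma D_attr_syn: "\<alpha> \<in> set S \<Longrightarrow> D_attr X \<alpha> j = D_attr X \<alpha> j'"
  by (simp add: D_attr_def)

text \<open>Induction on the tree, with an inner induction on the suffixes of the local schedule,
  that is, on the moments of evaluation. The entry evaluated last in a suffix is of one of three
  kinds. If its rule lives at this node, its references are defined by the inner hypothesis. If it
  is inherited at this node, it is covered by the assumption. If it is synthesized at a child, the
  outer hypothesis applies to the plan of the child from this entry on, whose inherited entries were
  evaluated before. A version for the whole of \<open>L\<close> only would ask the context for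
  inherited attributes that may depend on the attribute in question.\<close>

lemma consistent_defd:
  "consistent t L \<Longrightarrow> subtree (marked s) v = Some (map_tree Some t) \<Longrightarrow> L = P @ L' \<Longrightarrow>
    (\<And>b j. (b, j) \<in> set L' \<Longrightarrow> b \<notin> set S \<Longrightarrow> defd D s (D_attr X b j) v) \<Longrightarrow>
    (\<alpha>, j) \<in> set L' \<Longrightarrow> defd D s (D_attr X \<alpha> j) v"
proof (induction arbitrary: v P L' \<alpha> j rule: consistent.induct)
  case (1 h M ts)
  let ?L = "restr 0 M"
  have label: "label_at (marked s) v = Some (Some (enc (h, ?L)))"
    using 1(5) by (auto simp: label_at_iff)
  have distM: "distinct (map fst M)" using schedule_distinct[OF 1(1)] .
  have main: "\<And>\<alpha> i j. ((\<alpha>, i), j) \<in> set M' \<Longrightarrow> defd D s (D_attr X \<alpha> j) (child v i)"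
    if "M = P' @ M'" "\<And>b j. (b, j) \<in> set (restr 0 M') \<Longrightarrow> b \<notin> set S \<Longrightarrow> defd D s (D_attr X b j) v"
    for P' M'
    using that
  proof (induction M' arbitrary: P')
    case (Cons e M')
    have IH: "defd D s (D_attr X \<alpha> j) (child v i)" if "((\<alpha>, i), j) \<in> set M'" for \<alpha> i j
      using Cons.IH[where P' = "P' @ [e]"] Cons.prems that by auto
    have sched: "schedule X (Some h) (e # M')" using 1(1) Cons.prems(2) schedule_append by blast
    have "defd D s (D_attr X \<alpha> j) (child v i)" if e: "e = ((\<alpha>, i), j)" for \<alpha> i j
    proof (cases "(i = 0) = (\<alpha> \<in> set S)")
      case True
      from sched have "justified X (Some h) M' ((\<alpha>, i), j)" by (simp add: e)
      from justifiedD[OF this True] obtain \<xi> where r: "j < length R" "R ! j = (Some h, (\<alpha>, i), \<xi>)"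
        and dep: "\<And>\<gamma> i'. Inr (\<gamma>, i') \<in> set_tree \<xi> \<Longrightarrow> \<exists>j'. ((\<gamma>, i'), j') \<in> set M'" by blast
      \<comment> \<open>A synthesized left-hand side belongs to the node and occurs just once in its
        plan, so the rule in the schedule is the one selected by \<open>D_rule\<close>.\<close>
      have "lookup ?L \<alpha> = j" if "\<alpha> \<in> set S"
        using lookup_eq[OF distinct_restr[OF distM, of 0], of \<alpha> j] that True Cons.prems(2)
        by (auto simp: mem_restr e)
      then have rule: "(Some (enc (h, ?L)), (D_attr X \<alpha> j, i), D_rhs X ?L \<xi>) \<in> rules D"
        unfolding D_def using r 1(2) by (auto simp: mem_D_rules intro!: exI[of _ j])
      show ?thesis
      proof (rule defd_rule[OF is_att_D label rule])
        fix n i' assume "Inr (n, i') \<in> set_tree (D_rhs X ?L \<xi>)"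
        then obtain \<gamma> where \<gamma>: "Inr (\<gamma>, i') \<in> set_tree \<xi>" "n = D_attr X \<gamma> (lookup ?L \<gamma>)"
          using set_tree_D_rhs by blast
        from dep[OF \<gamma>(1)] obtain j' where j': "((\<gamma>, i'), j') \<in> set M'" by blast
        \<comment> \<open>The name on the right-hand side is formed with the number from the plan
          and has to match the entry in the schedule. Names of synthesized attributes ignore the
          number; inherited references are at the node itself, so their entries are in the
          plan.\<close>
        have "n = D_attr X \<gamma> j'"
        proof (cases "\<gamma> \<in> set S")
          case False
          then have "i' = 0"
            using is_att_ruleD(3)[OF A0 A0_rule[OF r] \<gamma>(1)] by (simp add: A0_def)
          then have "(\<gamma>, j') \<in> set ?L" using j' Cons.prems(2) by (simp add: mem_restr)
          then show ?thesis using lookup_eq[OF distinct_restr[OF distM]] \<gamma>(2) by simp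
        qed (use \<gamma>(2) D_attr_syn in simp)
        then show "defd D s n (child v i')" using IH[OF j'] by simp
      qed
    next
      case False
      show ?thesis
      proof (cases "i = 0")
        case True
        then show ?thesis using False Cons.prems(3)[of \<alpha> j] by (simp add: e child_def)
      next
        case i: False
        then have \<alpha>: "\<alpha> \<in> set S" using False by simp
        have le: "i \<le> length ts" using 1(3) Cons.prems(2) by (auto simp: e)
        obtain m where m: "i = Suc m" using i by (cases i) auto
        have "subtree (marked s) (child v i) = Some (map_tree Some (ts ! m))"
          using subtree_snoc[of "marked s" v "Some (enc (h, ?L))" "map (map_tree Some) ts" i] 1(5) le m
          by (simp add: child_def)
        \<comment> \<open>This exhibits \<open>restr i (e # M')\<close> as a suffix of the plan of
          the child. Since \<open>e\<close> is synthesized, all inherited entries of the suffix come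
          from \<open>M'\<close>.\<close>
        moreover have "restr i M = restr i P' @ restr i (e # M')"
          using Cons.prems(2) by simp
        moreover have "defd D s (D_attr X b j') (child v i)"
          if "(b, j') \<in> set (restr i (e # M'))" "b \<notin> set S" for b j'
          using that IH \<alpha> by (auto simp: e mem_restr)
        moreover have "(\<alpha>, j) \<in> set (restr i (e # M'))" by (simp add: e)
        ultimately show ?thesis using 1(4) le m
          by (metis Suc_le_lessD)
      qed
    qed
    then show ?case using IH Cons.prems(1) by (metis set_ConsD)
  qed simp
  from suffix_of_restr[OF 1(6)] obtain P' M' where M': "M = P' @ M'" "restr 0 M' = L'" by blast
  from main[OF M'(1)] 1(7) M'(2) have "defd D s (D_attr X \<alpha> j) (child v 0)"
    using 1(8) mem_restr[of \<alpha> j 0 M'] by blast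
  then show ?case by (simp add: child_def)
qed

text \<open>The assumption on inherited attributes in \<open>consistent_defd\<close> is discharged
  at the root: there they are supplied by the rules of the root marker, in the order of the
  plan.\<close>

lemma root_defd:
  assumes "consistent t L" "schedule X None (map (\<lambda>e. ((fst e, 1), snd e)) L)" "(\<alpha>, j) \<in> set L"
  shows "defd D t (D_attr X \<alpha> j) [1]"
proof -
  have sub: "subtree (marked t) [1] = Some (map_tree Some t)" using subtree_marked[of t "[]"] by simp
  have "\<And>\<alpha> j. (\<alpha>, j) \<in> set L' \<Longrightarrow> defd D t (D_attr X \<alpha> j) [1]" if "L = P @ L'" for P L'
    using that
  proof (induction L' arbitrary: P)
    case (Cons e L')
    have IH: "defd D t (D_attr X \<alpha> j) [1]" if "(\<alpha>, j) \<in> set L'" for \<alpha> j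
      using Cons.IH[where P = "P @ [e]"] Cons.prems that by auto
    have "defd D t (D_attr X \<alpha> j) [1]" if e: "e = (\<alpha>, j)" for \<alpha> j
    proof (cases "\<alpha> \<in> set S")
      case True
      have "defd D t (D_attr X b j') [1]" if "(b, j') \<in> set (e # L')" "b \<notin> set S" for b j'
        using that True IH by (auto simp: e)
      from consistent_defd[OF assms(1) sub Cons.prems(2) this] show ?thesis by (simp add: e)
    next
      case False
      let ?f = "\<lambda>e. ((fst e, 1 :: nat), snd e) :: entry"
      have "schedule X None (map ?f (e # L'))"
        using assms(2) Cons.prems(2) schedule_append[of X None "map ?f P" "map ?f (e # L')"] by simp
      then have just: "justified X None (map ?f L') ((\<alpha>, 1), j)" by (simp add: e)
      have "(1 = (0 :: nat)) = (\<alpha> \<in> set S)" using False by simp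
      from justifiedD[OF just this] obtain \<xi> where r: "j < length R" "R ! j = (None, (\<alpha>, 1), \<xi>)"
        and dep: "\<And>\<gamma> i'. Inr (\<gamma>, i') \<in> set_tree \<xi> \<Longrightarrow> \<exists>j'. ((\<gamma>, i'), j') \<in> set (map ?f L')"
        by blast
      \<comment> \<open>Rules of the root marker do not depend on a plan, so any plan exhibits them;
        the empty one is always available.\<close>
      have "[] \<in> set (plans X)" by (simp add: mem_plans)
      then have rule: "(None, (D_attr X \<alpha> j, 1), D_rhs X [] \<xi>) \<in> rules D"
        unfolding D_def using r False by (auto simp: mem_D_rules intro!: exI[of _ j])
      have "defd D t (D_attr X \<alpha> j) (child [] 1)"
      proof (rule defd_rule[OF is_att_D label_at_marked_Nil rule])
        fix n i' assume "Inr (n, i') \<in> set_tree (D_rhs X [] \<xi>)"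
        then obtain \<gamma> where \<gamma>: "Inr (\<gamma>, i') \<in> set_tree \<xi>" "n = D_attr X \<gamma> (lookup [] \<gamma>)"
          using set_tree_D_rhs by blast
        have i': "i' = 1" "\<gamma> \<in> set S"
          using is_att_ruleD(5)[OF A0 A0_rule[OF r] refl \<gamma>(1)] by (simp_all add: A0_def)
        from dep[OF \<gamma>(1)] obtain j' where "(\<gamma>, j') \<in> set L'" by auto
        from IH[OF this] show "defd D t n (child [] i')"
          using \<gamma>(2) D_attr_syn[OF i'(2)] i'(1) by (metis append_Nil child_def zero_neq_one)
      qed
      then show ?thesis by (simp add: child_def)
    qed
    then show ?case using IH Cons.prems(1) by (metis set_ConsD)
  qed simp
  from this[of "[]" L] show ?thesis using assms(3) by simp
qed

section \<open>Comparison of the translations\<close>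

definition attribute_name :: "nat \<times> node \<Rightarrow> nat \<times> node" where
  "attribute_name z = (fst (dec (fst z) :: nat \<times> nat), snd z)"

text \<open>Forgetting the numbers in attribute names and the plans in input symbols maps each rule
  of \<open>D\<close> to a rule of \<open>A0\<close>. Hence soundness holds whatever plans the input
  carries.\<close>

lemma gen_D:
  "gen D t Y u \<Longrightarrow> gen A0 (map_tree input_symbol t) (map_tree (map_sum id attribute_name) Y) u"
proof (induction rule: gen.induct)
  case (gen_Inl ts us f)
  then show ?case by (auto simp: list_all2_conv_all_nth intro!: gen.gen_Inl)
next
  case (gen_Inr v y n i \<zeta> u)
  from gen_Inr.hyps(2) obtain j x \<alpha> \<xi> L where r: "j < length R" "R ! j = (x, (\<alpha>, i), \<xi>)"
    "y = map_option (\<lambda>h. enc (h, L :: plan)) x" "n = D_attr X \<alpha> j" "\<zeta> = D_rhs X L \<xi>"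
    unfolding D_def att.simps mem_D_rules by blast
  have "label_at (marked (map_tree input_symbol t)) v = Some x"
    using gen_Inr.hyps(1) by (cases x) (simp_all add: label_at_marked_map r(3))
  moreover have "map_tree (map_sum id attribute_name) (instantiate v \<zeta>) = instantiate v \<xi>"
    unfolding r(5) D_rhs_def instantiate_def tree.map_comp
    by (rule tree.map_cong0) (auto simp: attribute_name_def D_attr_def split: sum.split)
  ultimately have "gen A0 (map_tree input_symbol t) (Node (Inr (\<alpha>, child v i)) []) u"
    using gen_Inr.IH gen.gen_Inr[OF _ A0_rule[OF r(1,2)]] by metis
  then show ?case by (simp add: attribute_name_def r(4) D_attr_def)
qed

lemma translation_sound:
  "attU_translation ((B, T), D) \<subseteq> attU_translation ((B0, T0), A0)"
proof safe
  fix s t assume "(s, t) \<in> attU_translation ((B, T), D)"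
  then obtain u s' P where u: "P \<in> final B" "bu_run B s P u" "(u, s') \<in> att_translation T"
    "(s', t) \<in> att_translation D"
    by (auto simp: attU_translation_def look_around_translation_def bu_translation_def)
  from bu_run_BD[OF u(2)] obtain p s1 where p: "P = enc (p, feasible s1)" "u = annotate s1"
    "bu_run B0 s p s1" by blast
  have "td_run T (init T) u s'" using u(3) td_translation_iff[OF is_td_relabeling_T] by blast
  then have run: "td_run T0 q0 s1 (map_tree input_symbol s')"
    using td_run_TD[OF _ p(2), of "init T" s' q0 None] by (simp add: T_def)
  then have "(s1, map_tree input_symbol s') \<in> att_translation T0"
    using td_run_in[OF T0 run] td_translation_iff[OF T0] by (simp add: T0_def)
  moreover have "(map_tree input_symbol s', t) \<in> att_translation A0"
  proof -
    have "gen D s' (Node (Inr (init D, [1])) []) t" using u(4) att_translation_iff[OF is_att_D] by blast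
    from gen_D[OF this] have "gen A0 (map_tree input_symbol s') (Node (Inr (init A0, [1])) []) t"
      by (simp add: attribute_name_def D_def A0_def)
    moreover have "map_tree input_symbol s' \<in> trees (in_alph A0)"
      using td_run_out[OF T0 run] by (simp add: T0_def A0_def)
    ultimately show ?thesis using att_translation_iff[OF A0] by blast
  qed
  moreover have "p \<in> final B0" using u(1) by (simp add: p(1) B_def mem_B_states B0_def)
  ultimately show "(s, t) \<in> attU_translation ((B0, T0), A0)"
    using p(3) by (auto simp: attU_translation_def look_around_translation_def bu_translation_def)
qed

text \<open>The plans selected by \<open>T\<close> need not be those of the given derivation, so the
  output \<open>t'\<close> may a priori differ from \<open>t\<close>.\<close>

lemma translation_complete:
  assumes "(s, t) \<in> attU_translation ((B0, T0), A0)"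
  shows "\<exists>t'. (s, t') \<in> attU_translation ((B, T), D)"
proof -
  from assms obtain p s1 s' where p: "p \<in> final B0" "bu_run B0 s p s1" "(s1, s') \<in> att_translation T0"
    "(s', t) \<in> att_translation A0"
    by (auto simp: attU_translation_def look_around_translation_def bu_translation_def)
  have s1: "s1 \<in> trees (set bB)" and run: "td_run T0 q0 s1 s'"
    using p(3) td_translation_iff[OF T0] by (auto simp: T0_def)
  have "gen A0 s' (Node (Inr (a0, [1])) []) t"
    using p(4) att_translation_iff[OF A0] by (simp add: A0_def)
  from evaluation_extend[OF this, of "[]"] obtain W where W: "evaluation s' W" "(a0, [1]) \<in> fst ` set W"
    by auto
  have "subtree (marked s') [1] = Some (map_tree Some s')" using subtree_marked[of s' "[]"] by simp
  from feasible_plan_at[OF run this W(1)] have "(q0, plan_at [1] W) \<in> set (feasible s1)" .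
  moreover have "(q0, None) \<in> set (T_states X ST)"
    using T0 by (auto simp: mem_T_states is_td_relabeling_def is_datt_def is_att_def T0_def)
  ultimately obtain s'' L where s'': "td_run T (enc (q0, None :: plan option)) (annotate s1) s''"
    "consistent s'' L" "state_ok X a0 None L"
    using td_run_T[OF s1 _ state_ok_plan_at[OF W]] by blast
  from s''(3) obtain j where j: "(a0, j) \<in> set L"
    "schedule X None (map (\<lambda>e. ((fst e, 1), snd e)) L)"
    by (auto simp: state_ok_def)
  have "a0 \<in> set S" using A0 by (simp add: is_att_def A0_def)
  then have "D_attr X a0 j = init D" by (simp add: D_attr_def D_def)
  then obtain t' where "gen D s'' (Node (Inr (init D, [1])) []) t'"
    using root_defd[OF s''(2) j(2,1)] by (auto simp: defd_def)
  moreover have "s'' \<in> trees (in_alph D)"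
    using td_run_out[OF is_td_relabeling_T s''(1)] by (simp add: T_def D_def)
  ultimately have "(s'', t') \<in> att_translation D" using att_translation_iff[OF is_att_D] by blast
  moreover have B: "bu_run B s (enc (p, feasible s1)) (annotate s1)" using bu_run_B[OF p(2)] .
  moreover have "enc (p, feasible s1) \<in> final B"
    using p(1) by (simp add: B_def B0_def mem_B_states feasible_mem)
  moreover have "(annotate s1, s'') \<in> att_translation T"
    using td_translation_iff[OF is_td_relabeling_T] td_run_in[OF is_td_relabeling_T s''(1)] s''(1)
    by (simp add: T_def)
  ultimately show ?thesis
    by (auto simp: attU_translation_def look_around_translation_def bu_translation_def)
qed

lemma translation_eq:
  assumes "single_valued (attU_translation ((B0, T0), A0))"
  shows "attU_translation ((B, T), D) = attU_translation ((B0, T0), A0)"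
  using translation_sound translation_complete assms
  by (fastforce dest: single_valuedD)

end

section \<open>Computability of the construction\<close>

text \<open>The default 0 keeps the program total: on numbers that code no transducer, missing
  components are read as 0.\<close>

definition item :: "nat \<Rightarrow> nat list \<Rightarrow> nat" where
  "item k l = (case drop k l of [] \<Rightarrow> 0 | x # _ \<Rightarrow> x)"

lemma computable_item [computable_intros]:
  assumes "computable l"
  shows "computable (\<lambda>x. item k (l x))"
proof -
  have "computable (\<lambda>x. case rec_nat (l x) (\<lambda>_ r. case r of [] \<Rightarrow> [] | y # ys \<Rightarrow> ys) k of [] \<Rightarrow> 0 | x # _ \<Rightarrow> x)"
    by (intro computable_intros assms)
  moreover have "rec_nat l (\<lambda>_ r. case r of [] \<Rightarrow> [] | y # ys \<Rightarrow> ys) k = drop k l" for l :: "nat list"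
    by (induction k) (auto simp: drop_Suc tl_drop split: list.split simp flip: tl_def)
  ultimately show ?thesis by (simp add: item_def)
qed

lemma computable_product [computable_intros]:
  fixes f :: "'a::coded \<Rightarrow> 'c::coded_onto list" and g :: "'a \<Rightarrow> 'd::coded_onto list"
  assumes "computable f" "computable g"
  shows "computable (\<lambda>x. List.product (f x) (g x))"
  unfolding product_concat_map
  by (intro computable_intros assms computable_comp[OF assms(2)])

lemma computable_lists_upto [computable_intros]:
  fixes f :: "'a::coded \<Rightarrow> 'c::coded_onto list"
  assumes "computable n" "computable f"
  shows "computable (\<lambda>x. lists_upto (n x) (f x))"
proof -
  have "computable (\<lambda>x. rec_nat [[]] (\<lambda>_ r. [] # concat (map (\<lambda>y. map (Cons y) r) (f x))) (n x))"
    by (intro computable_intros assms computable_comp[OF assms(2)])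
  moreover have "rec_nat [[]] (\<lambda>_ r. [] # concat (map (\<lambda>y. map (Cons y) r) xs)) n = lists_upto n xs"
    for n and xs :: "'c list"
    by (induction n) simp_all
  ultimately show ?thesis by simp
qed

lemma computable_tuples [computable_intros]:
  fixes f :: "'a::coded \<Rightarrow> 'c::coded_onto list"
  assumes "computable n" "computable f"
  shows "computable (\<lambda>x. tuples (n x) (f x))"
  unfolding tuples_def by (intro computable_intros assms computable_comp[OF assms(1)])

lemma computable_numbered [computable_intros]:
  fixes f :: "'a::coded \<Rightarrow> 'c::coded_onto list"
  assumes "computable f"
  shows "computable (\<lambda>x. numbered (f x))"
  unfolding numbered_def by (intro computable_intros assms)

lemma computable_leaf_refs [computable_intros]:
  fixes f :: "'a::coded \<Rightarrow> ('c::coded_onto + 'd::coded_onto) tree"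
  assumes "computable f"
  shows "computable (\<lambda>x. leaf_refs (f x))"
  unfolding leaf_refs_def by (intro computable_intros assms)

lemma computable_root_symbol [computable_intros]:
  fixes f :: "'a::coded \<Rightarrow> (nat + 'd::coded_onto) tree"
  assumes "computable f"
  shows "computable (\<lambda>x. root_symbol (f x))"
  unfolding root_symbol_def by (intro computable_intros assms)

lemma computable_attributes [computable_intros]:
  assumes "computable X"
  shows "computable (\<lambda>x. attributes (X x))"
  unfolding attributes_def by (intro computable_intros assms)

text \<open>Under a binder the parameters are applied to a component of the extended context;
  \<open>assms[THEN computable_comp]\<close> covers these occurrences.\<close>

lemma computable_justified [computable_intros]:
  assumes "computable X" "computable x" "computable M" "computable e"
  shows "computable (\<lambda>z. justified (X z) (x z) (M z) (e z))"
  unfolding justified_def by (intro computable_intros assms assms[THEN computable_comp])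

lemma computable_schedule [computable_intros]:
  assumes "computable X" "computable x" "computable M"
  shows "computable (\<lambda>z. schedule (X z) (x z) (M z))"
proof -
  \<comment> \<open>The recursion of \<open>schedule\<close> inspects the remaining list, so the
    fold rebuilds this list alongside the truth value.\<close>
  let ?f = "\<lambda>X x (e :: entry) r. (e # fst r, snd r \<and> (\<forall>e'\<in>set (fst r). fst e' \<noteq> fst e) \<and> justified X x (fst r) e)"
  have "computable (\<lambda>z. snd (foldr (?f (X z) (x z)) (M z) ([], True)))"
    by (intro computable_intros assms assms[THEN computable_comp])
  moreover have "foldr (?f X x) M ([], True) = (M, schedule X x M)" for X x M
    by (induction M) simp_all
  ultimately show ?thesis by simp
qed

lemma computable_restr [computable_intros]:
  assumes "computable i" "computable M"
  shows "computable (\<lambda>z. restr (i z) (M z))"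
  unfolding restr_def by (intro computable_intros assms assms[THEN computable_comp])

lemma computable_plans [computable_intros]:
  assumes "computable X"
  shows "computable (\<lambda>z. plans (X z))"
  unfolding plans_def by (intro computable_intros assms)

lemma computable_entry_lists [computable_intros]:
  assumes "computable X" "computable k"
  shows "computable (\<lambda>z. entry_lists (X z) (k z))"
  unfolding entry_lists_def by (intro computable_intros assms)

lemma computable_fits [computable_intros]:
  assumes "computable X" "computable h" "computable qs" "computable Qs" "computable M"
  shows "computable (\<lambda>z. fits (X z) (h z) (qs z) (Qs z) (M z))"
  unfolding fits_def by (intro computable_intros assms assms[THEN computable_comp])

lemma computable_choices [computable_intros]:
  assumes "computable X" "computable RT" "computable g" "computable q" "computable Qs"
  shows "computable (\<lambda>z. choices (X z) (RT z) (g z) (q z) (Qs z))"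
  unfolding choices_def by (intro computable_intros assms assms[THEN computable_comp])

lemma computable_state_plans [computable_intros]:
  assumes "computable X" "computable ST"
  shows "computable (\<lambda>z. state_plans (X z) (ST z))"
  unfolding state_plans_def by (intro computable_intros assms)

lemma computable_step_set [computable_intros]:
  assumes "computable X" "computable ST" "computable RT" "computable g" "computable Qs"
  shows "computable (\<lambda>z. step_set (X z) (ST z) (RT z) (g z) (Qs z))"
  unfolding step_set_def by (intro computable_intros assms assms[THEN computable_comp])

lemma computable_feasibles [computable_intros]:
  assumes "computable X" "computable ST"
  shows "computable (\<lambda>z. feasibles (X z) (ST z))"
  unfolding feasibles_def by (intro computable_intros assms)

lemma computable_B_states [computable_intros]:
  assumes "computable X" "computable ST" "computable ps"
  shows "computable (\<lambda>z. B_states (X z) (ST z) (ps z))"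
  unfolding B_states_def by (intro computable_intros assms)

lemma computable_B_out [computable_intros]:
  assumes "computable X" "computable ST" "computable b"
  shows "computable (\<lambda>z. B_out (X z) (ST z) (b z))"
  unfolding B_out_def by (intro computable_intros assms assms[THEN computable_comp])

lemma computable_B_rules [computable_intros]:
  assumes "computable X" "computable ST" "computable RT" "computable rs"
  shows "computable (\<lambda>z. B_rules (X z) (ST z) (RT z) (rs z))"
  unfolding B_rules_def by (intro computable_intros assms assms[THEN computable_comp])

lemma computable_state_ok [computable_intros]:
  assumes "computable X" "computable a0" "computable st" "computable L"
  shows "computable (\<lambda>z. state_ok (X z) (a0 z) (st z) (L z))"
  unfolding state_ok_def by (intro computable_intros assms assms[THEN computable_comp])

lemma computable_T_states [computable_intros]:
  assumes "computable X" "computable ST"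
  shows "computable (\<lambda>z. T_states (X z) (ST z))"
  unfolding T_states_def by (intro computable_intros assms)

lemma computable_T_out [computable_intros]:
  assumes "computable X" "computable b"
  shows "computable (\<lambda>z. T_out (X z) (b z))"
  unfolding T_out_def by (intro computable_intros assms)

lemma computable_T_rhs [computable_intros]:
  assumes "computable c"
  shows "computable (\<lambda>z. T_rhs (c z))"
  unfolding T_rhs_def by (intro computable_intros assms assms[THEN computable_comp])

lemma computable_T_choice [computable_intros]:
  assumes "computable X" "computable a0" "computable RT" "computable g" "computable Qs" "computable y"
  shows "computable (\<lambda>z. T_choice (X z) (a0 z) (RT z) (g z) (Qs z) (y z))"
  unfolding T_choice_def by (intro computable_intros assms assms[THEN computable_comp])

lemma computable_T_rule [computable_intros]:
  assumes "computable X" "computable a0" "computable RT" "computable g" "computable Qs" "computable y"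
  shows "computable (\<lambda>z. T_rule (X z) (a0 z) (RT z) (g z) (Qs z) (y z))"
  unfolding T_rule_def by (intro computable_intros assms assms[THEN computable_comp])

lemma computable_T_rules [computable_intros]:
  assumes "computable X" "computable a0" "computable ST" "computable RT" "computable b"
  shows "computable (\<lambda>z. T_rules (X z) (a0 z) (ST z) (RT z) (b z))"
  unfolding T_rules_def by (intro computable_intros assms assms[THEN computable_comp])

lemma computable_D_syn [computable_intros]:
  assumes "computable X"
  shows "computable (\<lambda>z. D_syn (X z))"
  unfolding D_syn_def by (intro computable_intros assms)

lemma computable_D_inh [computable_intros]:
  assumes "computable X"
  shows "computable (\<lambda>z. D_inh (X z))"
  unfolding D_inh_def by (intro computable_intros assms)

lemma computable_lookup [computable_intros]:
  assumes "computable L" "computable a"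
  shows "computable (\<lambda>z. lookup (L z) (a z))"
  unfolding lookup_def by (intro computable_intros assms assms[THEN computable_comp])

lemma computable_D_attr [computable_intros]:
  assumes "computable X" "computable a" "computable j"
  shows "computable (\<lambda>z. D_attr (X z) (a z) (j z))"
  unfolding D_attr_def by (intro computable_intros assms)

lemma computable_D_rhs [computable_intros]:
  assumes "computable X" "computable L" "computable t"
  shows "computable (\<lambda>z. D_rhs (X z) (L z) (t z))"
  unfolding D_rhs_def by (intro computable_intros assms assms[THEN computable_comp])

lemma computable_D_rule [computable_intros]:
  assumes "computable X" "computable y"
  shows "computable (\<lambda>z. D_rule (X z) (y z))"
  unfolding D_rule_def case_prod_beta by (intro computable_intros assms assms[THEN computable_comp])

lemma computable_D_rules [computable_intros]:
  assumes "computable X"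
  shows "computable (\<lambda>z. D_rules (X z))"
  unfolding D_rules_def by (intro computable_intros assms assms[THEN computable_comp])

section \<open>Codes of transducers\<close>

text \<open>Rules are presented as coded lists of components, whereas \<open>enc\<close> codes
  tuples by nested pairs; passing through lists of numbers reconciles the two.\<close>

definition att_rule_items :: "nat_att_rule \<Rightarrow> nat list" where
  "att_rule_items r = [enc (fst r), enc (fst (snd r)), enc (snd (snd r))]"

definition items_att_rule :: "nat list \<Rightarrow> nat_att_rule" where
  "items_att_rule l = (dec (item 0 l), dec (item 1 l), dec (item 2 l))"

lemma items_att_rule_items [simp]: "items_att_rule (att_rule_items r) = r"
  by (simp add: items_att_rule_def att_rule_items_def item_def)

definition bu_rule_items :: "nat \<times> nat list \<times> nat \<times> nat \<Rightarrow> nat list" where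
  "bu_rule_items r = [fst r, enc (fst (snd r)), fst (snd (snd r)), snd (snd (snd r))]"

definition items_bu_rule :: "nat list \<Rightarrow> nat \<times> nat list \<times> nat \<times> nat" where
  "items_bu_rule l = (item 0 l, dec (item 1 l), item 2 l, item 3 l)"

lemma items_bu_rule_items [simp]: "items_bu_rule (bu_rule_items r) = r"
  by (simp add: items_bu_rule_def bu_rule_items_def item_def)

lemma computable_rule_items [computable_intros]:
  "computable f \<Longrightarrow> computable (\<lambda>x. att_rule_items (f x))"
  "computable g \<Longrightarrow> computable (\<lambda>x. bu_rule_items (g x))"
  "computable h \<Longrightarrow> computable (\<lambda>x. items_att_rule (h x))"
  "computable h \<Longrightarrow> computable (\<lambda>x. items_bu_rule (h x))"
  unfolding att_rule_items_def bu_rule_items_def items_att_rule_def items_bu_rule_def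
  by (intro computable_intros; assumption)+

lemma enc_nat_list: "enc (xs :: nat list) = list_encode xs"
  by (simp add: enc_list_def enc_nat_def[abs_def])

lemma att_rule_code_eq: "att_rule_code r = enc (att_rule_items r)"
proof -
  obtain x l \<xi> where r: "r = (x, l, \<xi>)" by (metis surj_pair)
  have "symbol_code x = enc x" by (cases x) (simp_all add: enc_option_def)
  moreover have "prod_encode = (enc :: nat \<times> nat \<Rightarrow> nat)"
    by (auto simp: enc_prod_def)
  moreover have "map_tree (\<lambda>y. sum_encode (map_sum id prod_encode y)) \<xi> = map_tree enc \<xi>"
    by (rule tree.map_cong0) (auto simp: enc_sum_def enc_prod_def map_sum_def split: sum.split)
  ultimately show ?thesis
    by (simp only: r att_rule_code_def att_rule_items_def enc_nat_list enc_tree_def prod.case fst_conv snd_conv)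
qed

lemma bu_rule_code_eq: "bu_rule_code r = enc (bu_rule_items r)"
proof -
  obtain f ps p g where r: "r = (f, ps, p, g)" by (metis surj_pair)
  show ?thesis
    by (simp only: r bu_rule_code_def bu_rule_items_def enc_nat_list prod.case fst_conv snd_conv)
qed

lemma set_code_nat: "set_code id X n \<longleftrightarrow> (\<exists>xs :: nat list. set xs = X \<and> n = enc xs)"
  by (simp add: set_code_def enc_nat_list)

lemma prod_encode_eq_enc: "prod_encode = (enc :: nat \<times> nat \<Rightarrow> nat)"
  by (auto simp: enc_prod_def)

lemma set_code_prod: "set_code prod_encode X n \<longleftrightarrow> (\<exists>xs :: (nat \<times> nat) list. set xs = X \<and> n = enc xs)"
  by (simp only: set_code_def enc_list_def prod_encode_eq_enc)

lemma set_code_items: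
  assumes "\<And>r. c r = enc (f r)"
  shows "set_code c X n \<longleftrightarrow> (\<exists>xs. set xs = X \<and> n = enc (map f xs))"
proof -
  have "c = (\<lambda>r. enc (f r))" using assms by blast
  then show ?thesis by (simp add: set_code_def enc_list_def o_def)
qed

definition att_encode :: "nat list \<Rightarrow> nat list \<Rightarrow> (nat \<times> nat) list \<Rightarrow> (nat \<times> nat) list \<Rightarrow> nat \<Rightarrow>
    nat_att_rule list \<Rightarrow> nat" where
  "att_encode s i a b q r = enc [enc s, enc i, enc a, enc b, q, enc (map att_rule_items r)]"

definition bu_encode :: "nat list \<Rightarrow> (nat \<times> nat) list \<Rightarrow> (nat \<times> nat) list \<Rightarrow> nat list \<Rightarrow>
    (nat \<times> nat list \<times> nat \<times> nat) list \<Rightarrow> nat" where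
  "bu_encode s a b e r = enc [enc s, enc a, enc b, enc e, enc (map bu_rule_items r)]"

lemma att_code_iff: "att_code A n \<longleftrightarrow> (\<exists>s i a b r. set s = syn A \<and> set i = inh A \<and>
    set a = in_alph A \<and> set b = out_alph A \<and> set r = rules A \<and> n = att_encode s i a b (init A) r)"
  unfolding att_code_def set_code_nat set_code_prod set_code_items[OF att_rule_code_eq] att_encode_def
    enc_nat_list[of "[_, _, _, _, _, _]"]
  by blast

lemma bu_code_iff: "bu_code B n \<longleftrightarrow> (\<exists>s a b e r. set s = states B \<and> set a = bu_in B \<and>
    set b = bu_out B \<and> set e = final B \<and> set r = bu_rules B \<and> n = bu_encode s a b e r)"
  unfolding bu_code_def set_code_nat set_code_prod set_code_items[OF bu_rule_code_eq] bu_encode_def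
    enc_nat_list[of "[_, _, _, _, _]"]
  by blast

lemma attU_code_iff: "attU_code ((B, T), A) n \<longleftrightarrow>
    (\<exists>b t a. bu_code B b \<and> att_code T t \<and> att_code A a \<and> n = enc [b, t, a])"
  by (simp only: attU_code_def enc_nat_list prod.case)

definition construct :: "nat list \<Rightarrow> (nat \<times> nat) list \<Rightarrow> (nat \<times> nat) list \<Rightarrow> nat list \<Rightarrow>
    (nat \<times> nat list \<times> nat \<times> nat) list \<Rightarrow> nat list \<Rightarrow> (nat \<times> nat) list \<Rightarrow> nat \<Rightarrow> nat_att_rule list \<Rightarrow>
    att_data \<Rightarrow> (nat \<times> nat) list \<Rightarrow> nat \<Rightarrow> nat" where
  "construct sB aB bB fB rB ST oT q0 RT X oA a0 = enc [
     bu_encode (B_states X ST sB) aB (B_out X ST bB) (B_states X ST fB) (B_rules X ST RT rB),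
     att_encode (map enc (T_states X ST)) [] (B_out X ST bB) (T_out X oT) (enc (q0, None :: plan option))
       (T_rules X a0 ST RT bB),
     att_encode (D_syn X) (D_inh X) (T_out X oT) oA (enc (a0, 0 :: nat)) (D_rules X)]"

text \<open>The positions are those of \<open>bu_encode\<close> and \<open>att_encode\<close>. Item
  2 of \<open>b\<close> also serves as input alphabet of the top-down relabeling, and item 3 of
  \<open>t\<close> as that of the attributed transducer.\<close>

definition determinize_parts :: "nat list \<Rightarrow> nat list \<Rightarrow> nat list \<Rightarrow> nat" where
  "determinize_parts b t a = construct (dec (item 0 b)) (dec (item 1 b)) (dec (item 2 b)) (dec (item 3 b))
    (map items_bu_rule (dec (item 4 b))) (dec (item 0 t)) (dec (item 3 t)) (item 4 t)
    (map items_att_rule (dec (item 5 t)))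
    (dec (item 0 a), dec (item 1 a), map items_att_rule (dec (item 5 a))) (dec (item 3 a)) (item 4 a)"

definition determinize :: "nat \<Rightarrow> nat" where
  "determinize n = determinize_parts (dec (item 0 (dec n))) (dec (item 1 (dec n))) (dec (item 2 (dec n)))"

lemma computable_construct:
  assumes "computable sB" "computable aB" "computable bB" "computable fB" "computable rB"
    "computable ST" "computable oT" "computable q0" "computable RT" "computable X" "computable oA"
    "computable a0"
  shows "computable (\<lambda>z. construct (sB z) (aB z) (bB z) (fB z) (rB z) (ST z) (oT z) (q0 z) (RT z) (X z)
    (oA z) (a0 z))"
  unfolding construct_def bu_encode_def att_encode_def by (intro computable_intros assms)

lemma computable_determinize: "computable determinize"
  unfolding determinize_def determinize_parts_def
  by (intro computable_construct computable_intros)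

lemma determinize_encode:
  "determinize (enc [bu_encode sB aB bB fB rB, att_encode ST iT aT oT q0 RT, att_encode S I aA oA a0 R]) =
    construct sB aB bB fB rB ST oT q0 RT (S, I, R) oA a0"
  unfolding determinize_def determinize_parts_def bu_encode_def att_encode_def
  by (simp add: item_def o_def)

lemma determinize_correct:
  assumes M: "is_attU M" "single_valued (attU_translation M)" "attU_code M n"
  shows "\<exists>N. attU_code N (determinize n) \<and> is_dattU N \<and> attU_translation N = attU_translation M"
proof -
  obtain B0 T0 A0 where M_eq: "M = ((B0, T0), A0)" by (metis surj_pair)
  from M(3) obtain b t a where n: "bu_code B0 b" "att_code T0 t" "att_code A0 a" "n = enc [b, t, a]"
    by (auto simp: M_eq attU_code_iff)
  from n(1) obtain sB aB bB fB rB where b: "set sB = states B0" "set aB = bu_in B0" "set bB = bu_out B0"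
    "set fB = final B0" "set rB = bu_rules B0" "b = bu_encode sB aB bB fB rB"
    by (auto simp: bu_code_iff)
  from n(2) obtain ST iT aT oT RT where t: "set ST = syn T0" "set oT = out_alph T0"
    "set RT = rules T0" "t = att_encode ST iT aT oT (init T0) RT"
    by (auto simp: att_code_iff)
  from n(3) obtain S I aA oA R where a: "set S = syn A0" "set I = inh A0" "set oA = out_alph A0"
    "set R = rules A0" "a = att_encode S I aA oA (init A0) R"
    by (auto simp: att_code_iff)
  have wf: "is_bu_relabeling B0" "is_td_relabeling T0" "is_att A0" "bu_out B0 = in_alph T0"
    "out_alph T0 = in_alph A0" "inh T0 = {}"
    using M(1) by (auto simp: M_eq is_attU_def is_look_around_def is_td_relabeling_def)
  \<comment> \<open>The lists are the enumerations fixed by the code \<open>n\<close>. The results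
    of the locale hold for all enumerations, so correctness is independent of which code is
    given.\<close>
  interpret look_around_att sB fB aB bB rB ST oT "init T0" RT S I oA "init A0" R B0 T0 A0
    using b t a wf by unfold_locales simp_all
  let ?N = "((B, T), D)"
  have "determinize n = construct sB aB bB fB rB ST oT (init T0) RT X oA (init A0)"
    by (simp add: n(4) b(6) t(4) a(5) determinize_encode X_def)
  then have "attU_code ?N (determinize n)"
    unfolding attU_code_iff bu_code_iff att_code_iff construct_def
    by (intro exI conjI; (rule refl)?) (simp_all add: B_def T_def D_def)
  then show ?thesis
    using is_dattU translation_eq M(2) unfolding M_eq by blast
qed

section \<open>The identity as a look-around\<close>

text \<open>With an identity look-around, a transducer without look-around becomes an instance of
  the other case. One state, named 0, suffices for each relabeling.\<close>

definition id_bu :: "(nat \<times> nat) list \<Rightarrow> (nat, nat, nat) bu" where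
  "id_bu a = \<lparr>states = {0}, bu_in = set a, bu_out = set a, final = {0},
    bu_rules = (\<lambda>(f, k). (f, replicate k 0, 0, f)) ` set a\<rparr>"

definition id_td :: "(nat \<times> nat) list \<Rightarrow> (nat, nat, nat) att" where
  "id_td a = \<lparr>syn = {0}, inh = {}, in_alph = set a, out_alph = set a, init = 0,
    rules = (\<lambda>(f, k). (Some f, (0, 0), td_rhs f (replicate k 0))) ` set a\<rparr>"

lemma bu_run_id: "bu_run (id_bu a) s p s' \<longleftrightarrow> p = 0 \<and> s' = s \<and> s \<in> trees (set a)"
proof
  assume "bu_run (id_bu a) s p s'"
  then show "p = 0 \<and> s' = s \<and> s \<in> trees (set a)"
  proof (induction rule: bu_run.induct)
    case (1 f ps p g ts ts')
    then have "ts' = ts" by (auto intro: nth_equalityI)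
    then show ?case using 1 by (auto simp: id_bu_def Node_in_trees_iff in_set_conv_nth)
  qed
next
  have "s \<in> trees (set a) \<Longrightarrow> bu_run (id_bu a) s 0 s"
  proof (induction s rule: tree.induct)
    case (Node f ts)
    then show ?case
      by (intro bu_run.intros[where ps = "replicate (length ts) 0"])
        (auto simp: id_bu_def Node_in_trees_iff image_iff intro!: bexI[of _ "(f, length ts)"])
  qed
  then show "p = 0 \<and> s' = s \<and> s \<in> trees (set a) \<Longrightarrow> bu_run (id_bu a) s p s'" by blast
qed

lemma is_bu_relabeling_id: "ranked_alphabet (set a) \<Longrightarrow> is_bu_relabeling (id_bu a)"
  by (auto simp: is_bu_relabeling_def id_bu_def)

lemma is_td_relabeling_id:
  assumes "ranked_alphabet (set a)"
  shows "is_td_relabeling (id_td a)"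
proof -
  have "is_att_rule (id_td a) r" if "r \<in> rules (id_td a)" for r
  proof -
    from that obtain f k where "(f, k) \<in> set a" "r = (Some f, (0, 0), td_rhs f (replicate k 0))"
      by (auto simp: id_td_def)
    then show ?thesis
      by (auto simp: id_td_def is_att_rule_def td_rhs_def intro!: exI[of _ k])
  qed
  moreover have "deterministic (id_td a)"
    using assms by (auto simp: deterministic_def id_td_def ranked_alphabet_def dest: single_valuedD)
  ultimately have "is_datt (id_td a)"
    using assms by (simp add: is_datt_def is_att_def id_td_def)
  moreover have "case r of (x, l, \<xi>) \<Rightarrow> \<exists>f g qs. x = Some f \<and> (f, length qs) \<in> in_alph (id_td a) \<and>
      (g, length qs) \<in> out_alph (id_td a) \<and> \<xi> = td_rhs g qs" if "r \<in> rules (id_td a)" for r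
  proof -
    from that obtain f k where "(f, k) \<in> set a" "r = (Some f, (0, 0), td_rhs f (replicate k 0))"
      by (auto simp: id_td_def)
    then show ?thesis by (auto simp: id_td_def)
  qed
  moreover have "inh (id_td a) = {}" by (simp add: id_td_def)
  ultimately show ?thesis unfolding is_td_relabeling_def td_rhs_def by blast
qed

lemma td_run_id:
  assumes "ranked_alphabet (set a)"
  shows "td_run (id_td a) 0 s s' \<longleftrightarrow> s' = s \<and> s \<in> trees (set a)"
proof
  assume run: "td_run (id_td a) 0 s s'"
  have "s \<in> trees (set a)" using td_run_in[OF is_td_relabeling_id[OF assms] run] by (simp add: id_td_def)
  moreover have "td_run (id_td a) q s s' \<Longrightarrow> s' = s" for q
  proof (induction rule: td_run.induct)
    case (1 g q h qs ts us)
    then have "us = ts" by (auto intro: nth_equalityI)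
    then show ?case using 1(1) by (auto simp: id_td_def)
  qed
  ultimately show "s' = s \<and> s \<in> trees (set a)" using run by blast
next
  have "s \<in> trees (set a) \<Longrightarrow> td_run (id_td a) 0 s s"
  proof (induction s rule: tree.induct)
    case (Node f ts)
    then show ?case
      by (intro td_run.intros[where qs = "replicate (length ts) 0"])
        (auto simp: id_td_def Node_in_trees_iff image_iff intro!: bexI[of _ "(f, length ts)"])
  qed
  then show "s' = s \<and> s \<in> trees (set a) \<Longrightarrow> td_run (id_td a) 0 s s'" by blast
qed

lemma attU_id:
  assumes A: "is_att A" "set a = in_alph A"
  shows "is_attU ((id_bu a, id_td a), A)" "attU_translation ((id_bu a, id_td a), A) = att_translation A"
proof -
  have ra: "ranked_alphabet (set a)" using A by (simp add: is_att_def)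
  note td = is_td_relabeling_id[OF ra]
  show "is_attU ((id_bu a, id_td a), A)"
    using is_bu_relabeling_id[OF ra] td A
    by (simp add: is_attU_def is_look_around_def) (simp add: id_bu_def id_td_def)
  have "bu_translation (id_bu a) = Id_on (trees (set a))"
    by (auto simp: bu_translation_def bu_run_id) (auto simp: id_bu_def)
  moreover have "att_translation (id_td a) = Id_on (trees (set a))"
  proof -
    have "init (id_td a) = 0" "in_alph (id_td a) = set a" by (simp_all add: id_td_def)
    then show ?thesis by (auto simp: td_translation_iff[OF td] td_run_id[OF ra])
  qed
  ultimately show "attU_translation ((id_bu a, id_td a), A) = att_translation A"
    using A(2) by (auto simp: attU_translation_def look_around_translation_def att_translation_def)
qed

text \<open>Item 2 of a transducer code is the input alphabet, from which both identity relabelings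
  are written down; \<open>n\<close> becomes the third component as it is.\<close>

definition add_id :: "nat \<Rightarrow> nat" where
  "add_id n = (let a = dec (item 2 (dec n)) in
    enc [bu_encode [0] a a [0] (map (\<lambda>y. (fst y, replicate (snd y) 0, 0, fst y)) a),
      att_encode [0] [] a a 0 (map (\<lambda>y. (Some (fst y), (0, 0),
        Node (Inl (fst y)) (map (\<lambda>i. Node (Inr (0, Suc i)) []) [0..<snd y]))) a), n])"

lemma computable_add_id: "computable add_id"
  unfolding add_id_def Let_def bu_encode_def att_encode_def by (intro computable_intros)

lemma add_id_correct:
  assumes "att_code A n"
  shows "\<exists>a. set a = in_alph A \<and> attU_code ((id_bu a, id_td a), A) (add_id n)"
proof -
  from assms obtain s i a b r where a: "set a = in_alph A" "n = att_encode s i a b (init A) r"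
    by (auto simp: att_code_iff)
  have item: "dec (item 2 (dec n)) = a" by (simp add: a(2) att_encode_def item_def)
  let ?r = "map (\<lambda>y. (fst y, replicate (snd y) 0, 0, fst y)) a"
  let ?r' = "map (\<lambda>y. (Some (fst y), (0, 0),
        Node (Inl (fst y)) (map (\<lambda>i. Node (Inr (0, Suc i)) []) [0..<snd y]))) a"
  have rhs: "Node (Inl f) (map (\<lambda>i. Node (Inr (0, Suc i)) []) [0..<k]) = td_rhs f (replicate k 0)"
    for f k :: nat
    by (simp add: td_rhs_def)
  have "bu_code (id_bu a) (bu_encode [0] a a [0] ?r)"
    unfolding bu_code_iff
    by (rule exI[of _ "[0]"], rule exI[of _ a], rule exI[of _ a], rule exI[of _ "[0]"], rule exI[of _ ?r])
      (auto simp: id_bu_def image_iff split_beta)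
  moreover have "att_code (id_td a) (att_encode [0] [] a a 0 ?r')"
    unfolding att_code_iff
    by (rule exI[of _ "[0]"], rule exI[of _ "[]"], rule exI[of _ a], rule exI[of _ a], rule exI[of _ ?r'])
      (auto simp: id_td_def image_iff split_beta rhs)
  ultimately have "attU_code ((id_bu a, id_td a), A) (add_id n)"
    unfolding attU_code_iff add_id_def item Let_def using assms by blast
  then show ?thesis using a(1) by blast
qed

theorem corollary1:
  shows "(\<exists>f. \<forall>(A :: (nat, nat, nat) att) n.
            is_att A \<and> single_valued (att_translation A) \<and> att_code A n \<longrightarrow>
            (\<exists>(D :: (nat, nat, nat, nat, nat, nat, nat) attU) m.
              computes f [n] m \<and> attU_code D m \<and> is_dattU D \<and>
              attU_translation D = att_translation A)) \<and>
         (\<exists>f. \<forall>(A :: (nat, nat, nat, nat, nat, nat, nat) attU) n.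
            is_attU A \<and> single_valued (attU_translation A) \<and> attU_code A n \<longrightarrow>
            (\<exists>(D :: (nat, nat, nat, nat, nat, nat, nat) attU) m.
              computes f [n] m \<and> attU_code D m \<and> is_dattU D \<and>
              attU_translation D = attU_translation A))"
proof
  obtain f where f: "\<And>n. computes f [n] (determinize (add_id n))"
    using computable_comp[OF computable_determinize computable_add_id]
    unfolding computable_def enc_nat_def by blast
  have "\<exists>D m. computes f [n] m \<and> attU_code D m \<and> is_dattU D \<and>
      attU_translation D = att_translation A"
    if "is_att A" "single_valued (att_translation A)" "att_code A n"
    for A :: "(nat, nat, nat) att" and n
  proof -
    from add_id_correct[OF that(3)] obtain a where a: "set a = in_alph A"
      "attU_code ((id_bu a, id_td a), A) (add_id n)" by blast
    note id = attU_id[OF that(1) a(1)]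
    from determinize_correct[OF id(1) _ a(2)] that(2) show ?thesis
      unfolding id(2) using f by blast
  qed
  then show "\<exists>f. \<forall>(A :: (nat, nat, nat) att) n.
      is_att A \<and> single_valued (att_translation A) \<and> att_code A n \<longrightarrow>
      (\<exists>(D :: (nat, nat, nat, nat, nat, nat, nat) attU) m.
        computes f [n] m \<and> attU_code D m \<and> is_dattU D \<and> attU_translation D = att_translation A)"
    by blast
next
  obtain f where f: "\<And>n. computes f [n] (determinize n)"
    using computable_determinize unfolding computable_def enc_nat_def by blast
  show "\<exists>f. \<forall>(A :: (nat, nat, nat, nat, nat, nat, nat) attU) n.
      is_attU A \<and> single_valued (attU_translation A) \<and> attU_code A n \<longrightarrow>
      (\<exists>(D :: (nat, nat, nat, nat, nat, nat, nat) attU) m.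
        computes f [n] m \<and> attU_code D m \<and> is_dattU D \<and> attU_translation D = attU_translation A)"
    using determinize_correct f by blast
qed

end
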